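(* Consider $H_{\mathrm{mic}}=H_0+H_K+H_t+H_V$ on a single bond (two cells joined by one edge), with $U_0>0$, and let $t_b=J_\perp/2$ and $V_b=J_z$ be the quartet hopping and density interaction of its effective Hamiltonian on the empty/full manifold. (i) Pair hopping generates nearest-neighbor quartet motion at second order: the second-order contributions of $H_K$ are $$t_b^{(K)}=\frac{J_\perp^{(K)}}2=\frac{K^2}{U_0},\qquad V_b^{(K)}=J_z^{(K)}=\frac{2K^2}{U_0}.$$ (ii) In the electron-hopping-only limit $K=V_{\mathrm{nn}}=0$, quartet hopping first appears at fourth order in $t$, whereas the induced diagonal interaction begins at second order: $$t_b^{(t)}=\frac{16}3\frac{t^4}{U_0^3}+O\left(\frac{t^6}{U_0^5}\right),\qquad V_b^{(t)}=J_z^{(t)}=\frac{16}3\frac{t^2}{U_0}+O\left(\frac{t^4}{U_0^3}\right).$$ Consequently $t_b^{(t)}/V_b^{(t)}=(t/U_0)^2[1+O(t^2/U_0^2)]$, while pair hopping generates quartet motion and its induced diagonal scale at the same order $K^2/U_0$.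
   Context: Two cells $\bm R,\bm R'$; each carries four fermionic modes with creation operators $c_{\bm R,m}^\dagger$, $m=1,\dots,4$, number operators $\hat n_{\bm R,m}$, and $\hat n_{\bm R}=\sum_m\hat n_{\bm R,m}$. Define $p_{\bm R,+}^\dagger=c_{\bm R,1}^\dagger c_{\bm R,2}^\dagger$, $p_{\bm R,-}^\dagger=c_{\bm R,3}^\dagger c_{\bm R,4}^\dagger$, $q_{\bm R}^\dagger=p_{\bm R,+}^\dagger p_{\bm R,-}^\dagger$ (same for $\bm R'$). With real $K,t,V_{\mathrm{nn}}$, $$H_0=\frac{U_0}4\sum_{\bm X\in\{\bm R,\bm R'\}}\hat n_{\bm X}(4-\hat n_{\bm X}),\quad H_K=-K\sum_{\eta=\pm}\left(p_{\bm R,\eta}^\dagger p_{\bm R',\eta}+\mathrm{H.c.}\right),$$ $$H_t=-t\sum_m\left(c_{\bm R,m}^\dagger c_{\bm R',m}+\mathrm{H.c.}\right),\quad H_V=V_{\mathrm{nn}}(\hat n_{\bm R}-2)(\hat n_{\bm R'}-2).$$ Let $P$ be the projector onto the span of $|0,0\rangle$, $|4,0\rangle=q_{\bm R}^\dagger|0\rangle$, $|0,4\rangle=q_{\bm R'}^\dagger|0\rangle$, $|4,4\rangle=q_{\bm R}^\dagger q_{\bm R'}^\dagger|0\rangle$ (the ground space of $H_0$). The effective Hamiltonian is the Hermitian (des Cloizeaux) one: with $\bar P$ the spectral projector of $H_{\mathrm{mic}}$ onto the eigenspace continuously connected to the range of $P$, $H_{\mathrm{eff}}=WH_{\mathrm{mic}}W^\dagger$,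 $W=(P\bar PP)^{-1/2}P\bar P$, expanded in powers of the perturbation. It has the form $$H_{\mathrm{eff}}=\mathrm{const}-J_\perp\left(T_{\bm R}^xT_{\bm R'}^x+T_{\bm R}^yT_{\bm R'}^y\right)+J_zT_{\bm R}^zT_{\bm R'}^z,$$ with $T^+_{\bm R}=q_{\bm R}^\dagger$, $T_{\bm R}^-=q_{\bm R}$, $T^\pm=T^x\pm\mathrm iT^y$, and $T_{\bm R}^z=+\tfrac12$ on a full cell, $-\tfrac12$ on an empty cell; i.e. $-J_\perp/2=\langle4,0|H_{\mathrm{eff}}|0,4\rangle$ and $-J_z/2=\langle4,0|H_{\mathrm{eff}}|4,0\rangle-\langle4,4|H_{\mathrm{eff}}|4,4\rangle$. *)

theory Defs
  imports "HOL-Analysis.Analysis" "HOL-Library.Landau_Symbols"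
begin

section \<open>Operators on a finite-dimensional complex Hilbert space\<close>

text \<open>Vectors are \<open>complex ^ 'n\<close> in an orthonormal basis indexed by \<open>'n\<close>, operators are square matrices.\<close>

definition adj :: "complex ^ 'n ^ 'n \<Rightarrow> complex ^ 'n ^ 'n" where
  "adj A = (\<chi> i j. cnj (A $ j $ i))"

definition braket :: "complex ^ 'n \<Rightarrow> complex ^ 'n ^ 'n \<Rightarrow> complex ^ 'n \<Rightarrow> complex" where
  "braket u A v = (\<Sum>i\<in>UNIV. cnj (u $ i) * (A *v v) $ i)"

definition positive_op :: "complex ^ 'n ^ 'n \<Rightarrow> bool" where
  "positive_op A \<longleftrightarrow> adj A = A \<and> (\<forall>v. 0 \<le> Re (braket v A v))"

definition is_orth_projector_onto :: "(complex ^ 'n) set \<Rightarrow> complex ^ 'n ^ 'n \<Rightarrow> bool" where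
  "is_orth_projector_onto S Q \<longleftrightarrow> adj Q = Q \<and> Q ** Q = Q \<and> range (\<lambda>v. Q *v v) = S"

definition orth_projector :: "(complex ^ 'n) set \<Rightarrow> complex ^ 'n ^ 'n" where
  "orth_projector S = (THE Q. is_orth_projector_onto S Q)"

text \<open>A spectral projector of \<open>H\<close> projects onto the sum of the full eigenspaces belonging to some
  set \<open>\<Lambda>\<close> of eigenvalues.\<close>

definition is_spectral_projector :: "complex ^ 'n ^ 'n \<Rightarrow> complex ^ 'n ^ 'n \<Rightarrow> bool" where
  "is_spectral_projector H Q \<longleftrightarrow>
     (\<exists>\<Lambda>. is_orth_projector_onto (vec.span {v. \<exists>E\<in>\<Lambda>. H *v v = E *s v}) Q)"

text \<open>The spectral projector of \<open>H\<^sub>0 + V\<close> onto the eigenspace that is continuously connected to the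
  range of \<open>P\<close> as the perturbation is switched on along \<open>H\<^sub>0 + s V\<close>, \<open>0 \<le> s \<le> 1\<close>. Since every member of
  the family is a spectral projector, there is at most one such continuous family; it exists as long
  as the group of eigenvalues that emanates from \<open>P\<close> stays separated from the rest of the spectrum, in
  particular for all small \<open>V\<close>.\<close>

definition connected_projector ::
    "complex ^ 'n ^ 'n \<Rightarrow> complex ^ 'n ^ 'n \<Rightarrow> complex ^ 'n ^ 'n \<Rightarrow> complex ^ 'n ^ 'n" where
  "connected_projector P H\<^sub>0 V =
     (THE Q. \<exists>F. continuous_on {0..1::real} F \<and> F 0 = P \<and> F 1 = Q \<and>
        (\<forall>s\<in>{0..1}. is_spectral_projector (H\<^sub>0 + s *\<^sub>R V) (F s)))"

text \<open>\<open>A\<^sup>-\<^sup>1\<^sup>/\<^sup>2\<close> for a positive operator \<open>A\<close> on the range of \<open>P\<close>, extended by zero to the orthogonal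
  complement of that range.\<close>

definition inv_sqrt_on :: "complex ^ 'n ^ 'n \<Rightarrow> complex ^ 'n ^ 'n \<Rightarrow> complex ^ 'n ^ 'n" where
  "inv_sqrt_on P A = (THE X. positive_op X \<and> P ** X = X \<and> X ** P = X \<and> X ** X ** A = P)"

text \<open>The Hermitian (des Cloizeaux) effective Hamiltonian.\<close>

definition des_cloizeaux ::
    "complex ^ 'n ^ 'n \<Rightarrow> complex ^ 'n ^ 'n \<Rightarrow> complex ^ 'n ^ 'n \<Rightarrow> complex ^ 'n ^ 'n" where
  "des_cloizeaux P H\<^sub>0 V =
     (let Pbar = connected_projector P H\<^sub>0 V;
          W = inv_sqrt_on P (P ** Pbar ** P) ** P ** Pbar
      in W ** (H\<^sub>0 + V) ** adj W)"

section \<open>Fermionic Fock space of two cells with four modes each\<close>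

datatype cell = Cell_R | Cell_R'

datatype orbital = Orb1 | Orb2 | Orb3 | Orb4

lemma UNIV_cell: "UNIV = {Cell_R, Cell_R'}"
  using cell.exhaust by auto

lemma UNIV_orbital: "UNIV = {Orb1, Orb2, Orb3, Orb4}"
  using orbital.exhaust by auto

instance cell :: finite
  by standard (simp add: UNIV_cell)

instance orbital :: finite
  by standard (simp add: UNIV_orbital)

type_synonym mode = "cell \<times> orbital"

text \<open>The occupation number basis is indexed by the set of occupied modes.\<close>

type_synonym fock = "complex ^ (mode set)"
type_synonym fock_op = "complex ^ (mode set) ^ (mode set)"

text \<open>The ordering of the modes used for the Jordan--Wigner signs.\<close>

fun mode_index :: "mode \<Rightarrow> nat" where
  "mode_index (X, m) = (case X of Cell_R \<Rightarrow> 0 | Cell_R' \<Rightarrow> 4) +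
     (case m of Orb1 \<Rightarrow> 0 | Orb2 \<Rightarrow> 1 | Orb3 \<Rightarrow> 2 | Orb4 \<Rightarrow> 3)"

definition jw_sign :: "mode \<Rightarrow> mode set \<Rightarrow> complex" where
  "jw_sign a S = (- 1) ^ card {b\<in>S. mode_index b < mode_index a}"

definition cre :: "cell \<Rightarrow> orbital \<Rightarrow> fock_op" where
  "cre X m = (\<chi> S T. if (X, m) \<notin> T \<and> S = insert (X, m) T then jw_sign (X, m) T else 0)"

definition ann :: "cell \<Rightarrow> orbital \<Rightarrow> fock_op" where
  "ann X m = adj (cre X m)"

definition vacuum :: fock where
  "vacuum = axis {} 1"

subsection \<open>The canonical anticommutation relations\<close>

lemma mode_index_inject: "mode_index a = mode_index b \<longleftrightarrow> a = b"
  by (cases a; cases b) (auto split: cell.splits orbital.splits)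

lemma cre_apply:
  "(cre X m *v v) $ S = (if (X, m) \<in> S then jw_sign (X, m) (S - {(X, m)}) * v $ (S - {(X, m)}) else 0)"
proof -
  let ?a = "(X, m)"
  have eq: "?a \<notin> T \<and> S = insert ?a T \<longleftrightarrow> ?a \<in> S \<and> T = S - {?a}" for T
    by auto
  show ?thesis
    unfolding cre_def matrix_vector_mult_def vec_lambda_beta eq
    by (auto simp: if_distrib[of "\<lambda>x. x * _"] cong: if_cong)
qed

lemma ann_apply:
  "(ann X m *v v) $ S = (if (X, m) \<in> S then 0 else jw_sign (X, m) S * v $ insert (X, m) S)"
proof -
  have cnj: "cnj (jw_sign a T) = jw_sign a T" for a T
    by (simp add: jw_sign_def)
  show ?thesis
    unfolding ann_def adj_def cre_def matrix_vector_mult_def vec_lambda_beta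
    by (auto simp: cnj if_distrib[of "\<lambda>x. x * _"] if_distrib[of cnj] cong: if_cong)
qed

lemma jw_sign_insert:
  "a \<notin> S \<Longrightarrow> jw_sign b (insert a S) = (if mode_index a < mode_index b then - 1 else 1) * jw_sign b S"
proof -
  assume a: "a \<notin> S"
  have "{c \<in> insert a S. mode_index c < mode_index b} =
      (if mode_index a < mode_index b then insert a {c \<in> S. mode_index c < mode_index b}
       else {c \<in> S. mode_index c < mode_index b})"
    by auto
  with a show ?thesis
    by (simp add: jw_sign_def)
qed

lemma jw_sign_remove:
  "a \<in> S \<Longrightarrow> jw_sign b (S - {a}) = (if mode_index a < mode_index b then - 1 else 1) * jw_sign b S"
  using jw_sign_insert[of a "S - {a}" b] by (auto simp: insert_absorb)

lemma jw_sign_square: "jw_sign a S * jw_sign a S = 1"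
  by (simp add: jw_sign_def flip: power_mult_distrib)

lemma car_cre_cre: "cre X m ** cre Y k + cre Y k ** cre X m = 0"
proof -
  have "((cre X m ** cre Y k + cre Y k ** cre X m) *v v) $ S = 0" for v S
  proof (cases "(X, m) = (Y, k)")
    case True
    have "((cre X m ** cre X m) *v v) $ S = 0"
      by (simp add: cre_apply flip: matrix_vector_mul_assoc)
    with True show ?thesis
      unfolding matrix_vector_mult_add_rdistrib vector_add_component by auto
  next
    case False
    have idx: "mode_index (X, m) < mode_index (Y, k) \<longleftrightarrow> \<not> mode_index (Y, k) < mode_index (X, m)"
      using False mode_index_inject[of "(X, m)" "(Y, k)"] by linarith
    have comm: "S - {(X, m)} - {(Y, k)} = S - {(Y, k)} - {(X, m)}"
      by blast
    show ?thesis
      using False idx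
      by (auto simp del: mode_index.simps
          simp: matrix_vector_mult_add_rdistrib cre_apply jw_sign_remove comm
          simp flip: matrix_vector_mul_assoc)
  qed
  then show ?thesis
    by (simp add: matrix_eq vec_eq_iff)
qed

lemma car_ann_cre:
  "ann X m ** cre Y k + cre Y k ** ann X m = (if (X, m) = (Y, k) then mat 1 else 0)"
proof -
  have "((ann X m ** cre Y k + cre Y k ** ann X m) *v v) $ S =
      ((if (X, m) = (Y, k) then mat 1 else 0) *v v) $ S" for v S
  proof (cases "(X, m) = (Y, k)")
    case True
    then show ?thesis
      by (auto simp: matrix_vector_mult_add_rdistrib cre_apply ann_apply insert_absorb jw_sign_square
          simp flip: matrix_vector_mul_assoc mult.assoc)
  next
    case False
    have idx: "mode_index (X, m) < mode_index (Y, k) \<longleftrightarrow> \<not> mode_index (Y, k) < mode_index (X, m)"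
      using False mode_index_inject[of "(X, m)" "(Y, k)"] by linarith
    have comm: "insert (X, m) S - {(Y, k)} = insert (X, m) (S - {(Y, k)})"
      using False by blast
    show ?thesis
      using False idx
      by (auto simp del: mode_index.simps
          simp: matrix_vector_mult_add_rdistrib cre_apply ann_apply jw_sign_remove jw_sign_insert comm
          simp flip: matrix_vector_mul_assoc)
  qed
  then show ?thesis
    by (simp add: matrix_eq vec_eq_iff)
qed

section \<open>The microscopic Hamiltonian of a single bond\<close>

definition num :: "cell \<Rightarrow> fock_op" where
  "num X = (\<Sum>m\<in>UNIV. cre X m ** ann X m)"

text \<open>The pair index \<open>\<eta> = +\<close> is \<open>True\<close>, \<open>\<eta> = -\<close> is \<open>False\<close>.\<close>

definition pair_cre :: "cell \<Rightarrow> bool \<Rightarrow> fock_op" where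
  "pair_cre X \<eta> = (if \<eta> then cre X Orb1 ** cre X Orb2 else cre X Orb3 ** cre X Orb4)"

definition quartet_cre :: "cell \<Rightarrow> fock_op" where
  "quartet_cre X = pair_cre X True ** pair_cre X False"

definition plus_hc :: "fock_op \<Rightarrow> fock_op" where
  "plus_hc A = A + adj A"

definition H_onsite :: "real \<Rightarrow> fock_op" where
  "H_onsite U\<^sub>0 = (U\<^sub>0 / 4) *\<^sub>R (\<Sum>X\<in>UNIV. num X ** (mat 4 - num X))"

definition H_pair :: "real \<Rightarrow> fock_op" where
  "H_pair K = (- K) *\<^sub>R (\<Sum>\<eta>\<in>UNIV. plus_hc (pair_cre Cell_R \<eta> ** adj (pair_cre Cell_R' \<eta>)))"

definition H_hop :: "real \<Rightarrow> fock_op" where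
  "H_hop t = (- t) *\<^sub>R (\<Sum>m\<in>UNIV. plus_hc (cre Cell_R m ** ann Cell_R' m))"

definition H_nn :: "real \<Rightarrow> fock_op" where
  "H_nn V = V *\<^sub>R ((num Cell_R - mat 2) ** (num Cell_R' - mat 2))"

definition ket00 :: fock where "ket00 = vacuum"
definition ket40 :: fock where "ket40 = quartet_cre Cell_R *v vacuum"
definition ket04 :: fock where "ket04 = quartet_cre Cell_R' *v vacuum"
definition ket44 :: fock where "ket44 = (quartet_cre Cell_R ** quartet_cre Cell_R') *v vacuum"

definition P_ground :: fock_op where
  "P_ground = orth_projector (vec.span {ket00, ket40, ket04, ket44})"

definition H_eff :: "real \<Rightarrow> real \<Rightarrow> real \<Rightarrow> real \<Rightarrow> fock_op" where
  "H_eff U\<^sub>0 K t V = des_cloizeaux P_ground (H_onsite U\<^sub>0) (H_pair K + H_hop t + H_nn V)"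

definition J_perp :: "real \<Rightarrow> real \<Rightarrow> real \<Rightarrow> real \<Rightarrow> complex" where
  "J_perp U\<^sub>0 K t V = - 2 * braket ket40 (H_eff U\<^sub>0 K t V) ket04"

definition J_z :: "real \<Rightarrow> real \<Rightarrow> real \<Rightarrow> real \<Rightarrow> complex" where
  "J_z U\<^sub>0 K t V =
     - 2 * (braket ket40 (H_eff U\<^sub>0 K t V) ket40 - braket ket44 (H_eff U\<^sub>0 K t V) ket44)"

definition t_b :: "real \<Rightarrow> real \<Rightarrow> real \<Rightarrow> real \<Rightarrow> complex" where
  "t_b U\<^sub>0 K t V = J_perp U\<^sub>0 K t V / 2"

definition V_b :: "real \<Rightarrow> real \<Rightarrow> real \<Rightarrow> real \<Rightarrow> complex" where
  "V_b U\<^sub>0 K t V = J_z U\<^sub>0 K t V"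

section \<open>Expansion in powers of the perturbation\<close>

text \<open>\<open>c\<close> is the (unique) coefficient of order \<open>n\<close> in the expansion of \<open>f\<close> about 0.\<close>

definition order_coeff :: "nat \<Rightarrow> (real \<Rightarrow> complex) \<Rightarrow> complex \<Rightarrow> bool" where
  "order_coeff n f c \<longleftrightarrow>
     (\<exists>a. a n = c \<and>
        (\<lambda>x. f x - (\<Sum>k\<le>n. a k * of_real x ^ k)) \<in> O[at 0](\<lambda>x. of_real x ^ Suc n))"

text \<open>The contribution of the pair hopping to the term of order \<open>n\<close> of a function \<open>f K t V\<close> of the
  couplings: all couplings are scaled by the same formal parameter \<open>x\<close>, and \<open>c\<close> is the part of the
  coefficient of \<open>x\<^sup>n\<close> that disappears when \<open>H_pair\<close> is switched off. It includes cross terms between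
  \<open>K\<close> and the other couplings, so that asking for one \<open>c\<close> for all \<open>t\<close> and \<open>V\<close> also says that these
  vanish. For \<open>t = V = 0\<close> it is the coefficient of order \<open>n > 0\<close> in powers of \<open>H_pair\<close> alone.\<close>

definition pair_hopping_contribution ::
    "nat \<Rightarrow> (real \<Rightarrow> real \<Rightarrow> real \<Rightarrow> complex) \<Rightarrow> real \<Rightarrow> complex \<Rightarrow> bool" where
  "pair_hopping_contribution n f K c \<longleftrightarrow>
     (\<forall>t V. \<exists>a b.
        order_coeff n (\<lambda>x. f (x * K) (x * t) (x * V)) a \<and>
        order_coeff n (\<lambda>x. f 0 (x * t) (x * V)) b \<and> c = a - b)"

text \<open>The regime \<open>g / U\<^sub>0 \<rightarrow> 0\<close>, \<open>g \<noteq> 0\<close>, for a coupling \<open>g\<close> and any \<open>U\<^sub>0 > 0\<close>. Landau symbols over this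
  filter have constants that depend neither on \<open>g\<close> nor on \<open>U\<^sub>0\<close>.\<close>

definition weak_coupling :: "(real \<times> real) filter" where
  "weak_coupling = inf (filtercomap (\<lambda>(U\<^sub>0, g). g / U\<^sub>0) (at 0)) (principal {(U\<^sub>0, g). U\<^sub>0 > 0})"

lemma eventually_weak_coupling:
  "eventually Q weak_coupling \<longleftrightarrow>
     (\<exists>\<delta>>0. \<forall>U\<^sub>0>0. \<forall>g. g \<noteq> 0 \<and> \<bar>g\<bar> < \<delta> * U\<^sub>0 \<longrightarrow> Q (U\<^sub>0, g))"
proof
  assume "eventually Q weak_coupling"
  then obtain R where R: "eventually R (at (0::real))"
    and RQ: "\<And>U\<^sub>0 g. R (g / U\<^sub>0) \<Longrightarrow> U\<^sub>0 > 0 \<Longrightarrow> Q (U\<^sub>0, g)"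
    unfolding weak_coupling_def eventually_inf_principal eventually_filtercomap by auto
  from R obtain \<delta> where "\<delta> > 0" and \<delta>: "\<And>x. x \<noteq> 0 \<Longrightarrow> \<bar>x\<bar> < \<delta> \<Longrightarrow> R x"
    by (auto simp: eventually_at dist_real_def)
  show "\<exists>\<delta>>0. \<forall>U\<^sub>0>0. \<forall>g. g \<noteq> 0 \<and> \<bar>g\<bar> < \<delta> * U\<^sub>0 \<longrightarrow> Q (U\<^sub>0, g)"
    using \<open>\<delta> > 0\<close> by (intro exI[of _ \<delta>]) (auto intro!: RQ \<delta> simp: abs_divide divide_less_eq)
next
  assume "\<exists>\<delta>>0. \<forall>U\<^sub>0>0. \<forall>g. g \<noteq> 0 \<and> \<bar>g\<bar> < \<delta> * U\<^sub>0 \<longrightarrow> Q (U\<^sub>0, g)"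
  then obtain \<delta> where "\<delta> > 0"
    and \<delta>: "\<And>U\<^sub>0 g. U\<^sub>0 > 0 \<Longrightarrow> g \<noteq> 0 \<Longrightarrow> \<bar>g\<bar> < \<delta> * U\<^sub>0 \<Longrightarrow> Q (U\<^sub>0, g)"
    by blast
  have "eventually (\<lambda>x. x \<noteq> 0 \<and> \<bar>x\<bar> < \<delta>) (at (0::real))"
    using \<open>\<delta> > 0\<close> by (auto simp: eventually_at dist_real_def)
  then show "eventually Q weak_coupling"
    unfolding weak_coupling_def eventually_inf_principal eventually_filtercomap
    by (intro exI[of _ "\<lambda>x. x \<noteq> 0 \<and> \<bar>x\<bar> < \<delta>"] conjI)
       (auto intro!: \<delta> simp: abs_divide divide_less_eq)
qed

end

theory Submission
  imports Defs
begin

text \<open>All couplings preserve, for every orbital, the number of electrons on the bond. So the empty and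
  the full bond are exact eigenvectors, and the states |4,0> and |0,4> lie in a 16-dimensional sector
  in which every orbital is occupied on exactly one cell. Exchanging the cells splits this sector
  further, and |4,0> + |0,4> and |4,0> - |0,4> have different parity. The projected eigenvectors are
  therefore already orthogonal, and the des Cloizeaux Hamiltonian is diagonal in this basis with the
  exact energies \<open>E\<^sub>e\<close>, \<open>E\<^sub>o\<close> of the two parities as eigenvalues, so that \<open>t_b = (E\<^sub>o - E\<^sub>e) / 2\<close> and
  \<open>V_b = 8 V - E\<^sub>e - E\<^sub>o\<close> when \<open>U\<^sub>0 = 1\<close>, which is no restriction by homogeneity. Permutation symmetry of
  the orbitals leaves one unknown amplitude for the odd eigenvector and three for the even one;
  eliminating them gives scalar equations \<open>E = \<Sigma>(E)\<close> with a contraction \<open>\<Sigma>\<close>, from which the expansions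
  are read off.\<close>

section \<open>The effective Hamiltonian of a separated group of eigenvalues\<close>

text \<open>\<open>connected_projector\<close> and \<open>inv_sqrt_on\<close> are definite
  descriptions, so each needs an explicit candidate together with a uniqueness argument. The
  candidate path consists of the normalised eigenvectors at couplings scaled by \<open>s\<close>.
  Hence the scalar equations must be solved on all of [0,1], continuously in \<open>s\<close>, and
  every other eigenvector must be kept away from the four energies. The weak-coupling claims ask for
  constants uniform in \<open>g / U\<close>, so all expansions are explicit inequalities instead of
  power series. The orders follow from parity (with \<open>U = 1\<close>). Odd states have no
  amplitude on doubly hopped configurations, so pair hopping alone lowers only
  \<open>E\<^sub>e\<close>, by 2 K^2 to leading order: this gives K^2 in \<open>t_b\<close> and 2
  K^2 in \<open>V_b\<close>. Electron hopping lowers both energies by 8/3 t^2, which adds up in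
  \<open>V_b\<close> and cancels in \<open>t_b\<close>. What distinguishes the parities is the term
  12 t^2 / (2 - E), the shift of the singly hopped level by the doubly hopped ones, present for even
  parity only; it enters the energy at order t^4.\<close>

definition cip :: "complex ^ 'n \<Rightarrow> complex ^ 'n \<Rightarrow> complex" where
  "cip u v = (\<Sum>i\<in>UNIV. cnj (u $ i) * v $ i)"

lemma braket_eq_cip: "braket u A v = cip u (A *v v)"
  by (simp add: braket_def cip_def)

lemma cip_add_left: "cip (u + v) w = cip u w + cip v w"
  by (simp add: cip_def distrib_right sum.distrib)

lemma cip_add_right: "cip w (u + v) = cip w u + cip w v"
  by (simp add: cip_def distrib_left sum.distrib)

lemma cip_diff_left: "cip (u - v) w = cip u w - cip v w"
  by (simp add: cip_def left_diff_distrib sum_subtractf)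

lemma cip_diff_right: "cip w (u - v) = cip w u - cip w v"
  by (simp add: cip_def right_diff_distrib sum_subtractf)

lemma cip_scale_left: "cip (c *s u) v = cnj c * cip u v"
  by (simp add: cip_def sum_distrib_left mult.assoc)

lemma cip_scale_right: "cip u (c *s v) = c * cip u v"
  by (simp add: cip_def sum_distrib_left mult.left_commute)

lemma cip_zero [simp]: "cip 0 v = 0" "cip v 0 = 0"
  by (simp_all add: cip_def)

lemma cip_sum_left: "cip (\<Sum>k\<in>A. f k) v = (\<Sum>k\<in>A. cip (f k) v)"
  by (induction A rule: infinite_finite_induct) (auto simp: cip_add_left)

lemma cip_sum_right: "cip v (\<Sum>k\<in>A. f k) = (\<Sum>k\<in>A. cip v (f k))"
  by (induction A rule: infinite_finite_induct) (auto simp: cip_add_right)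

lemmas cip_simps = cip_add_left cip_add_right cip_diff_left cip_diff_right cip_scale_left
  cip_scale_right cip_sum_left cip_sum_right

lemma cnj_cip: "cnj (cip u v) = cip v u"
  by (simp add: cip_def mult.commute)

lemma norm_sq_eq: "(norm v)\<^sup>2 = (\<Sum>i\<in>UNIV. (norm (v $ i))\<^sup>2)"
  by (simp add: norm_vec_def L2_set_def sum_nonneg)

lemma cip_self: "cip v v = complex_of_real ((norm v)\<^sup>2)"
  by (simp add: cip_def norm_sq_eq mult.commute flip: complex_norm_square)

lemma cip_self_eq_0: "cip v v = 0 \<longleftrightarrow> v = 0"
  by (simp add: cip_self)

lemma norm_cip_le: "norm (cip u v) \<le> norm u * norm v"
proof -
  have "norm (cip u v) \<le> (\<Sum>i\<in>UNIV. norm (u $ i) * norm (v $ i))"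
    unfolding cip_def by (rule order_trans[OF norm_sum]) (simp add: norm_mult)
  also have "\<dots> = (\<Sum>i\<in>UNIV. \<bar>norm (u $ i)\<bar> * \<bar>norm (v $ i)\<bar>)"
    by simp
  also have "\<dots> \<le> norm u * norm v"
    unfolding norm_vec_def by (rule L2_set_mult_ineq)
  finally show ?thesis .
qed

lemma cip_ext: "(\<And>u. cip u v = cip u w) \<Longrightarrow> v = w"
  using cip_self_eq_0[of "v - w"] by (auto simp: cip_simps)

lemma adj_component [simp]: "adj A $ i $ j = cnj (A $ j $ i)"
  by (simp add: adj_def)

lemma adj_adj [simp]: "adj (adj A) = A"
  by (simp add: vec_eq_iff)

lemma adj_add: "adj (A + B) = adj A + adj B"
  by (simp add: vec_eq_iff)

lemma adj_scaleR: "adj (c *\<^sub>R A) = c *\<^sub>R adj A"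
  by (simp add: vec_eq_iff)

lemma adj_sum: "adj (\<Sum>k\<in>S. f k) = (\<Sum>k\<in>S. adj (f k))"
proof -
  have "adj (0 :: complex ^ 'n ^ 'n) = 0"
    by (simp add: vec_eq_iff)
  then show ?thesis
    by (induction S rule: infinite_finite_induct) (auto simp: adj_add)
qed

lemma adj_mult: "adj (A ** B) = adj B ** adj A"
  by (simp add: vec_eq_iff matrix_matrix_mult_def mult.commute)

lemma cip_adj_left: "cip (adj A *v u) v = cip u (A *v v)"
proof -
  have "cip (adj A *v u) v = (\<Sum>i\<in>UNIV. \<Sum>j\<in>UNIV. A $ j $ i * cnj (u $ j) * v $ i)"
    by (simp add: cip_def matrix_vector_mult_def sum_distrib_right)
  also have "\<dots> = (\<Sum>j\<in>UNIV. \<Sum>i\<in>UNIV. A $ j $ i * cnj (u $ j) * v $ i)"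
    by (rule sum.swap)
  also have "\<dots> = cip u (A *v v)"
    by (simp add: cip_def matrix_vector_mult_def sum_distrib_left mult_ac)
  finally show ?thesis .
qed

lemma cip_adj_right: "cip u (adj A *v v) = cip (A *v u) v"
  using cip_adj_left[of "adj A" u v] by simp

lemma adj_eqI: "(\<And>u v. cip u (A *v v) = cip (A *v u) v) \<Longrightarrow> adj A = A"
  unfolding matrix_eq by (intro allI cip_ext) (simp add: cip_adj_right)

lemma scaleR_mult_vec: "(c *\<^sub>R A) *v v = c *\<^sub>R (A *v v)" for A :: "complex ^ 'n ^ 'm"
  by (simp add: vec_eq_iff matrix_vector_mult_def scaleR_sum_right)

lemma scaleR_mult_left: "(c *\<^sub>R A) ** B = c *\<^sub>R (A ** B)" for A :: "complex ^ 'n ^ 'm"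
  by (simp add: vec_eq_iff matrix_matrix_mult_def scaleR_sum_right)

lemma scaleR_mult_right: "A ** (c *\<^sub>R B) = c *\<^sub>R (A ** B)" for A :: "complex ^ 'n ^ 'm"
  by (simp add: vec_eq_iff matrix_matrix_mult_def scaleR_sum_right)

lemma scaleR_eq_scale: "c *\<^sub>R v = complex_of_real c *s v" for v :: "complex ^ 'n"
  by (simp add: vec_eq_iff) (simp add: scaleR_conv_of_real)

lemma matrix_diff_distribs:
  "A ** (B - C) = A ** B - A ** C" "(B - C) ** A = B ** A - C ** A" for A B C :: "complex ^ 'n ^ 'n"
  by (simp_all add: vec_eq_iff matrix_matrix_mult_def algebra_simps sum_subtractf)

lemma sum_mult_vec: "(\<Sum>k\<in>S. f k) *v v = (\<Sum>k\<in>S. f k *v v)"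
  by (induction S rule: infinite_finite_induct) (auto simp: matrix_vector_mult_add_rdistrib)

lemma mult_vec_sum: "A *v (\<Sum>k\<in>S. f k) = (\<Sum>k\<in>S. A *v f k)"
  by (induction S rule: infinite_finite_induct) (auto simp: matrix_vector_right_distrib)

section \<open>Rank-one operators and orthogonal projectors\<close>

definition outer :: "complex ^ 'n \<Rightarrow> complex ^ 'n \<Rightarrow> complex ^ 'n ^ 'n" where
  "outer u v = (\<chi> i j. u $ i * cnj (v $ j))"

lemma outer_mult_vec: "outer u v *v x = cip v x *s u"
  by (simp add: vec_eq_iff outer_def cip_def matrix_vector_mult_def sum_distrib_right
      sum_distrib_left mult_ac)

lemma adj_outer: "adj (outer u v) = outer v u"
  by (simp add: vec_eq_iff outer_def mult.commute)

definition orthonormal :: "('k \<Rightarrow> complex ^ 'n) \<Rightarrow> bool" where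
  "orthonormal e \<longleftrightarrow> (\<forall>k l. cip (e k) (e l) = (if k = l then 1 else 0))"

text \<open>Indexed by a family instead of a set: the vectors will move with the coupling strength
  while keeping their labels.\<close>

definition projm :: "('k::finite \<Rightarrow> complex ^ 'n) \<Rightarrow> complex ^ 'n ^ 'n" where
  "projm e = (\<Sum>k\<in>UNIV. outer (e k) (e k))"

lemma projm_mult_vec: "projm e *v x = (\<Sum>k\<in>UNIV. cip (e k) x *s e k)"
  by (simp add: projm_def sum_mult_vec outer_mult_vec)

lemma adj_projm: "adj (projm e) = projm e"
  by (simp add: projm_def adj_sum adj_outer)

lemma sum_if_scale:
  "(\<Sum>k\<in>UNIV. (if k = l then c k else 0) *s f k) = c l *s f l"
  "(\<Sum>k\<in>UNIV. (if l = k then c k else 0) *s f k) = c l *s f l"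
  for f :: "'k::finite \<Rightarrow> complex ^ 'n"
proof -
  have "(\<Sum>k\<in>UNIV. (if k = l then c k else 0) *s f k) = (\<Sum>k\<in>UNIV. if k = l then c k *s f k else 0)"
    by (rule sum.cong) auto
  then show "(\<Sum>k\<in>UNIV. (if k = l then c k else 0) *s f k) = c l *s f l"
    by simp
  then show "(\<Sum>k\<in>UNIV. (if l = k then c k else 0) *s f k) = c l *s f l"
    by (simp add: eq_commute)
qed

lemma projm_basis:
  assumes "orthonormal e"
  shows "projm e *v e k = e k"
  using assms unfolding orthonormal_def by (simp add: projm_mult_vec sum_if_scale)

lemma projm_orth_projector:
  assumes "orthonormal e"
  shows "is_orth_projector_onto (vec.span (range e)) (projm e)"
  unfolding is_orth_projector_onto_def
proof (intro conjI adj_projm)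
  show idem: "projm e ** projm e = projm e"
  proof -
    have "projm e *v (projm e *v x) = projm e *v x" for x
      by (subst (2 3) projm_mult_vec) (simp add: mult_vec_sum vector_scalar_commute projm_basis[OF assms])
    then show ?thesis
      by (simp add: matrix_eq flip: matrix_vector_mul_assoc)
  qed
  show "range (\<lambda>v. projm e *v v) = vec.span (range e)"
  proof (intro equalityI subsetI)
    fix x assume "x \<in> range (\<lambda>v. projm e *v v)"
    then show "x \<in> vec.span (range e)"
      by (auto simp: projm_mult_vec intro!: vec.span_sum vec.span_scale intro: vec.span_base)
  next
    fix x assume "x \<in> vec.span (range e)"
    then have "projm e *v x = x"
      by (induction rule: vec.span_induct_alt)
        (auto simp: matrix_vector_right_distrib vector_scalar_commute projm_basis[OF assms])
    then show "x \<in> range (\<lambda>v. projm e *v v)"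
      by (metis rangeI)
  qed
qed

lemma orth_projector_range:
  assumes "is_orth_projector_onto S Q"
  shows "v \<in> S \<longleftrightarrow> Q *v v = v"
proof
  assume "v \<in> S"
  then obtain w where "v = Q *v w"
    using assms unfolding is_orth_projector_onto_def by auto
  then show "Q *v v = v"
    using assms by (simp add: is_orth_projector_onto_def matrix_vector_mul_assoc)
next
  assume "Q *v v = v"
  then have "v \<in> range ((*v) Q)"
    by (metis rangeI)
  then show "v \<in> S"
    using assms by (simp add: is_orth_projector_onto_def)
qed

text \<open>Equal ranges give QR = R and RQ = Q; the adjoint of the first equation is RQ =
  R.\<close>

lemma orth_projector_unique:
  assumes "is_orth_projector_onto S Q" "is_orth_projector_onto S R"
  shows "Q = R"
proof -
  have "Q ** R = R" "R ** Q = Q"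
    using assms orth_projector_range[OF assms(1)] orth_projector_range[OF assms(2)]
    unfolding is_orth_projector_onto_def matrix_eq
    by (auto simp flip: matrix_vector_mul_assoc)
  then have "adj (Q ** R) = R" "R ** Q = Q"
    using assms by (auto simp: is_orth_projector_onto_def)
  then show ?thesis
    using assms by (simp add: adj_mult is_orth_projector_onto_def)
qed

lemma orth_projector_eqI: "is_orth_projector_onto S Q \<Longrightarrow> orth_projector S = Q"
  unfolding orth_projector_def using orth_projector_unique by blast

section \<open>Spectral projectors and uniqueness of the connected family\<close>

lemma eigenvectors_orthogonal:
  assumes "adj H = H" "H *v u = E *s u" "H *v v = F *s v" "E \<noteq> F"
  shows "cip u v = 0"
proof (cases "u = 0")
  case False
  have "cnj E * cip u u = E * cip u u"
    using cip_adj_left[of H u u] assms by (simp add: cip_simps)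
  then have E: "cnj E = E"
    using False by (metis (full_types) cip_self_eq_0 mult_right_cancel)
  have "cnj E * cip u v = F * cip u v"
    using cip_adj_left[of H u v] assms by (simp add: cip_simps)
  with E assms(4) show ?thesis
    by simp
qed simp

text \<open>If E is not selected, v is orthogonal to all generating eigenvectors, hence to Qv, and
  the squared norm of Qv equals the inner product of v with Qv.\<close>

lemma spectral_projector_eigenvector:
  assumes H: "adj H = H" and Q: "is_orth_projector_onto (vec.span {v. \<exists>E\<in>\<Lambda>. H *v v = E *s v}) Q"
    and v: "H *v v = E *s v"
  shows "Q *v v = (if E \<in> \<Lambda> then v else 0)"
proof (cases "E \<in> \<Lambda>")
  case True
  then have "v \<in> vec.span {v. \<exists>E\<in>\<Lambda>. H *v v = E *s v}"
    using v by (intro vec.span_base) auto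
  then show ?thesis
    using orth_projector_range[OF Q] True by simp
next
  case False
  have "Q *v v \<in> vec.span {v. \<exists>E\<in>\<Lambda>. H *v v = E *s v}"
    using Q unfolding is_orth_projector_onto_def by auto
  then have "cip v (Q *v v) = 0"
  proof (induction rule: vec.span_induct_alt)
    case (step c x y)
    then show ?case
      using eigenvectors_orthogonal[OF H v] False by (fastforce simp: cip_simps)
  qed simp
  moreover have "cip (Q *v v) (Q *v v) = cip v (Q *v v)"
    using Q cip_adj_left[of Q v "Q *v v"]
    by (simp add: is_orth_projector_onto_def matrix_vector_mul_assoc)
  ultimately show ?thesis
    using False by (simp add: cip_self_eq_0)
qed

text \<open>The range of R is spanned by eigenvectors, each of which Q fixes or kills, so Q
  preserves that range: RQR = QR. The adjoint of this equation is RQR = RQ.\<close>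

lemma spectral_projectors_commute:
  assumes H: "adj H = H" and "is_spectral_projector H Q" "is_spectral_projector H R"
  shows "Q ** R = R ** Q"
proof -
  obtain L where Q: "is_orth_projector_onto (vec.span {v. \<exists>E\<in>L. H *v v = E *s v}) Q"
    using assms by (auto simp: is_spectral_projector_def)
  obtain M where R: "is_orth_projector_onto (vec.span {v. \<exists>E\<in>M. H *v v = E *s v}) R"
    using assms by (auto simp: is_spectral_projector_def)
  have "Q *v x \<in> vec.span {v. \<exists>E\<in>M. H *v v = E *s v}"
    if "x \<in> vec.span {v. \<exists>E\<in>M. H *v v = E *s v}" for x
    using that
  proof (induction rule: vec.span_induct_alt)
    case (step c x y)
    then obtain E where "E \<in> M" "H *v x = E *s x"
      by auto
    then have "Q *v x \<in> vec.span {v. \<exists>E\<in>M. H *v v = E *s v}"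
      using spectral_projector_eigenvector[OF H Q, of x E]
      by (auto intro: vec.span_base vec.span_zero)
    with step show ?case
      by (simp add: matrix_vector_right_distrib vector_scalar_commute vec.span_add vec.span_scale)
  qed (simp add: vec.span_zero)
  then have "R *v (Q *v (R *v x)) = Q *v (R *v x)" for x
    using R unfolding orth_projector_range[OF R] is_orth_projector_onto_def
    by (metis matrix_vector_mul_assoc)
  then have RQR: "R ** Q ** R = Q ** R"
    by (simp add: matrix_eq flip: matrix_vector_mul_assoc)
  then have "adj (R ** Q ** R) = adj (Q ** R)"
    by simp
  then have "R ** Q ** R = R ** Q"
    using Q R by (simp add: adj_mult is_orth_projector_onto_def matrix_mul_assoc)
  with RQR show ?thesis
    by simp
qed

text \<open>The norm of a nested vector is the Frobenius norm. The entries of AB pair rows of A with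
  columns of B, so Cauchy-Schwarz yields the rows of \<open>adj B\<close>; for the self-adjoint
  operators of the application this is submultiplicativity.\<close>

lemma norm_matrix_mult_le: "norm (A ** B) \<le> norm A * norm (adj B)" for A B :: "complex ^ 'n ^ 'n"
proof -
  have entry: "(A ** B) $ i $ j = cip (\<chi> k. cnj (A $ i $ k)) (\<chi> k. B $ k $ j)" for i j
    by (simp add: matrix_matrix_mult_def cip_def)
  have *: "norm (\<chi> k. cnj (x $ k)) = norm x" for x :: "complex ^ 'n"
    by (simp add: norm_vec_def)
  have "norm (\<chi> k. B $ k $ j) = norm (adj B $ j)" for j
    using *[of "\<chi> k. B $ k $ j"] by (simp add: adj_def)
  then have le: "(norm ((A ** B) $ i $ j))\<^sup>2 \<le> (norm (A $ i))\<^sup>2 * (norm (adj B $ j))\<^sup>2" for i j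
    using norm_cip_le[of "\<chi> k. cnj (A $ i $ k)" "\<chi> k. B $ k $ j"]
    by (auto simp: entry * power_mult_distrib[symmetric] intro!: power_mono)
  have "(norm (A ** B))\<^sup>2 = (\<Sum>i\<in>UNIV. \<Sum>j\<in>UNIV. (norm ((A ** B) $ i $ j))\<^sup>2)"
    by (simp add: norm_vec_def L2_set_def sum_nonneg)
  also have "\<dots> \<le> (\<Sum>i\<in>UNIV. \<Sum>j\<in>UNIV. (norm (A $ i))\<^sup>2 * (norm (adj B $ j))\<^sup>2)"
    by (intro sum_mono le)
  also have "\<dots> = (norm A * norm (adj B))\<^sup>2"
    by (simp add: norm_vec_def[of A] norm_vec_def[of "adj B"] L2_set_def sum_nonneg
        power_mult_distrib sum_product)
  finally show ?thesis
    by (rule power2_le_imp_le) simp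
qed

text \<open>The difference \<open>D\<close> of two commuting projectors satisfies \<open>D\<^sup>3 = D\<close>, so its norm is 0 or at least 1.\<close>

lemma commuting_projectors_eq:
  fixes Q R :: "complex ^ 'n ^ 'n"
  assumes "adj Q = Q" "adj R = R" "Q ** Q = Q" "R ** R = R" "Q ** R = R ** Q" "norm (Q - R) < 1"
  shows "Q = R"
proof -
  define D where "D = Q - R"
  have adjD: "adj D = D"
    using assms by (simp add: D_def vec_eq_iff)
  have QQ: "Q ** (Q ** X) = Q ** X" and RR: "R ** (R ** X) = R ** X"
    and QR: "Q ** (R ** X) = R ** (Q ** X)" for X
    using assms by (simp_all add: matrix_mul_assoc)
  have "D ** (D ** D) = D"
    unfolding D_def matrix_diff_distribs QQ RR QR assms(3-5) by simp
  then have "norm D \<le> norm D * norm (D ** D)"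
    using norm_matrix_mult_le[of D "D ** D"] by (simp add: adj_mult adjD)
  also have "\<dots> \<le> norm D * (norm D * norm D)"
    using norm_matrix_mult_le[of D D] by (intro mult_left_mono) (simp_all add: adjD)
  finally have "norm D \<le> norm D * (norm D * norm D)" .
  moreover have "norm D * norm D < 1" if "norm D > 0"
    using assms(6) that mult_strict_mono[of "norm D" 1 "norm D" 1] by (simp add: D_def)
  ultimately have "norm D = 0"
    by (metis less_eq_real_def mult_less_cancel_left2 norm_ge_zero not_less)
  then show ?thesis
    by (simp add: D_def)
qed

text \<open>Uniqueness is a connectedness argument. Two families agree on a closed set of
  parameters; both members at \<open>s\<close> are spectral projectors of the same operator, hence
  commute, so distance below 1 already forces equality and the set is open as well. It contains
  0.\<close>

lemma connected_projector_eqI: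
  assumes adjH: "adj H\<^sub>0 = H\<^sub>0" "adj V = V"
    and F: "continuous_on {0..1} F" "F 0 = P"
      "\<And>s. s \<in> {0..1} \<Longrightarrow> is_spectral_projector (H\<^sub>0 + s *\<^sub>R V) (F s)"
  shows "connected_projector P H\<^sub>0 V = F 1"
proof -
  have uniq: "G 1 = F 1" if G: "continuous_on {0..1} G" "G 0 = P"
      "\<forall>s\<in>{0..1}. is_spectral_projector (H\<^sub>0 + s *\<^sub>R V) (G s)" for G
  proof -
    have eq: "G s = F s" if s: "s \<in> {0..1}" and "norm (G s - F s) < 1" for s
    proof (rule commuting_projectors_eq)
      show "G s ** F s = F s ** G s"
        using F(3) G(3) s
        by (intro spectral_projectors_commute[of "H\<^sub>0 + s *\<^sub>R V"]) (auto simp: adj_add adj_scaleR adjH)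
    qed (use that F(3)[OF s] G(3) in
        \<open>auto simp: is_spectral_projector_def is_orth_projector_onto_def\<close>)
    have cont: "continuous_on {0..1} (\<lambda>s. norm (G s - F s))"
      by (intro continuous_intros F G)
    have "closedin (top_of_set {0..1}) ({0..1} \<inter> (\<lambda>s. norm (G s - F s)) -` {0})"
      by (rule continuous_closedin_preimage[OF cont]) simp
    moreover have "openin (top_of_set {0..1}) ({0..1} \<inter> (\<lambda>s. norm (G s - F s)) -` {..<1})"
      by (rule continuous_openin_preimage_gen[OF cont]) simp
    moreover have "{0..1} \<inter> (\<lambda>s. norm (G s - F s)) -` {0} =
        {0..1} \<inter> (\<lambda>s. norm (G s - F s)) -` {..<1}"
      using eq by auto
    moreover have "0 \<in> {0..1} \<inter> (\<lambda>s. norm (G s - F s)) -` {0}"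
      using F G by simp
    moreover have "connected {0..1::real}"
      by simp
    ultimately have "{0..1} \<inter> (\<lambda>s. norm (G s - F s)) -` {0} = {0..1}"
      unfolding connected_clopen by (metis empty_iff)
    then have "1 \<in> {0..1} \<inter> (\<lambda>s. norm (G s - F s)) -` {0}"
      by simp
    then show ?thesis
      by simp
  qed
  show ?thesis
    unfolding connected_projector_def
  proof (rule the_equality)
    show "\<exists>F'. continuous_on {0..1} F' \<and> F' 0 = P \<and> F' 1 = F 1 \<and>
        (\<forall>s\<in>{0..1}. is_spectral_projector (H\<^sub>0 + s *\<^sub>R V) (F' s))"
      using F by blast
  qed (use uniq in blast)
qed

text \<open>The selected eigenvalues are the energies \<open>E k\<close>, which may coincide.
  \<open>gap\<close> says that no eigenvector for one of them is left outside the span of the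
  family.\<close>

lemma projm_spectral:
  fixes E :: "'k::finite \<Rightarrow> real"
  assumes H: "adj H = H" and e: "orthonormal e"
    and eig: "\<And>k. H *v e k = of_real (E k) *s e k"
    and gap: "\<And>v k. (\<And>l. cip (e l) v = 0) \<Longrightarrow> H *v v = of_real (E k) *s v \<Longrightarrow> v = 0"
  shows "is_spectral_projector H (projm e)"
proof -
  define \<Lambda> where "\<Lambda> = range (\<lambda>k. complex_of_real (E k))"
  have "vec.span (range e) = vec.span {v. \<exists>E\<in>\<Lambda>. H *v v = E *s v}"
  proof (intro equalityI vec.span_minimal vec.subspace_span subsetI)
    fix v assume "v \<in> range e"
    then show "v \<in> vec.span {v. \<exists>E\<in>\<Lambda>. H *v v = E *s v}"
      using eig by (intro vec.span_base) (auto simp: \<Lambda>_def)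
  next
    fix v assume "v \<in> {v. \<exists>E\<in>\<Lambda>. H *v v = E *s v}"
    then obtain k where k: "H *v v = of_real (E k) *s v"
      by (auto simp: \<Lambda>_def)
    define w where "w = v - projm e *v v"
    have orth: "cip (e l) w = 0" for l
      using cip_adj_left[of "projm e" "e l" v] adj_projm[of e] projm_basis[OF e, of l]
      by (simp add: w_def cip_simps)
    \<comment> \<open>Components of v survive only along those \<open>e l\<close> with
      \<open>E l = E k\<close>. So the projected part of v is itself an eigenvector for
      \<open>E k\<close>, and so is the remainder \<open>w\<close>, to which \<open>gap\<close>
      applies.\<close>
    have "of_real (E l) * cip (e l) v = of_real (E k) * cip (e l) v" for l
      using cip_adj_left[of H "e l" v] H eig[of l] k by (simp add: cip_simps)
    then have "H *v (projm e *v v) = of_real (E k) *s (projm e *v v)"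
      unfolding projm_mult_vec mult_vec_sum vector_scalar_commute eig vec.scale_sum_right vec.scale_scale
      by (intro sum.cong arg_cong2[where f = "(*s)"]) (simp_all add: mult.commute)
    then have "H *v w = of_real (E k) *s w"
      using k by (simp add: w_def matrix_vector_mult_diff_distrib vec.scale_right_diff_distrib)
    with orth gap have "w = 0"
      by blast
    then show "v \<in> vec.span (range e)"
      using orth_projector_range[OF projm_orth_projector[OF e]] by (simp add: w_def)
  qed
  then show ?thesis
    using projm_orth_projector[OF e] unfolding is_spectral_projector_def
    by (intro exI[of _ \<Lambda>]) simp
qed

text \<open>Existence is a direct check of the diagonal candidate. Uniqueness rests on positivity,
  which excludes the other square roots of the inverse.\<close>

lemma inv_sqrt_on_diagonal:
  fixes p :: "'k::finite \<Rightarrow> complex ^ 'n"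
  assumes p: "orthonormal p" and c: "\<And>k. c k > 0"
    and A: "\<And>v. A *v v = (\<Sum>k\<in>UNIV. (of_real ((c k)\<^sup>2) * cip (p k) v) *s p k)"
  shows "inv_sqrt_on (projm p) A = (\<Sum>k\<in>UNIV. outer (of_real (1 / c k) *s p k) (p k))"
proof -
  define Y where "Y = (\<Sum>k\<in>UNIV. outer (of_real (1 / c k) *s p k) (p k))"
  have pp: "cip (p k) (p l) = (if k = l then 1 else 0)" for k l
    using p by (simp add: orthonormal_def)
  have X: "Y *v v = (\<Sum>k\<in>UNIV. (of_real (1 / c k) * cip (p k) v) *s p k)" for v
    by (simp add: Y_def sum_mult_vec outer_mult_vec mult.commute)
  have Xp: "Y *v p k = of_real (1 / c k) *s p k" for k
    unfolding X by (simp add: pp if_distrib[of "\<lambda>x. _ * x"] sum_if_scale cong: if_cong)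
  have Ap: "A *v p k = of_real ((c k)\<^sup>2) *s p k" for k
    unfolding A by (simp add: pp if_distrib[of "\<lambda>x. _ * x"] sum_if_scale cong: if_cong)
  have "adj Y = Y"
    by (rule adj_eqI, unfold X) (simp add: cip_simps cnj_cip mult_ac)
  moreover have "0 \<le> Re (braket v Y v)" for v
  proof -
    have "braket v Y v = (\<Sum>k\<in>UNIV. of_real (1 / c k * (norm (cip (p k) v))\<^sup>2))"
      unfolding braket_eq_cip X cip_simps
      by (intro sum.cong refl) (unfold of_real_mult complex_norm_square cnj_cip, simp add: mult_ac)
    then show ?thesis
      using c by (simp add: sum_nonneg less_imp_le)
  qed
  ultimately have "positive_op Y"
    by (simp add: positive_op_def)
  moreover have "projm p ** Y = Y"
    unfolding matrix_eq matrix_vector_mul_assoc[symmetric]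
    by (simp add: X mult_vec_sum vector_scalar_commute projm_basis[OF p])
  moreover have "Y ** projm p = Y"
    unfolding matrix_eq matrix_vector_mul_assoc[symmetric]
    by (simp add: projm_mult_vec mult_vec_sum vector_scalar_commute Xp) (simp add: X mult.commute)
  moreover have "Y ** Y ** A = projm p"
    unfolding matrix_eq matrix_vector_mul_assoc[symmetric] A
    using c by (simp add: mult_vec_sum vector_scalar_commute Xp projm_mult_vec power2_eq_square less_imp_neq[THEN not_sym])
  ultimately have Y: "positive_op Y \<and> projm p ** Y = Y \<and> Y ** projm p = Y \<and> Y ** Y ** A = projm p"
    by blast
  have uniq: "X = Y" if "positive_op X \<and> projm p ** X = X \<and> X ** projm p = X \<and> X ** X ** A = projm p" for X
  proof -
    have pos: "positive_op X" and XP: "X ** projm p = X" and XXA: "X ** X ** A = projm p"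
      using that by auto
    have "X *v p k = of_real (1 / c k) *s p k" for k
    proof -
      \<comment> \<open>Since X squared acts on \<open>p k\<close> as 1 / c^2, the product (X +
        1/c)(X - 1/c) annihilates \<open>p k\<close>. Thus \<open>w\<close> satisfies the eigenvalue
        equation of the positive operator X for the negative number - 1/c, and must vanish.\<close>
      define w where "w = X *v p k - of_real (1 / c k) *s p k"
      have "X *v (X *v (A *v p k)) = p k"
        using XXA projm_basis[OF p, of k] by (metis matrix_vector_mul_assoc)
      then have "of_real ((c k)\<^sup>2) *s (X *v (X *v p k)) = p k"
        by (simp add: Ap vector_scalar_commute)
      then have "of_real ((1 / c k)\<^sup>2) *s p k =
          complex_of_real ((1 / c k)\<^sup>2 * (c k)\<^sup>2) *s (X *v (X *v p k))"
        by (metis of_real_mult vector_smult_assoc)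
      also have "(1 / c k)\<^sup>2 * (c k)\<^sup>2 = 1"
        using c[of k] by (simp add: power_divide)
      finally have "X *v (X *v p k) = of_real ((1 / c k)\<^sup>2) *s p k"
        by simp
      then have "X *v w = of_real (- (1 / c k)) *s w"
        by (simp add: w_def matrix_vector_mult_diff_distrib vector_scalar_commute
            vec.scale_right_diff_distrib power2_eq_square)
      then have "cip w (X *v w) = of_real (- (1 / c k) * (norm w)\<^sup>2)"
        by (simp only: cip_scale_right cip_self of_real_mult)
      then have "0 \<le> - (1 / c k) * (norm w)\<^sup>2"
        using pos unfolding positive_op_def braket_eq_cip by (metis Re_complex_of_real)
      then have "w = 0"
        using c[of k] by (simp add: divide_le_0_iff)
      then show ?thesis
        by (simp add: w_def)
    qed
    then have "X *v (projm p *v v) = (\<Sum>k\<in>UNIV. (of_real (1 / c k) * cip (p k) v) *s p k)" for v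
      unfolding projm_mult_vec mult_vec_sum vector_scalar_commute by (simp add: mult.commute)
    then have "(X ** projm p) *v v = Y *v v" for v
      unfolding X matrix_vector_mul_assoc[symmetric] .
    then show ?thesis
      unfolding XP by (simp add: matrix_eq)
  qed
  show ?thesis
    unfolding inv_sqrt_on_def Y_def[symmetric]
    by (rule the_equality) (use Y uniq in blast)+
qed

text \<open>A diagonal overlap matrix with positive entries is what removes any rotation within the
  ground space. P Pbar P is then diagonal with entries \<open>(c k)\<^sup>2\<close>, its inverse
  root cancels the overlaps, and W simply carries each exact eigenvector \<open>e 1 k\<close> to
  \<open>p k\<close>. Symmetry will supply the diagonality.\<close>

theorem des_cloizeaux_diagonal:
  fixes p :: "'k::finite \<Rightarrow> complex ^ 'n" and e :: "real \<Rightarrow> 'k \<Rightarrow> complex ^ 'n"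
    and E :: "real \<Rightarrow> 'k \<Rightarrow> real"
  assumes adjH: "adj H\<^sub>0 = H\<^sub>0" "adj V = V"
    and cont: "\<And>k. continuous_on {0..1} (\<lambda>s. e s k)"
    and e0: "e 0 = p"
    and e: "\<And>s. s \<in> {0..1} \<Longrightarrow> orthonormal (e s)"
    and eig: "\<And>s k. s \<in> {0..1} \<Longrightarrow> (H\<^sub>0 + s *\<^sub>R V) *v e s k = of_real (E s k) *s e s k"
    and gap: "\<And>s k v. s \<in> {0..1} \<Longrightarrow> (\<And>l. cip (e s l) v = 0) \<Longrightarrow>
        (H\<^sub>0 + s *\<^sub>R V) *v v = of_real (E s k) *s v \<Longrightarrow> v = 0"
    and overlap: "\<And>k l. cip (p k) (e 1 l) = (if k = l then of_real (c k) else 0)"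
    and c: "\<And>k. c k > 0"
  shows "des_cloizeaux (projm p) H\<^sub>0 V = (\<Sum>k\<in>UNIV. outer (of_real (E 1 k) *s p k) (p k))"
proof -
  define q where "q = e 1"
  have p: "orthonormal p" and q: "orthonormal q"
    using e[of 0] e0 e[of 1] by (auto simp: q_def)
  have pq: "cip (p k) (q l) = (if k = l then of_real (c k) else 0)" for k l
    using overlap by (simp add: q_def)
  have qp: "cip (q k) (p l) = (if k = l then of_real (c k) else 0)" for k l
    using arg_cong[OF pq[of l k], of cnj] by (auto simp: cnj_cip)
  have Pbar: "connected_projector (projm p) H\<^sub>0 V = projm q"
    unfolding q_def
  proof (rule connected_projector_eqI[OF adjH])
    show "continuous_on {0..1} (\<lambda>s. projm (e s))"
      unfolding projm_def outer_def by (intro continuous_intros cont)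
    show "is_spectral_projector (H\<^sub>0 + s *\<^sub>R V) (projm (e s))" if "s \<in> {0..1}" for s
      using that by (intro projm_spectral[where E = "E s"] e eig gap[of s])
        (auto simp: adj_add adj_scaleR adjH)
  qed (simp add: e0)
  have "(projm p ** projm q ** projm p) *v v = (\<Sum>k\<in>UNIV. (of_real ((c k)\<^sup>2) * cip (p k) v) *s p k)" for v
    unfolding matrix_vector_mul_assoc[symmetric]
    by (simp add: projm_mult_vec cip_simps pq qp sum_distrib_left sum_distrib_right if_distrib[of "\<lambda>x. _ * x"] power2_eq_square mult_ac
        cong: if_cong)
  then have inv: "inv_sqrt_on (projm p) (projm p ** projm q ** projm p) =
      (\<Sum>k\<in>UNIV. outer (of_real (1 / c k) *s p k) (p k))"
    by (rule inv_sqrt_on_diagonal[OF p c])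
  define W where "W = inv_sqrt_on (projm p) (projm p ** projm q ** projm p) ** projm p ** projm q"
  have W: "W = (\<Sum>k\<in>UNIV. outer (p k) (q k))"
    unfolding W_def inv matrix_eq matrix_vector_mul_assoc[symmetric]
    using c p unfolding orthonormal_def
    by (simp add: projm_mult_vec mult_vec_sum sum_mult_vec vector_scalar_commute outer_mult_vec cip_simps
        pq if_distrib[of "\<lambda>x. _ * x"] if_distrib[of "\<lambda>x. x / _"] sum_if_scale less_imp_neq[THEN not_sym] cong: if_cong)
  have Hq: "(H\<^sub>0 + V) *v q k = of_real (E 1 k) *s q k" for k
    using eig[of 1 k] by (simp add: q_def)
  have qq: "cip (q k) (q l) = (if k = l then 1 else 0)" for k l
    using q by (simp add: orthonormal_def)
  have "W ** (H\<^sub>0 + V) ** adj W = (\<Sum>k\<in>UNIV. outer (of_real (E 1 k) *s p k) (p k))"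
    unfolding W adj_sum adj_outer matrix_eq matrix_vector_mul_assoc[symmetric]
    by (simp add: mult_vec_sum sum_mult_vec vector_scalar_commute outer_mult_vec cip_simps
        Hq qq if_distrib[of "\<lambda>x. _ * x"] sum_if_scale mult.commute cong: if_cong)
  then show ?thesis
    by (simp add: des_cloizeaux_def Pbar Let_def W_def)
qed

section \<open>The Fock space of a bond\<close>

lemma norm_mult_vec_le: "norm (A *v v) \<le> norm A * norm v" for A :: "complex ^ 'n ^ 'm"
proof -
  have entry: "(A *v v) $ i = cip (\<chi> k. cnj (A $ i $ k)) v" for i
    by (simp add: matrix_vector_mult_def cip_def)
  have "norm (\<chi> k. cnj (A $ i $ k)) = norm (A $ i)" for i
    by (simp add: norm_vec_def)
  then have le: "(norm ((A *v v) $ i))\<^sup>2 \<le> (norm (A $ i))\<^sup>2 * (norm v)\<^sup>2" for i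
    using norm_cip_le[of "\<chi> k. cnj (A $ i $ k)" v]
    by (auto simp: entry power_mult_distrib[symmetric] intro!: power_mono)
  have "(norm (A *v v))\<^sup>2 = (\<Sum>i\<in>UNIV. (norm ((A *v v) $ i))\<^sup>2)"
    by (simp add: norm_vec_def L2_set_def sum_nonneg)
  also have "\<dots> \<le> (\<Sum>i\<in>UNIV. (norm (A $ i))\<^sup>2 * (norm v)\<^sup>2)"
    by (intro sum_mono le)
  also have "\<dots> = (norm A * norm v)\<^sup>2"
    by (simp add: norm_vec_def[of A] L2_set_def sum_nonneg power_mult_distrib sum_distrib_right)
  finally show ?thesis
    by (rule power2_le_imp_le) simp
qed

lemma sum_cell: "(\<Sum>X\<in>UNIV. f X) = f Cell_R + f Cell_R'"
  by (simp add: UNIV_cell)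

lemma sum_orbital: "(\<Sum>m\<in>UNIV. f m) = f Orb1 + (f Orb2 + (f Orb3 + f Orb4))"
  by (simp add: UNIV_orbital)

section \<open>Anticommutation relations on vectors and the sign-free transfer operators\<close>

lemma cre_cre_vec: "cre X m *v (cre Y k *v v) = - (cre Y k *v (cre X m *v v))"
  using arg_cong[OF car_cre_cre[of X m Y k], of "\<lambda>A. A *v v"]
  by (simp add: matrix_vector_mult_add_rdistrib eq_neg_iff_add_eq_0 flip: matrix_vector_mul_assoc)

lemma ann_cre_vec:
  "ann X m *v (cre Y k *v v) = (if X = Y \<and> m = k then v else 0) - cre Y k *v (ann X m *v v)"
  using arg_cong[OF car_ann_cre[of X m Y k], of "\<lambda>A. A *v v"]
  by (simp add: matrix_vector_mult_add_rdistrib eq_diff_eq split: if_splits flip: matrix_vector_mul_assoc)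

lemma ann_ann_vec: "ann X m *v (ann Y k *v v) = - (ann Y k *v (ann X m *v v))"
proof -
  have "adj (cre Y k ** cre X m + cre X m ** cre Y k) = adj 0"
    using car_cre_cre by simp
  then have "ann X m ** ann Y k + ann Y k ** ann X m = 0"
    by (simp add: adj_add adj_mult ann_def) (simp add: vec_eq_iff)
  from arg_cong[OF this, of "\<lambda>A. A *v v"] show ?thesis
    by (simp add: matrix_vector_mult_add_rdistrib eq_neg_iff_add_eq_0 flip: matrix_vector_mul_assoc)
qed

lemma ann_vacuum: "ann X m *v vacuum = 0"
  by (simp add: vec_eq_iff ann_apply vacuum_def axis_def)

lemma cip_cre_left: "cip (cre X m *v u) v = cip u (ann X m *v v)"
  using cip_adj_right[of u "cre X m" v] by (simp add: ann_def)

text \<open>Being bilinear in fermion operators, it passes creation operators without signs. Number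
  operators, electron hopping and pair hopping are all polynomials in it, so the Jordan-Wigner signs
  never enter the later computations.\<close>

definition transfer :: "cell \<Rightarrow> cell \<Rightarrow> orbital \<Rightarrow> fock_op" where
  "transfer X Y m = cre X m ** ann Y m"

lemma adj_transfer: "adj (transfer X Y m) = transfer Y X m"
  by (simp add: transfer_def adj_mult ann_def)

lemma transfer_cre:
  "transfer X Y m *v (cre Z k *v v) =
     (if Z = Y \<and> k = m then cre X m *v v else 0) + cre Z k *v (transfer X Y m *v v)"
  by (auto simp: transfer_def ann_cre_vec matrix_vector_mult_diff_distrib cre_cre_vec[of X m Z k]
      simp flip: matrix_vector_mul_assoc)

lemma transfer_vacuum: "transfer X Y m *v vacuum = 0"
  by (simp add: transfer_def ann_vacuum flip: matrix_vector_mul_assoc)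

lemma num_eq_transfer: "num X = (\<Sum>m\<in>UNIV. transfer X X m)"
  by (simp add: num_def transfer_def)

text \<open>Two signs cancel: one from moving an annihilator past a creator, with no contraction
  because X and Y differ, and one from exchanging the two annihilators.\<close>

lemma pair_hop_eq_transfer:
  assumes "X \<noteq> Y"
  shows "cre X m ** cre X k ** adj (cre Y m ** cre Y k) = transfer X Y m ** transfer X Y k"
  unfolding matrix_eq
  using assms by (simp add: transfer_def adj_mult ann_cre_vec ann_ann_vec[of Y k Y m] linear_neg[OF matrix_vector_mul_linear]
      flip: ann_def matrix_vector_mul_assoc)

lemma H_hop_eq: "H_hop t = (- t) *\<^sub>R (\<Sum>m\<in>UNIV. transfer Cell_R Cell_R' m + transfer Cell_R' Cell_R m)"
  by (simp add: H_hop_def plus_hc_def adj_transfer flip: transfer_def)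

lemma H_pair_eq: "H_pair K = (- K) *\<^sub>R
    (transfer Cell_R Cell_R' Orb1 ** transfer Cell_R Cell_R' Orb2 +
     transfer Cell_R' Cell_R Orb2 ** transfer Cell_R' Cell_R Orb1 +
     transfer Cell_R Cell_R' Orb3 ** transfer Cell_R Cell_R' Orb4 +
     transfer Cell_R' Cell_R Orb4 ** transfer Cell_R' Cell_R Orb3)"
  by (simp add: H_pair_def UNIV_bool plus_hc_def pair_cre_def pair_hop_eq_transfer adj_transfer adj_mult[of "transfer _ _ _"] add_ac)

text \<open>The configurations with each orbital occupied on exactly one cell. Creators are ordered
  by orbital, not by \<open>mode_index\<close>, so that moving an electron to the other cell
  produces no sign.\<close>

definition ket :: "cell \<Rightarrow> cell \<Rightarrow> cell \<Rightarrow> cell \<Rightarrow> fock" where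
  "ket a b c d = cre a Orb1 *v (cre b Orb2 *v (cre c Orb3 *v (cre d Orb4 *v vacuum)))"

lemma ket40_eq: "ket40 = ket Cell_R Cell_R Cell_R Cell_R"
  by (simp add: ket40_def quartet_cre_def pair_cre_def ket_def matrix_vector_mul_assoc matrix_mul_assoc)

lemma ket04_eq: "ket04 = ket Cell_R' Cell_R' Cell_R' Cell_R'"
  by (simp add: ket04_def quartet_cre_def pair_cre_def ket_def matrix_vector_mul_assoc matrix_mul_assoc)

lemma transfer_ket:
  "transfer X Y Orb1 *v ket a b c d = (if a = Y then ket X b c d else 0)"
  "transfer X Y Orb2 *v ket a b c d = (if b = Y then ket a X c d else 0)"
  "transfer X Y Orb3 *v ket a b c d = (if c = Y then ket a b X d else 0)"
  "transfer X Y Orb4 *v ket a b c d = (if d = Y then ket a b c X else 0)"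
  by (auto simp: ket_def transfer_cre transfer_vacuum)

lemma cip_vacuum: "cip vacuum vacuum = 1"
proof -
  have "cnj (vacuum $ S) * vacuum $ S = (if S = {} then 1 else 0)" for S
    by (simp add: vacuum_def axis_def)
  then show ?thesis
    by (simp add: cip_def)
qed

lemma cip_ket:
  "cip (ket a b c d) (ket a' b' c' d') = (if a = a' \<and> b = b' \<and> c = c' \<and> d = d' then 1 else 0)"
  by (auto simp: ket_def cip_cre_left ann_cre_vec ann_vacuum cip_vacuum)

fun other :: "cell \<Rightarrow> cell" where
  "other Cell_R = Cell_R'" | "other Cell_R' = Cell_R"

definition count :: "cell \<Rightarrow> cell \<Rightarrow> cell \<Rightarrow> cell \<Rightarrow> cell \<Rightarrow> real" where
  "count X a b c d = of_bool (a = X) + of_bool (b = X) + of_bool (c = X) + of_bool (d = X)"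

lemma num_ket: "num X *v ket a b c d = complex_of_real (count X a b c d) *s ket a b c d"
  by (auto simp: num_eq_transfer sum_orbital count_def matrix_vector_mult_add_rdistrib transfer_ket
      vec_eq_iff algebra_simps)

lemma mat_mult_vec: "mat c *v v = c *s v" for v :: "complex ^ 'n"
  by (simp add: vec_eq_iff mat_def matrix_vector_mult_def if_distrib[of "\<lambda>x. x * _"] cong: if_cong)

lemma numeral_mat_mult_vec [simp]: "mat (numeral n) *v v = numeral n *s v" for v :: "complex ^ 'n"
  by (rule mat_mult_vec)

lemma H_onsite_ket: "H_onsite U *v ket a b c d =
    complex_of_real (U / 4 * (\<Sum>X\<in>UNIV. count X a b c d * (4 - count X a b c d))) *s ket a b c d"
  by (simp add: H_onsite_def scaleR_mult_vec sum_cell matrix_vector_mult_diff_rdistrib num_ket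
      matrix_vector_mult_diff_distrib vector_scalar_commute scaleR_eq_scale vec_eq_iff algebra_simps
      matrix_vector_mult_add_rdistrib flip: matrix_vector_mul_assoc)

lemma H_nn_ket: "H_nn V *v ket a b c d =
    complex_of_real (V * (count Cell_R a b c d - 2) * (count Cell_R' a b c d - 2)) *s ket a b c d"
  by (simp add: H_nn_def scaleR_mult_vec matrix_vector_mult_diff_rdistrib num_ket
      matrix_vector_mult_diff_distrib vector_scalar_commute scaleR_eq_scale vec_eq_iff algebra_simps
      flip: matrix_vector_mul_assoc)

lemma H_hop_ket: "H_hop t *v ket a b c d =
    complex_of_real (- t) *s (ket (other a) b c d + ket a (other b) c d + ket a b (other c) d + ket a b c (other d))"
  unfolding H_hop_eq scaleR_mult_vec sum_orbital matrix_vector_mult_add_rdistrib transfer_ket scaleR_eq_scale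
  by (cases a; cases b; cases c; cases d) (simp_all add: add_ac)

lemma H_pair_ket: "H_pair K *v ket a b c d =
    complex_of_real (- K) *s ((if a = b then ket (other a) (other b) c d else 0) +
      (if c = d then ket a b (other c) (other d) else 0))"
  unfolding H_pair_eq scaleR_mult_vec matrix_vector_mult_add_rdistrib scaleR_eq_scale
    matrix_vector_mul_assoc[symmetric]
  by (cases a; cases b; cases c; cases d) (simp_all add: transfer_ket add_ac)

section \<open>The Hamiltonian acting on amplitudes of the sixteen configurations\<close>

type_synonym amplitude = "cell \<Rightarrow> cell \<Rightarrow> cell \<Rightarrow> cell \<Rightarrow> complex"

definition superposition :: "amplitude \<Rightarrow> fock" where
  "superposition f = (\<Sum>a\<in>UNIV. \<Sum>b\<in>UNIV. \<Sum>c\<in>UNIV. \<Sum>d\<in>UNIV. f a b c d *s ket a b c d)"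

definition hamiltonian :: "real \<Rightarrow> real \<Rightarrow> real \<Rightarrow> real \<Rightarrow> fock_op" where
  "hamiltonian U K t V = H_onsite U + (H_pair K + H_hop t + H_nn V)"

text \<open>With n electrons on one cell and 4 - n on the other, both cells have the same on-site
  energy, hence U / 2, and the neighbour term becomes - V (n - 2)^2.\<close>

definition amplitude_hamiltonian :: "real \<Rightarrow> real \<Rightarrow> real \<Rightarrow> real \<Rightarrow> amplitude \<Rightarrow> amplitude" where
  "amplitude_hamiltonian U K t V f a b c d =
     complex_of_real (U / 2 * (count Cell_R a b c d * (4 - count Cell_R a b c d)) -
       V * (count Cell_R a b c d - 2)\<^sup>2) * f a b c d
     - of_real t * (f (other a) b c d + f a (other b) c d + f a b (other c) d + f a b c (other d))
     - of_real K * ((if a = b then f (other a) (other b) c d else 0) +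
         (if c = d then f a b (other c) (other d) else 0))"

lemma count_other: "count Cell_R' a b c d = 4 - count Cell_R a b c d"
  by (cases a; cases b; cases c; cases d) (simp_all add: count_def)

lemma hamiltonian_ket: "hamiltonian U K t V *v ket a b c d =
    complex_of_real (U / 2 * (count Cell_R a b c d * (4 - count Cell_R a b c d)) -
       V * (count Cell_R a b c d - 2)\<^sup>2) *s ket a b c d
    + complex_of_real (- K) *s ((if a = b then ket (other a) (other b) c d else 0) +
      (if c = d then ket a b (other c) (other d) else 0))
    + complex_of_real (- t) *s (ket (other a) b c d + ket a (other b) c d + ket a b (other c) d + ket a b c (other d))"
proof -
  have "complex_of_real (U / 4 * (\<Sum>X\<in>UNIV. count X a b c d * (4 - count X a b c d))) *s ket a b c d
     + complex_of_real (V * (count Cell_R a b c d - 2) * (count Cell_R' a b c d - 2)) *s ket a b c d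
     = complex_of_real (U / 2 * (count Cell_R a b c d * (4 - count Cell_R a b c d)) -
       V * (count Cell_R a b c d - 2)\<^sup>2) *s ket a b c d"
    unfolding vec.scale_left_distrib[symmetric] of_real_add[symmetric]
    by (rule arg_cong[where f = "\<lambda>x. complex_of_real x *s ket a b c d"])
      (simp add: sum_cell count_other power2_eq_square field_simps)
  then show ?thesis
    unfolding hamiltonian_def matrix_vector_mult_add_rdistrib H_onsite_ket H_pair_ket H_hop_ket H_nn_ket
    by (simp add: add_ac)
qed

lemma superposition_expand:
  "superposition f =
     f Cell_R Cell_R Cell_R Cell_R *s ket Cell_R Cell_R Cell_R Cell_R +
     f Cell_R Cell_R Cell_R Cell_R' *s ket Cell_R Cell_R Cell_R Cell_R' +
     f Cell_R Cell_R Cell_R' Cell_R *s ket Cell_R Cell_R Cell_R' Cell_R +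
     f Cell_R Cell_R Cell_R' Cell_R' *s ket Cell_R Cell_R Cell_R' Cell_R' +
     f Cell_R Cell_R' Cell_R Cell_R *s ket Cell_R Cell_R' Cell_R Cell_R +
     f Cell_R Cell_R' Cell_R Cell_R' *s ket Cell_R Cell_R' Cell_R Cell_R' +
     f Cell_R Cell_R' Cell_R' Cell_R *s ket Cell_R Cell_R' Cell_R' Cell_R +
     f Cell_R Cell_R' Cell_R' Cell_R' *s ket Cell_R Cell_R' Cell_R' Cell_R' +
     f Cell_R' Cell_R Cell_R Cell_R *s ket Cell_R' Cell_R Cell_R Cell_R +
     f Cell_R' Cell_R Cell_R Cell_R' *s ket Cell_R' Cell_R Cell_R Cell_R' +
     f Cell_R' Cell_R Cell_R' Cell_R *s ket Cell_R' Cell_R Cell_R' Cell_R +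
     f Cell_R' Cell_R Cell_R' Cell_R' *s ket Cell_R' Cell_R Cell_R' Cell_R' +
     f Cell_R' Cell_R' Cell_R Cell_R *s ket Cell_R' Cell_R' Cell_R Cell_R +
     f Cell_R' Cell_R' Cell_R Cell_R' *s ket Cell_R' Cell_R' Cell_R Cell_R' +
     f Cell_R' Cell_R' Cell_R' Cell_R *s ket Cell_R' Cell_R' Cell_R' Cell_R +
     f Cell_R' Cell_R' Cell_R' Cell_R' *s ket Cell_R' Cell_R' Cell_R' Cell_R'"
  by (simp add: superposition_def sum_cell add_ac)

text \<open>An opaque wrapper: the simplifier does not expand it into sixteen terms, and reindexing
  by \<open>other\<close> becomes a rewrite rule.\<close>

definition sum4 :: "(cell \<Rightarrow> cell \<Rightarrow> cell \<Rightarrow> cell \<Rightarrow> fock) \<Rightarrow> fock" where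
  "sum4 g = (\<Sum>a\<in>UNIV. \<Sum>b\<in>UNIV. \<Sum>c\<in>UNIV. \<Sum>d\<in>UNIV. g a b c d)"

lemma other_other [simp]: "other (other a) = a"
  by (cases a) simp_all

lemma other_inject [simp]: "other a = other b \<longleftrightarrow> a = b"
  by (cases a; cases b) simp_all

lemma sum4_other:
  "sum4 (\<lambda>a b c d. g (other a) b c d) = sum4 g"
  "sum4 (\<lambda>a b c d. g a (other b) c d) = sum4 g"
  "sum4 (\<lambda>a b c d. g a b (other c) d) = sum4 g"
  "sum4 (\<lambda>a b c d. g a b c (other d)) = sum4 g"
  by (simp_all add: sum4_def sum_cell add_ac)

lemma sum4_linear:
  "sum4 (\<lambda>a b c d. g a b c d + h a b c d) = sum4 g + sum4 h"
  "sum4 (\<lambda>a b c d. x *s g a b c d) = x *s sum4 g"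
  "A *v sum4 g = sum4 (\<lambda>a b c d. A *v g a b c d)"
  by (simp_all add: sum4_def sum.distrib vec.scale_sum_right mult_vec_sum)

text \<open>The Hamiltonian moves kets; reindexing each sum by the involution \<open>other\<close>
  shifts the move to the amplitudes.\<close>

lemma hamiltonian_superposition:
  "hamiltonian U K t V *v superposition f = superposition (amplitude_hamiltonian U K t V f)"
proof -
  define D where "D a b c d = complex_of_real (U / 2 * (count Cell_R a b c d * (4 - count Cell_R a b c d)) -
       V * (count Cell_R a b c d - 2)\<^sup>2)" for a b c d
  \<comment> \<open>Indicator that a pair sits on one cell. Flipping both of its electrons leaves it
    unchanged, so it survives the reindexing.\<close>
  define p where "p a b = (if a = b then 1 else 0 :: complex)" for a b :: cell
  have p_other: "p (other a) (other b) = p a b" for a b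
    by (simp add: p_def)
  have "hamiltonian U K t V *v superposition f =
      sum4 (\<lambda>a b c d. (D a b c d * f a b c d) *s ket a b c d) +
      (complex_of_real (- K) *s
        (sum4 (\<lambda>a b c d. (p a b * f a b c d) *s ket (other a) (other b) c d) +
         sum4 (\<lambda>a b c d. (p c d * f a b c d) *s ket a b (other c) (other d))) +
      complex_of_real (- t) *s
        (sum4 (\<lambda>a b c d. f a b c d *s ket (other a) b c d) +
         (sum4 (\<lambda>a b c d. f a b c d *s ket a (other b) c d) +
         (sum4 (\<lambda>a b c d. f a b c d *s ket a b (other c) d) +
         sum4 (\<lambda>a b c d. f a b c d *s ket a b c (other d))))))"
    unfolding superposition_def sum4_def[symmetric] sum4_linear
    unfolding sum4_linear(1,2)[symmetric] vector_scalar_commute hamiltonian_ket D_def[symmetric]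
    by (intro arg_cong[where f = sum4] ext) (simp add: p_def vec_eq_iff algebra_simps)
  also have "sum4 (\<lambda>a b c d. (p a b * f a b c d) *s ket (other a) (other b) c d) =
      sum4 (\<lambda>a b c d. (p a b * f (other a) (other b) c d) *s ket a b c d)"
    using sum4_other(1)[of "\<lambda>a b c d. (p (other a) b * f (other a) b c d) *s ket a (other b) c d"]
      sum4_other(2)[of "\<lambda>a b c d. (p (other a) (other b) * f (other a) (other b) c d) *s ket a b c d"]
    by (simp add: p_other)
  also have "sum4 (\<lambda>a b c d. (p c d * f a b c d) *s ket a b (other c) (other d)) =
      sum4 (\<lambda>a b c d. (p c d * f a b (other c) (other d)) *s ket a b c d)"
    using sum4_other(3)[of "\<lambda>a b c d. (p (other c) d * f a b (other c) d) *s ket a b c (other d)"]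
      sum4_other(4)[of "\<lambda>a b c d. (p (other c) (other d) * f a b (other c) (other d)) *s ket a b c d"]
    by (simp add: p_other)
  also have "sum4 (\<lambda>a b c d. f a b c d *s ket (other a) b c d) =
      sum4 (\<lambda>a b c d. f (other a) b c d *s ket a b c d)"
    using sum4_other(1)[of "\<lambda>a b c d. f (other a) b c d *s ket a b c d"] by simp
  also have "sum4 (\<lambda>a b c d. f a b c d *s ket a (other b) c d) =
      sum4 (\<lambda>a b c d. f a (other b) c d *s ket a b c d)"
    using sum4_other(2)[of "\<lambda>a b c d. f a (other b) c d *s ket a b c d"] by simp
  also have "sum4 (\<lambda>a b c d. f a b c d *s ket a b (other c) d) =
      sum4 (\<lambda>a b c d. f a b (other c) d *s ket a b c d)"
    using sum4_other(3)[of "\<lambda>a b c d. f a b (other c) d *s ket a b c d"] by simp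
  also have "sum4 (\<lambda>a b c d. f a b c d *s ket a b c (other d)) =
      sum4 (\<lambda>a b c d. f a b c (other d) *s ket a b c d)"
    using sum4_other(4)[of "\<lambda>a b c d. f a b c (other d) *s ket a b c d"] by simp
  finally show ?thesis
    unfolding superposition_def sum4_def[symmetric] sum4_linear(1,2)[symmetric]
      amplitude_hamiltonian_def D_def[symmetric]
    by (simp only:) (intro arg_cong[where f = sum4] ext, simp add: p_def vec_eq_iff algebra_simps)
qed

lemma cip_superposition: "cip (superposition f) (superposition g) =
    (\<Sum>a\<in>UNIV. \<Sum>b\<in>UNIV. \<Sum>c\<in>UNIV. \<Sum>d\<in>UNIV. cnj (f a b c d) * g a b c d)"
  unfolding superposition_expand cip_simps cip_ket
  by (simp add: sum_cell add_ac)

section \<open>Diagonal operators and the gap of the on-site energy\<close>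

lemma adj_diagonal:
  assumes "\<And>v S. (A *v v) $ S = complex_of_real (d S) * v $ S"
  shows "adj A = A"
  by (rule adj_eqI) (simp add: cip_def assms mult_ac)

lemma num_apply: "(num X *v v) $ S = of_nat (card {m. (X, m) \<in> S}) * v $ S"
proof -
  have "(cre X m *v (ann X m *v v)) $ S = of_bool ((X, m) \<in> S) * v $ S" for m
    by (simp add: cre_apply ann_apply insert_absorb jw_sign_square flip: mult.assoc)
  then have "(num X *v v) $ S = (\<Sum>m\<in>UNIV. of_bool ((X, m) \<in> S)) * v $ S"
    by (simp add: num_def sum_mult_vec sum_distrib_right flip: matrix_vector_mul_assoc)
  also have "(\<Sum>m\<in>UNIV. of_bool ((X, m) \<in> S)) = (of_nat (card {m. (X, m) \<in> S}) :: complex)"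
    by (simp add: of_bool_def sum.If_cases)
  finally show ?thesis .
qed

definition occ :: "cell \<Rightarrow> mode set \<Rightarrow> nat" where
  "occ X S = card {m. (X, m) \<in> S}"

lemma H_onsite_apply:
  "(H_onsite U *v v) $ S = complex_of_real (U / 4 * (\<Sum>X\<in>UNIV. real (occ X S) * (4 - real (occ X S)))) * v $ S"
  by (simp add: H_onsite_def scaleR_mult_vec sum_mult_vec sum_cell matrix_vector_mult_diff_rdistrib
      num_apply occ_def matrix_vector_mult_add_rdistrib flip: matrix_vector_mul_assoc)
    (simp add: scaleR_conv_of_real algebra_simps)

lemma H_nn_apply:
  "(H_nn V *v v) $ S = complex_of_real (V * (real (occ Cell_R S) - 2) * (real (occ Cell_R' S) - 2)) * v $ S"
  by (simp add: H_nn_def scaleR_mult_vec matrix_vector_mult_diff_rdistrib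
      num_apply occ_def flip: matrix_vector_mul_assoc)
    (simp add: scaleR_conv_of_real algebra_simps)

lemma adj_H_onsite: "adj (H_onsite U) = H_onsite U"
  by (rule adj_diagonal, rule H_onsite_apply)

lemma adj_H_nn: "adj (H_nn V) = H_nn V"
  by (rule adj_diagonal, rule H_nn_apply)

lemma adj_plus_hc: "adj (plus_hc A) = plus_hc A"
  by (simp add: plus_hc_def adj_add add.commute)

lemma adj_H_pair: "adj (H_pair K) = H_pair K"
  by (simp only: H_pair_def adj_scaleR adj_sum adj_plus_hc)

lemma adj_H_hop: "adj (H_hop t) = H_hop t"
  by (simp only: H_hop_def adj_scaleR adj_sum adj_plus_hc)

lemmas adj_couplings = adj_H_onsite adj_H_nn adj_H_pair adj_H_hop

lemma H_scale:
  "H_onsite (c * U) = c *\<^sub>R H_onsite U" "H_pair (c * K) = c *\<^sub>R H_pair K"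
  "H_hop (c * t) = c *\<^sub>R H_hop t" "H_nn (c * V) = c *\<^sub>R H_nn V"
  by (simp_all add: H_onsite_def H_pair_def H_hop_def H_nn_def)

lemma hamiltonian_scaled_couplings:
  "H_onsite U + s *\<^sub>R (H_pair K + H_hop t + H_nn V) = hamiltonian U (s * K) (s * t) (s * V)"
  by (simp add: hamiltonian_def H_scale scaleR_add_right)

text \<open>Occupation sets in which every cell is empty or full, that is, the labels of the basis
  states spanning the ground space.\<close>

definition cell_modes :: "cell set \<Rightarrow> mode set" where
  "cell_modes C = C \<times> UNIV"

lemma UNIV_cell_set: "(UNIV :: cell set set) = {{}, {Cell_R}, {Cell_R'}, UNIV}"
proof -
  have "Pow {Cell_R, Cell_R'} = {{}, {Cell_R}, {Cell_R'}, {Cell_R, Cell_R'}}"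
    by (auto simp: Pow_insert)
  then show ?thesis
    by (simp add: UNIV_cell flip: Pow_UNIV)
qed

lemma CARD_orbital: "CARD(orbital) = 4"
  by (simp add: UNIV_orbital)

lemma occ_le: "occ X S \<le> 4"
  using card_mono[of UNIV "{m. (X, m) \<in> S}"] by (simp add: occ_def CARD_orbital)

lemma onsite_nonneg: "0 \<le> real (occ X S) * (4 - real (occ X S))"
  using occ_le[of X S] by simp

text \<open>Some cell holds 1, 2 or 3 electrons and contributes n (4 - n) >= 3. The value 3/4
  belongs to one cell with 1 or 3 electrons beside an empty or full one, so the gap over the whole
  Fock space is half of the 3/2 found in the sector of the kets.\<close>

lemma onsite_energy_gap:
  assumes "\<And>C. S \<noteq> cell_modes C"
  shows "3 / 4 \<le> 1 / 4 * (\<Sum>X\<in>UNIV. real (occ X S) * (4 - real (occ X S)))"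
proof -
  have cases: "occ X S \<in> {0, 1, 2, 3, 4}" for X
    using occ_le[of X S] by auto
  have "\<exists>X. occ X S \<noteq> 0 \<and> occ X S \<noteq> 4"
  proof (rule ccontr)
    assume "\<not> ?thesis"
    then have *: "occ X S = 0 \<or> occ X S = 4" for X
      by auto
    have "{m. (X, m) \<in> S} = {} \<or> {m. (X, m) \<in> S} = UNIV" for X
      using *[of X] card_subset_eq[of UNIV "{m. (X, m) \<in> S}"] by (auto simp: occ_def CARD_orbital)
    then have "S = cell_modes {X. {m. (X, m) \<in> S} = UNIV}"
      unfolding cell_modes_def by fast
    with assms show False
      by blast
  qed
  then obtain X where "occ X S \<noteq> 0" "occ X S \<noteq> 4"
    by blast
  with cases[of X] have "3 \<le> real (occ X S) * (4 - real (occ X S))"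
    by auto
  also have "\<dots> \<le> (\<Sum>X\<in>UNIV. real (occ X S) * (4 - real (occ X S)))"
    using onsite_nonneg by (intro member_le_sum) auto
  finally show ?thesis
    by simp
qed

text \<open>The quadratic-form version of the gap: only the weight of v outside the ground space
  counts.\<close>

lemma onsite_lower_bound:
  "3 / 4 * ((norm v)\<^sup>2 - (\<Sum>C\<in>UNIV. (norm (v $ cell_modes C))\<^sup>2)) \<le> Re (cip v (H_onsite 1 *v v))"
proof -
  define d where "d S = 1 / 4 * (\<Sum>X\<in>UNIV. real (occ X S) * (4 - real (occ X S)))" for S
  have inj: "inj cell_modes"
    by (auto simp: inj_def cell_modes_def)
  have "(\<Sum>C\<in>UNIV. (norm (v $ cell_modes C))\<^sup>2) = (\<Sum>S\<in>range cell_modes. (norm (v $ S))\<^sup>2)"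
    by (simp add: sum.reindex inj)
  also have "(norm v)\<^sup>2 - \<dots> = (\<Sum>S\<in>- range cell_modes. (norm (v $ S))\<^sup>2)"
    using sum.subset_diff[of "range cell_modes" UNIV "\<lambda>S. (norm (v $ S))\<^sup>2"]
    by (simp add: norm_sq_eq Compl_eq_Diff_UNIV)
  also have "3 / 4 * \<dots> \<le> (\<Sum>S\<in>- range cell_modes. d S * (norm (v $ S))\<^sup>2)"
    unfolding sum_distrib_left using onsite_energy_gap
    by (intro sum_mono mult_right_mono) (auto simp: d_def)
  also have "\<dots> \<le> (\<Sum>S\<in>UNIV. d S * (norm (v $ S))\<^sup>2)"
    by (intro sum_mono2) (auto simp: d_def intro!: mult_nonneg_nonneg sum_nonneg onsite_nonneg)
  also have "\<dots> = Re (cip v (H_onsite 1 *v v))"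
  proof -
    have "cip v (H_onsite 1 *v v) = (\<Sum>S\<in>UNIV. complex_of_real (d S * (norm (v $ S))\<^sup>2))"
      unfolding cip_def H_onsite_apply d_def[symmetric]
      by (intro sum.cong refl) (unfold of_real_mult complex_norm_square, simp add: mult_ac)
    then show ?thesis
      by simp
  qed
  finally show ?thesis .
qed

section \<open>The four ground states as occupation number states\<close>

lemma cre_axis:
  assumes "(X, m) \<notin> S"
  shows "cre X m *v axis S 1 = jw_sign (X, m) S *s axis (insert (X, m) S) 1"
  using assms by (auto simp: vec_eq_iff cre_apply axis_def)

lemma norm_jw_sign [simp]: "norm (jw_sign a S) = 1"
  by (simp add: jw_sign_def norm_power)

text \<open>The sign is left unevaluated as a phase, since only moduli of overlaps with these states
  are used.\<close>

lemma quartet_axis: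
  assumes "S = cell_modes C" "X \<notin> C"
  shows "\<exists>z. norm z = 1 \<and> quartet_cre X *v axis S 1 = z *s axis (cell_modes (insert X C)) 1"
proof -
  have "(X, m) \<notin> S" for m
    using assms by (auto simp: cell_modes_def)
  moreover have "insert (X, Orb1) (insert (X, Orb2) (insert (X, Orb3) (insert (X, Orb4) S))) = cell_modes (insert X C)"
    using assms by (auto simp: cell_modes_def UNIV_orbital)
  ultimately show ?thesis
    by (intro exI[of _ "jw_sign (X, Orb4) S * jw_sign (X, Orb3) (insert (X, Orb4) S) *
        jw_sign (X, Orb2) (insert (X, Orb3) (insert (X, Orb4) S)) *
        jw_sign (X, Orb1) (insert (X, Orb2) (insert (X, Orb3) (insert (X, Orb4) S)))"])
      (simp add: norm_mult quartet_cre_def pair_cre_def cre_axis vector_scalar_commute mult_ac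
        flip: matrix_vector_mul_assoc)
qed

lemma kets_axis:
  "ket00 = axis (cell_modes {}) 1"
  "\<exists>z. norm z = 1 \<and> ket40 = z *s axis (cell_modes {Cell_R}) 1"
  "\<exists>z. norm z = 1 \<and> ket04 = z *s axis (cell_modes {Cell_R'}) 1"
  "\<exists>z. norm z = 1 \<and> ket44 = z *s axis UNIV 1"
proof -
  show vac: "ket00 = axis (cell_modes {}) 1"
    by (simp add: ket00_def vacuum_def cell_modes_def)
  show "\<exists>z. norm z = 1 \<and> ket40 = z *s axis (cell_modes {Cell_R}) 1"
    using quartet_axis[OF refl, of Cell_R "{}"] vac by (simp add: ket40_def ket00_def)
  show 04: "\<exists>z. norm z = 1 \<and> ket04 = z *s axis (cell_modes {Cell_R'}) 1"
    using quartet_axis[OF refl, of Cell_R' "{}"] vac by (simp add: ket04_def ket00_def)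
  obtain z where z: "norm z = 1" "ket04 = z *s axis (cell_modes {Cell_R'}) 1"
    using 04 by blast
  obtain y where y: "norm y = 1"
    "quartet_cre Cell_R *v axis (cell_modes {Cell_R'}) 1 = y *s axis (cell_modes {Cell_R, Cell_R'}) 1"
    using quartet_axis[OF refl, of Cell_R "{Cell_R'}"] by auto
  have cell: "cell_modes {Cell_R, Cell_R'} = UNIV"
    by (simp add: cell_modes_def flip: UNIV_cell)
  have "ket44 = quartet_cre Cell_R *v ket04"
    by (simp add: ket44_def ket04_def matrix_vector_mul_assoc)
  then have "ket44 = (z * y) *s axis UNIV 1"
    unfolding z(2) by (simp add: vector_scalar_commute y cell)
  then show "\<exists>z. norm z = 1 \<and> ket44 = z *s axis UNIV 1"
    using y z by (metis norm_mult mult_1)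
qed

lemma norm_cip_axis: "norm z = 1 \<Longrightarrow> norm (cip (z *s axis S 1) v) = norm (v $ S)"
proof -
  have "cip (axis S 1) v = v $ S"
  proof -
    have "cnj (axis S 1 $ i) * v $ i = (if i = S then v $ i else 0)" for i
      by (simp add: axis_def)
    then show ?thesis
      by (simp add: cip_def)
  qed
  then show "norm z = 1 \<Longrightarrow> ?thesis"
    by (simp add: cip_scale_left norm_mult)
qed

lemma transfer_axis_empty: "transfer X Y m *v axis {} 1 = 0"
  using transfer_vacuum by (simp add: vacuum_def)

lemma transfer_axis_UNIV: "X \<noteq> Y \<Longrightarrow> transfer X Y m *v axis UNIV 1 = 0"
  by (auto simp: transfer_def vec_eq_iff cre_apply ann_apply axis_def simp flip: matrix_vector_mul_assoc)

lemma occ_simps: "occ X {} = 0" "occ X UNIV = 4"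
  by (simp_all add: occ_def CARD_orbital)

text \<open>No electron can leave an empty cell or enter a full one, so only the neighbour term
  acts, with (n - 2)(n' - 2) = 4.\<close>

lemma hamiltonian_axis:
  assumes "S \<in> {{}, UNIV}"
  shows "hamiltonian U K t V *v axis S 1 = complex_of_real (4 * V) *s axis S 1"
proof -
  have hop: "transfer X Y m *v axis S 1 = 0" if "X \<noteq> Y" for X Y m
    using assms transfer_axis_empty transfer_axis_UNIV[OF that] by auto
  have "H_pair K *v axis S 1 = 0" "H_hop t *v axis S 1 = 0"
    by (simp_all add: H_pair_eq H_hop_eq scaleR_mult_vec matrix_vector_mult_add_rdistrib sum_mult_vec hop
        flip: matrix_vector_mul_assoc scaleR_minus_left)
  moreover have "H_onsite U *v axis S 1 = 0" "H_nn V *v axis S 1 = complex_of_real (4 * V) *s axis S 1"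
    using assms by (auto simp: vec_eq_iff H_onsite_apply H_nn_apply occ_simps sum_cell axis_def)
  ultimately show ?thesis
    by (simp add: hamiltonian_def matrix_vector_mult_add_rdistrib)
qed

lemma hamiltonian_ket00: "hamiltonian U K t V *v ket00 = complex_of_real (4 * V) *s ket00"
  using hamiltonian_axis[of "{}"] by (simp add: kets_axis(1) cell_modes_def)

lemma hamiltonian_ket44: "hamiltonian U K t V *v ket44 = complex_of_real (4 * V) *s ket44"
proof -
  obtain z where z: "ket44 = z *s axis UNIV 1"
    using kets_axis(4) by blast
  show ?thesis
    unfolding z using hamiltonian_axis[of UNIV U K t V] by (simp add: vector_scalar_commute mult_ac)
qed

lemma cip_ket00: "cip ket00 ket00 = 1" "cip ket00 ket44 = 0" "cip ket00 (ket a b c d) = 0"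
proof -
  show "cip ket00 ket00 = 1"
    using cip_vacuum by (simp add: ket00_def)
  show "cip ket00 ket44 = 0"
    using cnj_cip[of ket44 ket00]
    by (simp add: ket44_def quartet_cre_def pair_cre_def cip_cre_left ket00_def ann_vacuum
        flip: matrix_vector_mul_assoc)
  show "cip ket00 (ket a b c d) = 0"
    using cnj_cip[of "ket a b c d" ket00] by (simp add: ket_def cip_cre_left ket00_def ann_vacuum)
qed

lemma cip_ket44: "cip ket44 ket44 = 1" "cip ket44 (ket a b c d) = 0"
proof -
  obtain z where z: "norm z = 1" "ket44 = z *s axis UNIV 1"
    using kets_axis(4) by blast
  have "norm (ket44 $ S) = (if S = UNIV then 1 else 0)" for S
    unfolding z(2) using z(1) by (simp add: axis_def)
  then have "norm ket44 = 1"
    by (simp add: norm_vec_def L2_set_def if_distrib[of "\<lambda>x. x ^ 2"] cong: if_cong)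
  then show "cip ket44 ket44 = 1"
    by (simp add: cip_self)
  have "(ket a b c d) $ UNIV = 0"
    by (cases d) (auto simp: ket_def cre_apply vacuum_def axis_def)
  then have "norm (cip ket44 (ket a b c d)) = 0"
    using norm_cip_axis[OF z(1), of UNIV "ket a b c d"] z by simp
  then show "cip ket44 (ket a b c d) = 0"
    by simp
qed

section \<open>Symmetry sectors of the ground space\<close>

datatype sector = Empty | Full | Even | Odd

lemma UNIV_sector: "UNIV = {Empty, Full, Even, Odd}"
  using sector.exhaust by auto

instance sector :: finite
  by standard (simp add: UNIV_sector)

lemma sum_sector: "(\<Sum>k\<in>UNIV. f k) = f Empty + (f Full + (f Even + f Odd))"
  by (simp add: UNIV_sector)

text \<open>One amplitude per symmetry class: \<beta> for one electron away from a quartet, \<gamma>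
  for two with both pairs intact (\<open>a = b\<close> and n = 2 force \<open>c = d\<close>),
  \<delta> for two with both pairs split. Amplitude 1 on the quartet states is the intermediate
  normalisation.\<close>

definition even_amplitude :: "real \<Rightarrow> real \<Rightarrow> real \<Rightarrow> amplitude" where
  "even_amplitude \<beta> \<gamma> \<delta> a b c d = complex_of_real
     (let n = count Cell_R a b c d in
      if n \<in> {0, 4} then 1 else if n \<in> {1, 3} then \<beta> else if a = b then \<gamma> else \<delta>)"

text \<open>Amplitudes with n = 2 vanish: exchanging the cells sends such a configuration to its
  complement, which a permutation of orbitals respecting the pairs also reaches, so oddness and
  symmetry contradict each other unless the value is 0.\<close>

definition odd_amplitude :: "real \<Rightarrow> amplitude" where
  "odd_amplitude \<beta> a b c d = complex_of_real
     (let n = count Cell_R a b c d in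
      if n = 4 then 1 else if n = 0 then - 1 else if n = 3 then \<beta> else if n = 1 then - \<beta> else 0)"

text \<open>Not normalised for general parameters: the overlap with the unperturbed vector of the
  same sector is exactly 1.\<close>

fun sector_vector :: "real \<Rightarrow> real \<Rightarrow> real \<Rightarrow> real \<Rightarrow> sector \<Rightarrow> fock" where
  "sector_vector \<beta> \<gamma> \<delta> \<beta>' Empty = ket00"
| "sector_vector \<beta> \<gamma> \<delta> \<beta>' Full = ket44"
| "sector_vector \<beta> \<gamma> \<delta> \<beta>' Even = complex_of_real (1 / sqrt 2) *s superposition (even_amplitude \<beta> \<gamma> \<delta>)"
| "sector_vector \<beta> \<gamma> \<delta> \<beta>' Odd = complex_of_real (1 / sqrt 2) *s superposition (odd_amplitude \<beta>')"

lemma cip_ket_superposition: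
  "cip ket00 (superposition f) = 0" "cip ket44 (superposition f) = 0"
  "cip (superposition f) ket00 = 0" "cip (superposition f) ket44 = 0"
proof -
  show 1: "cip ket00 (superposition f) = 0" and 2: "cip ket44 (superposition f) = 0"
    by (simp_all add: superposition_def cip_simps cip_ket00 cip_ket44)
  show "cip (superposition f) ket00 = 0" "cip (superposition f) ket44 = 0"
    using cnj_cip[of ket00 "superposition f"] cnj_cip[of ket44 "superposition f"] 1 2 by simp_all
qed

text \<open>The coefficients 2, 8, 2, 4 count the configurations of the four classes: quartets, one
  electron moved, pairs intact, pairs split.\<close>

lemma cip_even_odd:
  "cip (superposition (even_amplitude \<beta> \<gamma> \<delta>)) (superposition (even_amplitude \<beta>' \<gamma>' \<delta>')) =
     complex_of_real (2 + 8 * \<beta> * \<beta>' + 2 * \<gamma> * \<gamma>' + 4 * \<delta> * \<delta>')"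
  "cip (superposition (odd_amplitude \<beta>)) (superposition (odd_amplitude \<beta>')) =
     complex_of_real (2 + 8 * \<beta> * \<beta>')"
  "cip (superposition (even_amplitude \<beta> \<gamma> \<delta>)) (superposition (odd_amplitude \<beta>')) = 0"
  "cip (superposition (odd_amplitude \<beta>')) (superposition (even_amplitude \<beta> \<gamma> \<delta>)) = 0"
  by (simp_all add: cip_superposition sum_cell even_amplitude_def odd_amplitude_def count_def)

lemma cip_sector_vector:
  "cip (sector_vector \<beta> \<gamma> \<delta> \<epsilon> k) (sector_vector \<beta>' \<gamma>' \<delta>' \<epsilon>' l) =
     (if k \<noteq> l then 0 else complex_of_real (case k of Empty \<Rightarrow> 1 | Full \<Rightarrow> 1
        | Even \<Rightarrow> 1 + 4 * \<beta> * \<beta>' + \<gamma> * \<gamma>' + 2 * \<delta> * \<delta>' | Odd \<Rightarrow> 1 + 4 * \<epsilon> * \<epsilon>'))"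
proof -
  have half: "complex_of_real (sqrt 2) * complex_of_real (sqrt 2) = 2"
    by (simp flip: of_real_mult)
  have "cip ket44 ket00 = 0"
    using cnj_cip[of ket00 ket44] by (simp add: cip_ket00)
  then show ?thesis
    by (cases k; cases l)
      (simp_all add: cip_simps cip_ket_superposition cip_ket00 cip_ket44 cip_even_odd half field_simps)
qed

text \<open>The hypotheses are the eigenvalue equation on each class, with diagonal energies - 4 V,
  3/2 - V, 2 and 2. From a singly hopped configuration one flip leads back to the quartet, one to
  \<gamma> and two to \<delta>; the one intact pair can hop, which leads to another singly hopped
  configuration and gives the diagonal K.\<close>

lemma hamiltonian_even:
  assumes "E = - 4 * V - 4 * t * \<beta> - 2 * K * \<gamma>"
    and "\<beta> * (3 / 2 - V - K - E) = t * (1 + \<gamma> + 2 * \<delta>)"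
    and "\<gamma> * (2 - E) = 2 * K + 4 * t * \<beta>" and "\<delta> * (2 - E) = 4 * t * \<beta>"
  shows "hamiltonian 1 K t V *v superposition (even_amplitude \<beta> \<gamma> \<delta>) =
    complex_of_real E *s superposition (even_amplitude \<beta> \<gamma> \<delta>)"
proof -
  have "amplitude_hamiltonian 1 K t V (even_amplitude \<beta> \<gamma> \<delta>) a b c d =
      complex_of_real E * even_amplitude \<beta> \<gamma> \<delta> a b c d" for a b c d
  proof -
    have "E * \<beta> = (3 / 2 - V) * \<beta> - K * \<beta> - t * (1 + \<gamma> + 2 * \<delta>)"
      using assms(2) by (simp add: algebra_simps)
    moreover have "E * \<gamma> = 2 * \<gamma> - 2 * K - 4 * t * \<beta>"
      using assms(3) by (simp add: algebra_simps)
    moreover have "E * \<delta> = 2 * \<delta> - 4 * t * \<beta>"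
      using assms(4) by (simp add: algebra_simps)
    ultimately have eqs: "E * \<beta> = (3 / 2 - V) * \<beta> - K * \<beta> - t * (1 + \<gamma> + 2 * \<delta>)"
      "E * \<gamma> = 2 * \<gamma> - 2 * K - 4 * t * \<beta>" "E * \<delta> = 2 * \<delta> - 4 * t * \<beta>"
      by blast+
    show ?thesis
      unfolding amplitude_hamiltonian_def even_amplitude_def of_real_mult[symmetric]
      by (cases a; cases b; cases c; cases d;
          simp add: count_def eqs flip: of_real_mult of_real_add of_real_diff; simp add: assms(1) algebra_simps)
  qed
  then show ?thesis
    unfolding hamiltonian_superposition by (simp add: superposition_def vec.scale_sum_right)
qed

text \<open>On doubly hopped configurations the contributions of opposite sign cancel, so no
  equation remains there. Pair hopping exchanges n = 3 and n = 1, where the amplitudes have opposite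
  signs, hence + K instead of - K.\<close>

lemma hamiltonian_odd:
  assumes "E = - 4 * V - 4 * t * \<beta>" and "\<beta> * (3 / 2 - V + K - E) = t"
  shows "hamiltonian 1 K t V *v superposition (odd_amplitude \<beta>) =
    complex_of_real E *s superposition (odd_amplitude \<beta>)"
proof -
  have "amplitude_hamiltonian 1 K t V (odd_amplitude \<beta>) a b c d =
      complex_of_real E * odd_amplitude \<beta> a b c d" for a b c d
  proof -
    have "E * \<beta> = (3 / 2 - V) * \<beta> + K * \<beta> - t"
      using assms(2) by (auto simp: algebra_simps)
    note eqs = this
    show ?thesis
      unfolding amplitude_hamiltonian_def odd_amplitude_def of_real_mult[symmetric]
      by (cases a; cases b; cases c; cases d;
          simp add: count_def eqs flip: of_real_mult of_real_add of_real_diff; simp add: assms(1) algebra_simps)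
  qed
  then show ?thesis
    unfolding hamiltonian_superposition by (simp add: superposition_def vec.scale_sum_right)
qed

section \<open>The ground space in the symmetry-adapted basis and the spectral gap\<close>

abbreviation ground :: "sector \<Rightarrow> fock" where
  "ground \<equiv> sector_vector 0 0 0 0"

lemma ground_even: "ground Even = complex_of_real (1 / sqrt 2) *s (ket40 + ket04)"
  by (simp add: superposition_expand even_amplitude_def count_def ket40_eq ket04_eq)

lemma ground_odd: "ground Odd = complex_of_real (1 / sqrt 2) *s (ket40 - ket04)"
  by (simp add: superposition_expand odd_amplitude_def count_def ket40_eq ket04_eq)

lemma ket40_ground: "ket40 = complex_of_real (1 / sqrt 2) *s (ground Even + ground Odd)"
  and ket04_ground: "ket04 = complex_of_real (1 / sqrt 2) *s (ground Even - ground Odd)"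
proof -
  have half: "complex_of_real (1 / sqrt 2) * complex_of_real (1 / sqrt 2) = 1 / 2"
    by (simp flip: of_real_mult)
  have "x = complex_of_real (1 / sqrt 2) *s (complex_of_real (1 / sqrt 2) *s (x + y) + complex_of_real (1 / sqrt 2) *s (x - y))"
    "y = complex_of_real (1 / sqrt 2) *s (complex_of_real (1 / sqrt 2) *s (x + y) - complex_of_real (1 / sqrt 2) *s (x - y))"
    for x y :: fock
    unfolding vec.scale_right_distrib vec.scale_right_diff_distrib vec.scale_scale half
    by (simp_all add: vec_eq_iff)
  then show "ket40 = complex_of_real (1 / sqrt 2) *s (ground Even + ground Odd)"
    "ket04 = complex_of_real (1 / sqrt 2) *s (ground Even - ground Odd)"
    unfolding ground_even ground_odd by blast+
qed

lemma orthonormal_ground: "orthonormal ground"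
  unfolding orthonormal_def cip_sector_vector by (simp split: sector.split)

lemma P_ground_eq: "P_ground = projm ground"
proof -
  have "vec.span (range ground) = vec.span {ket00, ket40, ket04, ket44}"
  proof (intro equalityI vec.span_minimal vec.subspace_span subsetI)
    fix x assume "x \<in> range ground"
    then obtain k where "x = ground k"
      by blast
    then show "x \<in> vec.span {ket00, ket40, ket04, ket44}"
      using ground_even ground_odd
      by (cases k) (auto simp del: sector_vector.simps(3,4)
          intro!: vec.span_scale vec.span_add vec.span_diff intro: vec.span_base)
  next
    fix x assume "x \<in> {ket00, ket40, ket04, ket44}"
    moreover have "ket00 \<in> range ground" "ket44 \<in> range ground"
      by (metis rangeI sector_vector.simps(1), metis rangeI sector_vector.simps(2))
    moreover have "ket40 \<in> vec.span (range ground)"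
      unfolding ket40_ground by (intro vec.span_scale vec.span_add vec.span_base rangeI)
    moreover have "ket04 \<in> vec.span (range ground)"
      unfolding ket04_ground by (intro vec.span_scale vec.span_diff vec.span_base rangeI)
    ultimately show "x \<in> vec.span (range ground)"
      by (auto intro: vec.span_base)
  qed
  then show ?thesis
    using projm_orth_projector[OF orthonormal_ground] unfolding P_ground_def
    by (simp add: orth_projector_eqI)
qed

lemma UNIV_cell_set_sum: "(\<Sum>C\<in>UNIV. f C) = f {} + (f UNIV + (f {Cell_R} + f {Cell_R'}))"
proof -
  have "{Cell_R} \<noteq> UNIV" "{Cell_R'} \<noteq> UNIV"
    by (auto simp: UNIV_cell)
  then show ?thesis
    unfolding UNIV_cell_set by (simp add: add_ac)
qed

text \<open>Both sides are the weight of v in the ground space. Phases drop out, and the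
  parallelogram law trades Even and Odd for the two quartet states.\<close>

lemma sum_cip_ground: "(\<Sum>k\<in>UNIV. (norm (cip (ground k) v))\<^sup>2) = (\<Sum>C\<in>UNIV. (norm (v $ cell_modes C))\<^sup>2)"
proof -
  have c: "norm (cip ket00 v) = norm (v $ cell_modes {})" "norm (cip ket44 v) = norm (v $ cell_modes UNIV)"
    "norm (cip ket40 v) = norm (v $ cell_modes {Cell_R})" "norm (cip ket04 v) = norm (v $ cell_modes {Cell_R'})"
    using norm_cip_axis[of 1 "cell_modes {}" v] kets_axis
    by (simp, metis norm_cip_axis cell_modes_def UNIV_Times_UNIV, (metis norm_cip_axis)+)
  have par: "(norm (x + y))\<^sup>2 + (norm (x - y))\<^sup>2 = 2 * (norm x)\<^sup>2 + 2 * (norm y)\<^sup>2" for x y :: complex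
    unfolding cmod_power2 by (simp add: power2_eq_square algebra_simps)
  have "(norm (cip (ground Even) v))\<^sup>2 + (norm (cip (ground Odd) v))\<^sup>2 =
      ((norm (cip ket40 v + cip ket04 v))\<^sup>2 + (norm (cip ket40 v - cip ket04 v))\<^sup>2) / 2"
    unfolding ground_even ground_odd cip_simps
    by (simp add: norm_mult norm_divide power_mult_distrib power_divide)
  also have "\<dots> = (norm (cip ket40 v))\<^sup>2 + (norm (cip ket04 v))\<^sup>2"
    unfolding par by simp
  finally show ?thesis
    unfolding sum_sector UNIV_cell_set_sum c[symmetric] by simp
qed

text \<open>Being orthogonal to vectors whose total squared distance from the ground vectors is at
  most 1/4, v has at most a quarter of its weight in the ground space. Its on-site energy is then at
  least 3/4 * 3/4 = 9/16 of its squared norm, and the perturbation takes away at most 1/4. The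
  remaining 5/16 exceeds E unless v = 0.\<close>

lemma sector_gap:
  assumes orth: "\<And>k. cip (sector_vector \<beta> \<gamma> \<delta> \<epsilon> k) v = 0"
    and small: "4 * \<beta>\<^sup>2 + \<gamma>\<^sup>2 + 2 * \<delta>\<^sup>2 + 4 * \<epsilon>\<^sup>2 \<le> 1 / 4"
    and pert: "norm (cip v ((H_pair K + H_hop t + H_nn V) *v v)) \<le> 1 / 4 * (norm v)\<^sup>2"
    and eig: "hamiltonian 1 K t V *v v = complex_of_real E *s v" and E: "E \<le> 1 / 4"
  shows "v = 0"
proof -
  let ?w = "sector_vector \<beta> \<gamma> \<delta> \<epsilon>"
  have diff: "(norm (ground k - ?w k))\<^sup>2 = (case k of Even \<Rightarrow> 4 * \<beta>\<^sup>2 + \<gamma>\<^sup>2 + 2 * \<delta>\<^sup>2 | Odd \<Rightarrow> 4 * \<epsilon>\<^sup>2 | _ \<Rightarrow> 0)" for k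
  proof -
    have "complex_of_real ((norm (ground k - ?w k))\<^sup>2) =
        complex_of_real (case k of Even \<Rightarrow> 4 * \<beta>\<^sup>2 + \<gamma>\<^sup>2 + 2 * \<delta>\<^sup>2 | Odd \<Rightarrow> 4 * \<epsilon>\<^sup>2 | _ \<Rightarrow> 0)"
      unfolding cip_self[symmetric] cip_diff_left cip_diff_right cip_sector_vector
      by (simp add: power2_eq_square split: sector.split)
    then show ?thesis
      unfolding of_real_eq_iff .
  qed
  have "(norm (cip (ground k) v))\<^sup>2 \<le> (norm (ground k - ?w k))\<^sup>2 * (norm v)\<^sup>2" for k
    using norm_cip_le[of "ground k - ?w k" v] orth[of k]
    by (simp add: cip_diff_left flip: power_mult_distrib)
  then have "(\<Sum>k\<in>UNIV. (norm (cip (ground k) v))\<^sup>2) \<le> (\<Sum>k\<in>UNIV. (norm (ground k - ?w k))\<^sup>2 * (norm v)\<^sup>2)"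
    by (intro sum_mono)
  also have "\<dots> = (4 * \<beta>\<^sup>2 + \<gamma>\<^sup>2 + 2 * \<delta>\<^sup>2 + 4 * \<epsilon>\<^sup>2) * (norm v)\<^sup>2"
    unfolding diff sum_sector by (simp add: algebra_simps)
  also have "\<dots> \<le> 1 / 4 * (norm v)\<^sup>2"
    using small by (intro mult_right_mono) auto
  finally have "(\<Sum>C\<in>UNIV. (norm (v $ cell_modes C))\<^sup>2) \<le> 1 / 4 * (norm v)\<^sup>2"
    unfolding sum_cip_ground .
  then have "3 / 4 * ((norm v)\<^sup>2 - 1 / 4 * (norm v)\<^sup>2) \<le>
      3 / 4 * ((norm v)\<^sup>2 - (\<Sum>C\<in>UNIV. (norm (v $ cell_modes C))\<^sup>2))"
    by (intro mult_left_mono diff_left_mono) auto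
  also note onsite_lower_bound
  finally have "3 / 4 * ((norm v)\<^sup>2 - 1 / 4 * (norm v)\<^sup>2) \<le> Re (cip v (H_onsite 1 *v v))" .
  moreover have "- (1 / 4 * (norm v)\<^sup>2) \<le> Re (cip v ((H_pair K + H_hop t + H_nn V) *v v))"
    using pert abs_Re_le_cmod[of "cip v ((H_pair K + H_hop t + H_nn V) *v v)"] by linarith
  moreover have "Re (cip v (H_onsite 1 *v v)) + Re (cip v ((H_pair K + H_hop t + H_nn V) *v v)) = E * (norm v)\<^sup>2"
  proof -
    have "cip v (H_onsite 1 *v v) + cip v ((H_pair K + H_hop t + H_nn V) *v v) = complex_of_real (E * (norm v)\<^sup>2)"
      using arg_cong[OF eig, of "cip v"]
      by (simp add: hamiltonian_def matrix_vector_mult_add_rdistrib[of "H_onsite 1"] cip_add_right cip_scale_right cip_self)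
    then show ?thesis
      by (metis Re_complex_of_real plus_complex.sel(1))
  qed
  moreover have "E * (norm v)\<^sup>2 \<le> 1 / 4 * (norm v)\<^sup>2"
    using E by (intro mult_right_mono) auto
  moreover have "n \<le> 0" if "3 / 4 * (n - 1 / 4 * n) \<le> a" "- (1 / 4 * n) \<le> b" "a + b = e" "e \<le> 1 / 4 * n"
    for n a b e :: real
    using that by (simp add: field_simps)
  ultimately have "(norm v)\<^sup>2 \<le> 0"
    by blast
  then show ?thesis
    by simp
qed

fun sector_energy :: "real \<Rightarrow> real \<Rightarrow> real \<Rightarrow> sector \<Rightarrow> real" where
  "sector_energy V E\<^sub>e E\<^sub>o Empty = 4 * V"
| "sector_energy V E\<^sub>e E\<^sub>o Full = 4 * V"
| "sector_energy V E\<^sub>e E\<^sub>o Even = E\<^sub>e"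
| "sector_energy V E\<^sub>e E\<^sub>o Odd = E\<^sub>o"

text \<open>The functions of \<open>s\<close> solve the sector equations with all couplings
  multiplied by \<open>s\<close>; they vanish at 0, where the path must start at the ground vectors.
  The four square norms in \<open>small\<close> and the energy bounds are exactly what
  \<open>sector_gap\<close> consumes.\<close>

lemma H_eff_eq:
  fixes \<beta> \<gamma> \<delta> \<epsilon> E\<^sub>e E\<^sub>o :: "real \<Rightarrow> real"
  assumes cont: "continuous_on {0..1} \<beta>" "continuous_on {0..1} \<gamma>" "continuous_on {0..1} \<delta>" "continuous_on {0..1} \<epsilon>"
    and zero: "\<beta> 0 = 0" "\<gamma> 0 = 0" "\<delta> 0 = 0" "\<epsilon> 0 = 0"
    and even: "\<And>s. s \<in> {0..1} \<Longrightarrow> E\<^sub>e s = - 4 * (s * V) - 4 * (s * t) * \<beta> s - 2 * (s * K) * \<gamma> s"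
      "\<And>s. s \<in> {0..1} \<Longrightarrow> \<beta> s * (3 / 2 - s * V - s * K - E\<^sub>e s) = s * t * (1 + \<gamma> s + 2 * \<delta> s)"
      "\<And>s. s \<in> {0..1} \<Longrightarrow> \<gamma> s * (2 - E\<^sub>e s) = 2 * (s * K) + 4 * (s * t) * \<beta> s"
      "\<And>s. s \<in> {0..1} \<Longrightarrow> \<delta> s * (2 - E\<^sub>e s) = 4 * (s * t) * \<beta> s"
    and odd: "\<And>s. s \<in> {0..1} \<Longrightarrow> E\<^sub>o s = - 4 * (s * V) - 4 * (s * t) * \<epsilon> s"
      "\<And>s. s \<in> {0..1} \<Longrightarrow> \<epsilon> s * (3 / 2 - s * V + s * K - E\<^sub>o s) = s * t"
    and small: "\<And>s. s \<in> {0..1} \<Longrightarrow> 4 * (\<beta> s)\<^sup>2 + (\<gamma> s)\<^sup>2 + 2 * (\<delta> s)\<^sup>2 + 4 * (\<epsilon> s)\<^sup>2 \<le> 1 / 4"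
      "\<And>s. s \<in> {0..1} \<Longrightarrow> E\<^sub>e s \<le> 1 / 4" "\<And>s. s \<in> {0..1} \<Longrightarrow> E\<^sub>o s \<le> 1 / 4" "4 * \<bar>V\<bar> \<le> 1 / 4"
    and pert: "\<And>v. norm (cip v ((H_pair K + H_hop t + H_nn V) *v v)) \<le> 1 / 4 * (norm v)\<^sup>2"
  shows "H_eff 1 K t V = (\<Sum>k\<in>UNIV. outer (complex_of_real (sector_energy V (E\<^sub>e 1) (E\<^sub>o 1) k) *s ground k) (ground k))"
proof -
  define w where "w s = sector_vector (\<beta> s) (\<gamma> s) (\<delta> s) (\<epsilon> s)" for s
  define e where "e s k = complex_of_real (1 / norm (w s k)) *s w s k" for s k
  define E where "E s = sector_energy (s * V) (E\<^sub>e s) (E\<^sub>o s)" for s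
  have ww: "cip (w s k) (w s l) = 0" if "k \<noteq> l" for s k l
    using that by (simp add: w_def cip_sector_vector)
  have pw: "cip (ground k) (w s l) = (if k = l then 1 else 0)" for s k l
    by (auto simp: w_def cip_sector_vector split: sector.split)
  then have w0: "w s k \<noteq> 0" for s k
    by (metis cip_zero(2) zero_neq_one)
  have cont_w: "continuous_on {0..1} (\<lambda>s. w s k)" for k
  proof -
    have scale: "c *s v = (\<chi> i. c * v $ i)" for c and v :: fock
      by (simp add: vec_eq_iff)
    show ?thesis
      using cont by (cases k)
        (auto simp: w_def superposition_expand even_amplitude_def odd_amplitude_def count_def scale
          intro!: continuous_intros)
  qed
  have "H_eff 1 K t V = des_cloizeaux (projm ground) (H_onsite 1) (H_pair K + H_hop t + H_nn V)"
    by (simp add: H_eff_def P_ground_eq)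
  also have "\<dots> = (\<Sum>k\<in>UNIV. outer (of_real (E 1 k) *s ground k) (ground k))"
  \<comment> \<open>The unnormalised vectors overlap with their ground vectors by 1 and with the
    others by 0, so after normalisation the overlap is the inverse norm.\<close>
  proof (rule des_cloizeaux_diagonal[where e = e and c = "\<lambda>k. 1 / norm (w 1 k)"])
    show "adj (H_onsite 1) = H_onsite 1"
      "adj (H_pair K + H_hop t + H_nn V) = H_pair K + H_hop t + H_nn V"
      by (simp_all add: adj_add adj_couplings)
    show "continuous_on {0..1} (\<lambda>s. e s k)" for k
      unfolding e_def scaleR_eq_scale[symmetric]
      by (intro continuous_intros cont_w) (auto simp: w0)
    show "e 0 = ground"
    proof
      fix k
      have "cip (ground k) (ground k) = 1"
        using orthonormal_ground by (simp add: orthonormal_def)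
      then have "norm (ground k) = 1"
        unfolding cip_self of_real_eq_1_iff by (smt (verit) norm_ge_zero power2_eq_1_iff)
      then show "e 0 k = ground k"
        by (simp add: e_def w_def zero del: sector_vector.simps)
    qed
    show "orthonormal (e s)" for s
      unfolding orthonormal_def e_def cip_simps using ww w0
      by (auto simp: cip_self power2_eq_square)
    fix s :: real assume s: "s \<in> {0..1}"
    have "hamiltonian 1 (s * K) (s * t) (s * V) *v w s k = of_real (E s k) *s w s k" for k
      using hamiltonian_even[OF even[OF s]] hamiltonian_odd[OF odd[OF s]]
      by (cases k) (simp_all add: w_def E_def hamiltonian_ket00 hamiltonian_ket44 vector_scalar_commute mult_ac)
    then show "(H_onsite 1 + s *\<^sub>R (H_pair K + H_hop t + H_nn V)) *v e s k = of_real (E s k) *s e s k" for k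
      unfolding hamiltonian_scaled_couplings e_def by (simp add: vector_scalar_commute mult_ac)
    show "v = 0" if orth: "\<And>l. cip (e s l) v = 0"
      and eig: "(H_onsite 1 + s *\<^sub>R (H_pair K + H_hop t + H_nn V)) *v v = of_real (E s k) *s v" for v k
    proof (rule sector_gap)
      show "cip (sector_vector (\<beta> s) (\<gamma> s) (\<delta> s) (\<epsilon> s) k) v = 0" for k
        using orth[of k] w0[of s k] by (simp add: e_def cip_scale_left w_def)
      show "hamiltonian 1 (s * K) (s * t) (s * V) *v v = of_real (E s k) *s v"
        using eig unfolding hamiltonian_scaled_couplings .
      have "s * V \<le> 1 * \<bar>V\<bar>"
        using s by (metis abs_ge_self abs_ge_zero abs_mult abs_of_nonneg atLeastAtMost_iff mult_right_mono order_trans)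
      then show "E s k \<le> 1 / 4"
        using small(2-4) s by (cases k) (auto simp: E_def)
      have "H_pair (s * K) + H_hop (s * t) + H_nn (s * V) = s *\<^sub>R (H_pair K + H_hop t + H_nn V)"
        by (simp add: H_scale scaleR_add_right)
      then have "norm (cip v ((H_pair (s * K) + H_hop (s * t) + H_nn (s * V)) *v v)) =
          s * norm (cip v ((H_pair K + H_hop t + H_nn V) *v v))"
        using s by (simp only: scaleR_mult_vec scaleR_eq_scale cip_scale_right norm_mult norm_of_real) simp
      also have "\<dots> \<le> 1 * (1 / 4 * (norm v)\<^sup>2)"
        using s pert by (intro mult_mono) auto
      finally show "norm (cip v ((H_pair (s * K) + H_hop (s * t) + H_nn (s * V)) *v v)) \<le> 1 / 4 * (norm v)\<^sup>2"
        by simp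
    qed (use small(1) s in auto)
  next
    show "cip (ground k) (e 1 l) = (if k = l then complex_of_real (1 / norm (w 1 k)) else 0)" for k l
      by (simp add: e_def cip_scale_right pw)
    show "0 < 1 / norm (w 1 k)" for k
      using w0 by simp
  qed
  finally show ?thesis
    by (simp add: E_def)
qed

text \<open>On the two quartet states the diagonal entry is the mean of the two energies and the
  off-diagonal entry is half of \<open>E\<^sub>e - E\<^sub>o\<close>, while \<open>ket44\<close> has
  energy 4 V.\<close>

lemma effective_couplings:
  assumes "H_eff U K t V = (\<Sum>k\<in>UNIV. outer (complex_of_real (sector_energy V E\<^sub>e E\<^sub>o k) *s ground k) (ground k))"
  shows "t_b U K t V = complex_of_real ((E\<^sub>o - E\<^sub>e) / 2)"
    and "V_b U K t V = complex_of_real (8 * V - E\<^sub>e - E\<^sub>o)"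
proof -
  have H: "braket u (H_eff U K t V) v = (\<Sum>k\<in>UNIV. complex_of_real (sector_energy V E\<^sub>e E\<^sub>o k) * (cip u (ground k) * cip (ground k) v))" for u v
    unfolding braket_eq_cip assms sum_mult_vec outer_mult_vec cip_simps by (simp add: mult_ac)
  have gg: "cip (ground k) (ground l) = (if k = l then 1 else 0)" for k l
    using orthonormal_ground by (simp add: orthonormal_def)
  have 44: "ket44 = ground Full"
    by simp
  show "t_b U K t V = complex_of_real ((E\<^sub>o - E\<^sub>e) / 2)" "V_b U K t V = complex_of_real (8 * V - E\<^sub>e - E\<^sub>o)"
    unfolding t_b_def V_b_def J_perp_def J_z_def H ket40_ground ket04_ground 44 cip_simps gg sum_sector
    by (simp_all add: field_simps flip: of_real_mult) (simp add: of_real_mult)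
qed

section \<open>Energies as fixed points of the self-energies\<close>

lemma is_spectral_projector_scaleR:
  assumes "c \<noteq> 0"
  shows "is_spectral_projector (c *\<^sub>R H) Q \<longleftrightarrow> is_spectral_projector H Q"
proof -
  have imp: "is_spectral_projector (b *\<^sub>R H) Q" if H: "is_spectral_projector H Q" and b: "b \<noteq> 0" for b H
  proof -
    obtain \<Lambda> where \<Lambda>: "is_orth_projector_onto (vec.span {v. \<exists>E\<in>\<Lambda>. H *v v = E *s v}) Q"
      using H by (auto simp: is_spectral_projector_def)
    have "(b *\<^sub>R H) *v v = (of_real b * E) *s v \<longleftrightarrow> H *v v = E *s v" for v E
      using b vec.scale_cancel_left[of "of_real b" "H *v v" "E *s v"]
      by (simp add: scaleR_mult_vec scaleR_eq_scale)
    then have "{v. \<exists>E\<in>\<Lambda>. H *v v = E *s v} = {v. \<exists>E\<in>(*) (of_real b) ` \<Lambda>. (b *\<^sub>R H) *v v = E *s v}"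
      by auto
    with \<Lambda> show ?thesis
      unfolding is_spectral_projector_def by (intro exI[of _ "(*) (of_real b) ` \<Lambda>"]) simp
  qed
  show ?thesis
    using imp[of H c] imp[of "c *\<^sub>R H" "1 / c"] assms by auto
qed

text \<open>A common factor changes no eigenspace along the path, so Pbar and W stay the same and
  only the operator between them scales.\<close>

lemma des_cloizeaux_scaleR:
  assumes "c \<noteq> 0"
  shows "des_cloizeaux P (c *\<^sub>R H) (c *\<^sub>R V) = c *\<^sub>R des_cloizeaux P H V"
proof -
  have "c *\<^sub>R H + s *\<^sub>R (c *\<^sub>R V) = c *\<^sub>R (H + s *\<^sub>R V)" for s
    by (simp add: scaleR_add_right)
  then have "connected_projector P (c *\<^sub>R H) (c *\<^sub>R V) = connected_projector P H V"
    by (simp add: connected_projector_def is_spectral_projector_scaleR assms)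
  then show ?thesis
    by (simp add: des_cloizeaux_def Let_def scaleR_mult_left scaleR_mult_right flip: scaleR_add_right)
qed

lemma H_eff_scale:
  assumes "U > 0"
  shows "H_eff U K t V = U *\<^sub>R H_eff 1 (K / U) (t / U) (V / U)"
proof -
  have "H_onsite U = U *\<^sub>R H_onsite 1"
    "H_pair K + H_hop t + H_nn V = U *\<^sub>R (H_pair (K / U) + H_hop (t / U) + H_nn (V / U))"
    using assms by (simp_all add: scaleR_add_right flip: H_scale)
  then show ?thesis
    using assms by (simp add: H_eff_def des_cloizeaux_scaleR)
qed

lemma couplings_scale:
  assumes "U > 0"
  shows "t_b U K t V = of_real U * t_b 1 (K / U) (t / U) (V / U)"
    and "V_b U K t V = of_real U * V_b 1 (K / U) (t / U) (V / U)"
  unfolding t_b_def V_b_def J_perp_def J_z_def H_eff_scale[OF assms, of K t V] braket_eq_cip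
    scaleR_mult_vec scaleR_eq_scale cip_scale_right
  by (simp_all add: algebra_simps)

text \<open>Banach's theorem gives the points. With contraction constant 1/2, the fixed points at q
  and p differ by at most twice the change of G at the single argument \<open>e p\<close>, so
  continuity of G in the parameter at fixed argument suffices.\<close>

lemma fixed_point_curve:
  fixes G :: "'a::metric_space \<Rightarrow> real \<Rightarrow> real"
  assumes r: "r \<ge> 0"
    and maps: "\<And>p x. p \<in> B \<Longrightarrow> \<bar>x\<bar> \<le> r \<Longrightarrow> \<bar>G p x\<bar> \<le> r"
    and lip: "\<And>p x y. p \<in> B \<Longrightarrow> \<bar>x\<bar> \<le> r \<Longrightarrow> \<bar>y\<bar> \<le> r \<Longrightarrow> \<bar>G p x - G p y\<bar> \<le> 1 / 2 * \<bar>x - y\<bar>"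
    and cont: "\<And>x. \<bar>x\<bar> \<le> r \<Longrightarrow> continuous_on B (\<lambda>p. G p x)"
  obtains e where "continuous_on B e" "\<And>p. p \<in> B \<Longrightarrow> \<bar>e p\<bar> \<le> r" "\<And>p. p \<in> B \<Longrightarrow> e p = G p (e p)"
proof -
  have "\<exists>x. \<bar>x\<bar> \<le> r \<and> x = G p x" if "p \<in> B" for p
  proof -
    have abs: "x \<in> {- r..r} \<longleftrightarrow> \<bar>x\<bar> \<le> r" for x
      by auto
    have "\<exists>!x. x \<in> {- r..r} \<and> G p x = x"
    proof (rule Banach_fix[of _ "1 / 2"])
      show "G p ` {- r..r} \<subseteq> {- r..r}"
        using maps[OF that] abs by blast
      show "dist (G p x) (G p y) \<le> 1 / 2 * dist x y" if "x \<in> {- r..r}" "y \<in> {- r..r}" for x y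
        using lip[OF \<open>p \<in> B\<close>] that unfolding abs dist_real_def by blast
    qed (use r in \<open>auto simp: compact_imp_complete\<close>)
    then show ?thesis
      unfolding abs by metis
  qed
  then obtain e where e: "\<And>p. p \<in> B \<Longrightarrow> \<bar>e p\<bar> \<le> r" "\<And>p. p \<in> B \<Longrightarrow> e p = G p (e p)"
    by metis
  have "continuous_on B e"
    unfolding continuous_on_def
  proof
    fix p assume p: "p \<in> B"
    have "((\<lambda>q. 2 * \<bar>G q (e p) - G p (e p)\<bar>) \<longlongrightarrow> 2 * \<bar>G p (e p) - G p (e p)\<bar>) (at p within B)"
      using cont[OF e(1)[OF p]] p unfolding continuous_on_def by (intro tendsto_intros) auto
    then have lim: "((\<lambda>q. 2 * \<bar>G q (e p) - G p (e p)\<bar>) \<longlongrightarrow> 0) (at p within B)"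
      by simp
    have "\<forall>\<^sub>F q in at p within B. norm (e q - e p) \<le> 2 * \<bar>G q (e p) - G p (e p)\<bar>"
      unfolding eventually_at_filter
    proof (intro always_eventually allI impI)
      fix q assume "q \<in> B"
      then have "\<bar>e q - G q (e p)\<bar> \<le> 1 / 2 * \<bar>e q - e p\<bar>"
        using lip[of q "e q" "e p"] e p by metis
      then show "norm (e q - e p) \<le> 2 * \<bar>G q (e p) - G p (e p)\<bar>"
        using abs_triangle_ineq[of "e q - G q (e p)" "G q (e p) - e p"]
        unfolding e(2)[OF p, symmetric] real_norm_def by simp
    qed
    then have "((\<lambda>q. e q - e p) \<longlongrightarrow> 0) (at p within B)"
      using lim by (rule Lim_null_comparison)
    then show "(e \<longlongrightarrow> e p) (at p within B)"
      by (simp add: LIM_zero_iff)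
  qed
  with e that show ?thesis
    by blast
qed

text \<open>Propagator of the singly hopped level after eliminating \<gamma> and \<delta>: in t
  (\<gamma> + 2 \<delta>) the return terms are (4 + 8) t^2 \<beta> / (2 - E), which gives the
  12.\<close>

definition even_response :: "real \<Rightarrow> real \<Rightarrow> real \<Rightarrow> real \<Rightarrow> real" where
  "even_response K t V E = 1 / (3 / 2 - V - K - E - 12 * t\<^sup>2 / (2 - E))"

text \<open>What remains of the energy equation after elimination. The singly hopped level is
  reached directly or through a pair-hopped state, hence the factor 1 + 2 K / (2 - E), once for
  going and once for returning.\<close>

definition even_self_energy :: "real \<Rightarrow> real \<Rightarrow> real \<Rightarrow> real \<Rightarrow> real" where
  "even_self_energy K t V E = - 4 * V - 4 * K\<^sup>2 / (2 - E) -
     4 * t\<^sup>2 * (1 + 2 * K / (2 - E))\<^sup>2 * even_response K t V E"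

definition odd_self_energy :: "real \<Rightarrow> real \<Rightarrow> real \<Rightarrow> real \<Rightarrow> real" where
  "odd_self_energy K t V E = - 4 * V - 4 * t\<^sup>2 / (3 / 2 - V + K - E)"

lemma inverse_diff_le:
  fixes x y :: real
  assumes "x \<ge> 1" "y \<ge> 1"
  shows "\<bar>1 / x - 1 / y\<bar> \<le> \<bar>x - y\<bar>"
proof -
  have "1 / x - 1 / y = (y - x) / (x * y)"
    using assms by (simp add: field_simps)
  then have "\<bar>1 / x - 1 / y\<bar> = \<bar>x - y\<bar> / (x * y)"
    using assms by (simp add: abs_mult abs_minus_commute)
  also have "\<dots> \<le> \<bar>x - y\<bar> / 1"
    using assms mult_mono[of 1 x 1 y] by (intro divide_left_mono) auto
  finally show ?thesis
    by simp
qed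

lemma abs_add_le: "\<bar>x\<bar> \<le> a \<Longrightarrow> \<bar>y\<bar> \<le> b \<Longrightarrow> \<bar>x + y\<bar> \<le> a + b" for x y a b :: real
  by linarith

lemma square_le_of_abs_le: "\<bar>x\<bar> \<le> m \<Longrightarrow> x\<^sup>2 \<le> m\<^sup>2" for x m :: real
  by (simp add: abs_le_square_iff[symmetric])

section \<open>Bounds and contraction of the self-energies for small couplings\<close>

context
  fixes K t V :: real
  assumes bounds: "\<bar>K\<bar> \<le> 1 / 40" "\<bar>t\<bar> \<le> 1 / 40" "\<bar>V\<bar> \<le> 1 / 40"
begin

lemma squares: "K\<^sup>2 \<le> 1 / 1600" "t\<^sup>2 \<le> 1 / 1600"
  using square_le_of_abs_le[OF bounds(1)] square_le_of_abs_le[OF bounds(2)]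
  by (simp_all add: power2_eq_square)

lemma inv_2:
  fixes E :: real
  assumes "\<bar>E\<bar> \<le> 1 / 4"
  shows "0 \<le> 1 / (2 - E)" "1 / (2 - E) \<le> 1"
  using assms by (auto simp: field_simps)

text \<open>The worst case is 3/2 - 2/40 - 1/4 - 12/1600 > 1. A denominator at least 1 bounds the
  response by 1 and makes \<open>inverse_diff_le\<close> applicable.\<close>

lemma even_denominator:
  assumes E: "\<bar>E\<bar> \<le> 1 / 4"
  shows "1 \<le> 3 / 2 - V - K - E - 12 * t\<^sup>2 / (2 - E)"
proof -
  have "t\<^sup>2 * (1 / (2 - E)) \<le> 1 / 1600 * 1"
    using squares inv_2[OF E] by (intro mult_mono) auto
  then have "12 * t\<^sup>2 / (2 - E) \<le> 12 / 1600"
    by simp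
  then show ?thesis
    using E bounds by linarith
qed

lemma odd_denominator:
  assumes E: "\<bar>E\<bar> \<le> 1 / 4"
  shows "1 \<le> 3 / 2 - V + K - E"
  using E bounds by (simp add: abs_le_iff)

lemma even_response_bounds:
  assumes E: "\<bar>E\<bar> \<le> 1 / 4"
  shows "0 \<le> even_response K t V E" "even_response K t V E \<le> 1"
  using even_denominator[OF E] by (simp_all add: even_response_def)

lemma pair_factor:
  assumes E: "\<bar>E\<bar> \<le> 1 / 4"
  shows "\<bar>2 * K / (2 - E)\<bar> \<le> 2 * \<bar>K\<bar>" "\<bar>1 + 2 * K / (2 - E)\<bar> \<le> 2"
proof -
  have "\<bar>2 * K / (2 - E)\<bar> = 2 * \<bar>K\<bar> * (1 / (2 - E))"
    using E by (simp add: abs_mult)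
  also have "\<dots> \<le> 2 * \<bar>K\<bar> * 1"
    using inv_2[OF E] by (intro mult_left_mono) auto
  finally show "\<bar>2 * K / (2 - E)\<bar> \<le> 2 * \<bar>K\<bar>"
    by simp
  then show "\<bar>1 + 2 * K / (2 - E)\<bar> \<le> 2"
    using bounds by linarith
qed

lemma pair_factor_square:
  assumes E: "\<bar>E\<bar> \<le> 1 / 4"
  shows "(1 + 2 * K / (2 - E))\<^sup>2 \<le> 4"
  using square_le_of_abs_le[OF pair_factor(2)[OF E]] by simp

lemma even_self_energy_shift:
  assumes E: "\<bar>E\<bar> \<le> 1 / 4"
  shows "\<bar>even_self_energy K t V E + 4 * V\<bar> \<le> 4 * K\<^sup>2 + 16 * t\<^sup>2"
proof -
  have "0 \<le> K\<^sup>2 * (1 / (2 - E))" "K\<^sup>2 * (1 / (2 - E)) \<le> K\<^sup>2 * 1"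
    using inv_2[OF E] by (simp, intro mult_left_mono) auto
  moreover have "0 \<le> t\<^sup>2 * ((1 + 2 * K / (2 - E))\<^sup>2 * even_response K t V E)"
    using even_response_bounds[OF E] by simp
  moreover have "t\<^sup>2 * ((1 + 2 * K / (2 - E))\<^sup>2 * even_response K t V E) \<le> t\<^sup>2 * (4 * 1)"
    using pair_factor_square[OF E] even_response_bounds[OF E] by (intro mult_left_mono mult_mono) auto
  ultimately show ?thesis
    by (simp add: even_self_energy_def abs_le_iff mult.assoc)
qed

lemma odd_self_energy_shift:
  assumes E: "\<bar>E\<bar> \<le> 1 / 4"
  shows "\<bar>odd_self_energy K t V E + 4 * V\<bar> \<le> 4 * t\<^sup>2"
proof -
  have "0 \<le> t\<^sup>2 * (1 / (3 / 2 - V + K - E))" "t\<^sup>2 * (1 / (3 / 2 - V + K - E)) \<le> t\<^sup>2 * 1"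
    using odd_denominator[OF E] by (simp, intro mult_left_mono) auto
  moreover have "odd_self_energy K t V E + 4 * V = - 4 * (t\<^sup>2 * (1 / (3 / 2 - V + K - E)))"
    by (simp add: odd_self_energy_def)
  ultimately show ?thesis
    by linarith
qed

text \<open>The interval is mapped into itself because 4/40 + 20/1600 < 1/4.\<close>

lemma self_energy_bounds:
  assumes E: "\<bar>E\<bar> \<le> 1 / 4"
  shows "\<bar>even_self_energy K t V E\<bar> \<le> 1 / 4" "\<bar>odd_self_energy K t V E\<bar> \<le> 1 / 4"
  using even_self_energy_shift[OF E] odd_self_energy_shift[OF E] squares bounds by linarith+

lemma odd_self_energy_lipschitz:
  assumes E: "\<bar>E\<bar> \<le> 1 / 4" and F: "\<bar>F\<bar> \<le> 1 / 4"
  shows "\<bar>odd_self_energy K t V E - odd_self_energy K t V F\<bar> \<le> 1 / 2 * \<bar>E - F\<bar>"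
proof -
  have "\<bar>1 / (3 / 2 - V + K - E) - 1 / (3 / 2 - V + K - F)\<bar> \<le> \<bar>(3 / 2 - V + K - E) - (3 / 2 - V + K - F)\<bar>"
    by (intro inverse_diff_le odd_denominator E F)
  also have "\<dots> = \<bar>E - F\<bar>"
    by linarith
  finally have "t\<^sup>2 * \<bar>1 / (3 / 2 - V + K - E) - 1 / (3 / 2 - V + K - F)\<bar> \<le> 1 / 1600 * \<bar>E - F\<bar>"
    using squares by (intro mult_mono) auto
  then have "4 * (t\<^sup>2 * \<bar>1 / (3 / 2 - V + K - E) - 1 / (3 / 2 - V + K - F)\<bar>) \<le> 4 * (1 / 1600 * \<bar>E - F\<bar>)"
    by (intro mult_left_mono) auto
  moreover have "odd_self_energy K t V E - odd_self_energy K t V F =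
      - (4 * (t\<^sup>2 * (1 / (3 / 2 - V + K - E) - 1 / (3 / 2 - V + K - F))))"
    by (simp add: odd_self_energy_def algebra_simps)
  then have "\<bar>odd_self_energy K t V E - odd_self_energy K t V F\<bar> =
      4 * (t\<^sup>2 * \<bar>1 / (3 / 2 - V + K - E) - 1 / (3 / 2 - V + K - F)\<bar>)"
    by (simp only: abs_minus_cancel abs_mult) simp
  ultimately have "\<bar>odd_self_energy K t V E - odd_self_energy K t V F\<bar> \<le> 4 * (1 / 1600 * \<bar>E - F\<bar>)"
    by (simp only:)
  also have "\<dots> \<le> 1 / 2 * \<bar>E - F\<bar>"
    by simp
  finally show ?thesis .
qed

text \<open>The factors \<open>u\<close>, \<open>w\<close>, \<open>a\<close> have Lipschitz
  constants 1, 2, 1 in E. Telescoping the product \<open>a * w\<close> gives 1 + 4 * 2 = 9, and the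
  prefactors leave 4 (1 + 9) / 1600, far below 1/2.\<close>

lemma even_self_energy_lipschitz:
  assumes E: "\<bar>E\<bar> \<le> 1 / 4" and F: "\<bar>F\<bar> \<le> 1 / 4"
  shows "\<bar>even_self_energy K t V E - even_self_energy K t V F\<bar> \<le> 1 / 2 * \<bar>E - F\<bar>"
proof -
  define u u' where "u = 1 / (2 - E)" and "u' = 1 / (2 - F)"
  define w w' where "w = even_response K t V E" and "w' = even_response K t V F"
  define a a' where "a = (1 + 2 * K * u)\<^sup>2" and "a' = (1 + 2 * K * u')\<^sup>2"
  have u: "0 \<le> u" "u \<le> 1" "0 \<le> u'" "u' \<le> 1"
    using inv_2[OF E] inv_2[OF F] by (simp_all add: u_def u'_def)
  have "\<bar>u - u'\<bar> \<le> \<bar>(2 - E) - (2 - F)\<bar>"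
    unfolding u_def u'_def using E F by (intro inverse_diff_le) linarith+
  then have du: "\<bar>u - u'\<bar> \<le> \<bar>E - F\<bar>"
    by linarith
  have "\<bar>w - w'\<bar> \<le> \<bar>(3 / 2 - V - K - E - 12 * t\<^sup>2 / (2 - E)) - (3 / 2 - V - K - F - 12 * t\<^sup>2 / (2 - F))\<bar>"
    unfolding w_def w'_def even_response_def by (intro inverse_diff_le even_denominator E F)
  also have "\<dots> = \<bar>(E - F) + 12 * (t\<^sup>2 * (u - u'))\<bar>"
    unfolding u_def u'_def by (simp add: algebra_simps abs_minus_commute)
  also have "\<dots> \<le> \<bar>E - F\<bar> + 12 * \<bar>t\<^sup>2 * (u - u')\<bar>"
    using abs_triangle_ineq[of "E - F" "12 * (t\<^sup>2 * (u - u'))"] by (simp add: abs_mult)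
  also have "\<dots> \<le> \<bar>E - F\<bar> + 12 * (1 / 1600 * \<bar>E - F\<bar>)"
    unfolding abs_mult using squares du by (intro add_left_mono mult_left_mono mult_mono) auto
  also have "\<dots> \<le> 2 * \<bar>E - F\<bar>"
    by simp
  finally have dw: "\<bar>w - w'\<bar> \<le> 2 * \<bar>E - F\<bar>" .
  have aa: "a - a' = 4 * (K * (u - u')) * (1 + K * (u + u'))"
    by (simp add: a_def a'_def power2_eq_square algebra_simps)
  have "\<bar>K * (u - u')\<bar> \<le> 1 / 40 * \<bar>E - F\<bar>"
    unfolding abs_mult using bounds du by (intro mult_mono) auto
  moreover have "\<bar>1 + K * (u + u')\<bar> \<le> 2"
  proof -
    have "\<bar>K * (u + u')\<bar> \<le> 1 / 40 * 2"
      unfolding abs_mult using bounds u by (intro mult_mono) auto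
    then show ?thesis
      by linarith
  qed
  ultimately have "\<bar>K * (u - u')\<bar> * \<bar>1 + K * (u + u')\<bar> \<le> 1 / 40 * \<bar>E - F\<bar> * 2"
    by (intro mult_mono) auto
  moreover have "\<bar>a - a'\<bar> = 4 * (\<bar>K * (u - u')\<bar> * \<bar>1 + K * (u + u')\<bar>)"
    unfolding aa abs_mult by simp
  ultimately have da: "\<bar>a - a'\<bar> \<le> \<bar>E - F\<bar>"
    by simp
  have a': "0 \<le> a'" "a' \<le> 4"
    using pair_factor_square[OF F] by (simp_all add: a'_def u'_def)
  have w: "0 \<le> w" "w \<le> 1"
    using even_response_bounds[OF E] by (simp_all add: w_def)
  have "\<bar>(a - a') * w\<bar> \<le> \<bar>E - F\<bar> * 1"
    unfolding abs_mult using da w by (intro mult_mono) auto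
  moreover have "\<bar>a' * (w - w')\<bar> \<le> 4 * (2 * \<bar>E - F\<bar>)"
    unfolding abs_mult using dw a' by (intro mult_mono) auto
  ultimately have "\<bar>(a - a') * w + a' * (w - w')\<bar> \<le> \<bar>E - F\<bar> * 1 + 4 * (2 * \<bar>E - F\<bar>)"
    by (rule abs_add_le)
  then have daw: "\<bar>a * w - a' * w'\<bar> \<le> 9 * \<bar>E - F\<bar>"
    by (simp add: algebra_simps)
  have "\<bar>K\<^sup>2 * (u - u')\<bar> \<le> 1 / 1600 * \<bar>E - F\<bar>"
    unfolding abs_mult using squares du by (intro mult_mono) auto
  moreover have "\<bar>t\<^sup>2 * (a * w - a' * w')\<bar> \<le> 1 / 1600 * (9 * \<bar>E - F\<bar>)"
    unfolding abs_mult using squares daw by (intro mult_mono) auto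
  moreover have "even_self_energy K t V E - even_self_energy K t V F =
      - 4 * (K\<^sup>2 * (u - u')) - 4 * (t\<^sup>2 * (a * w - a' * w'))"
    by (simp add: even_self_energy_def u_def u'_def a_def a'_def w_def w'_def algebra_simps)
  moreover have "\<bar>- 4 * x - 4 * y\<bar> \<le> 1 / 2 * d" if "\<bar>x\<bar> \<le> 1 / 1600 * d" "\<bar>y\<bar> \<le> 1 / 1600 * (9 * d)" for x y d :: real
    using that by linarith
  ultimately show ?thesis
    by (simp only:)
qed

end

text \<open>Back substitution: a fixed point of the self-energy restores the eliminated amplitudes.
  The three bounds keep the perturbed vectors as close to the ground vectors as
  \<open>sector_gap\<close> demands.\<close>

lemma even_solution:
  assumes bounds: "\<bar>K\<bar> \<le> 1 / 40" "\<bar>t\<bar> \<le> 1 / 40" "\<bar>V\<bar> \<le> 1 / 40"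
    and E: "\<bar>E\<bar> \<le> 1 / 4" "E = even_self_energy K t V E"
    and \<beta>: "\<beta> = t * (1 + 2 * K / (2 - E)) * even_response K t V E"
    and \<gamma>: "\<gamma> = (2 * K + 4 * t * \<beta>) / (2 - E)" and \<delta>: "\<delta> = 4 * t * \<beta> / (2 - E)"
  shows "E = - 4 * V - 4 * t * \<beta> - 2 * K * \<gamma>"
    and "\<beta> * (3 / 2 - V - K - E) = t * (1 + \<gamma> + 2 * \<delta>)"
    and "\<gamma> * (2 - E) = 2 * K + 4 * t * \<beta>" and "\<delta> * (2 - E) = 4 * t * \<beta>"
    and "\<bar>\<beta>\<bar> \<le> 1 / 20" and "\<bar>\<gamma>\<bar> \<le> 1 / 10" and "\<bar>\<delta>\<bar> \<le> 1 / 40"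
proof -
  define u w where "u = 1 / (2 - E)" and "w = even_response K t V E"
  have u: "0 \<le> u" "u \<le> 1"
    using inv_2[OF bounds E(1)] by (simp_all add: u_def)
  have \<beta>': "\<beta> = t * (1 + 2 * K * u) * w" and \<gamma>': "\<gamma> = (2 * K + 4 * t * \<beta>) * u"
    and \<delta>': "\<delta> = 4 * t * \<beta> * u"
    using \<beta> \<gamma> \<delta> by (simp_all add: u_def w_def)
  have "E = - 4 * V - 4 * K\<^sup>2 * u - 4 * t\<^sup>2 * (1 + 2 * K * u)\<^sup>2 * w"
    by (subst E(2)) (simp add: even_self_energy_def u_def w_def)
  then show "E = - 4 * V - 4 * t * \<beta> - 2 * K * \<gamma>"
    unfolding \<gamma>' \<beta>' by (simp add: power2_eq_square algebra_simps)
  have "w * (3 / 2 - V - K - E - 12 * t\<^sup>2 * u) = 1"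
    using even_denominator[OF bounds E(1)] by (simp add: w_def even_response_def u_def)
  then have "t * (1 + 2 * K * u) * (w * (3 / 2 - V - K - E - 12 * t\<^sup>2 * u)) = t * (1 + 2 * K * u)"
    by simp
  then have "\<beta> * (3 / 2 - V - K - E) = t * (1 + 2 * K * u) + 12 * t\<^sup>2 * u * \<beta>"
    unfolding \<beta>' by (simp add: algebra_simps)
  then show "\<beta> * (3 / 2 - V - K - E) = t * (1 + \<gamma> + 2 * \<delta>)"
    unfolding \<gamma>' \<delta>' by (simp add: power2_eq_square algebra_simps)
  show "\<gamma> * (2 - E) = 2 * K + 4 * t * \<beta>" "\<delta> * (2 - E) = 4 * t * \<beta>"
    using E(1) by (auto simp: \<gamma> \<delta>)
  have "\<bar>t * (1 + 2 * K * u)\<bar> \<le> 1 / 40 * 2"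
    unfolding abs_mult using bounds(2) pair_factor(2)[OF bounds E(1)] by (intro mult_mono) (auto simp: u_def)
  then have "\<bar>\<beta>\<bar> \<le> 1 / 40 * 2 * 1"
    unfolding \<beta>' abs_mult[of _ w] using even_response_bounds[OF bounds E(1)]
    by (intro mult_mono) (auto simp: w_def)
  then show b: "\<bar>\<beta>\<bar> \<le> 1 / 20"
    by simp
  have "\<bar>t * \<beta>\<bar> \<le> 1 / 40 * (1 / 20)"
    unfolding abs_mult using bounds b by (intro mult_mono) auto
  then have "\<bar>4 * t * \<beta>\<bar> \<le> 1 / 40"
    by (simp add: mult.assoc)
  moreover from this have "\<bar>2 * K + 4 * t * \<beta>\<bar> \<le> 1 / 10"
    using bounds abs_triangle_ineq[of "2 * K" "4 * t * \<beta>"] unfolding abs_mult[of 2 K] by simp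
  ultimately have tb: "\<bar>4 * t * \<beta>\<bar> \<le> 1 / 40" "\<bar>2 * K + 4 * t * \<beta>\<bar> \<le> 1 / 10"
    by blast+
  have "\<bar>4 * t * \<beta>\<bar> * \<bar>u\<bar> \<le> 1 / 40 * 1" "\<bar>2 * K + 4 * t * \<beta>\<bar> * \<bar>u\<bar> \<le> 1 / 10 * 1"
    using tb u by (intro mult_mono; simp)+
  then show "\<bar>\<gamma>\<bar> \<le> 1 / 10" "\<bar>\<delta>\<bar> \<le> 1 / 40"
    unfolding \<gamma>' \<delta>' abs_mult[of _ u] by simp_all
qed

lemma odd_solution:
  assumes bounds: "\<bar>K\<bar> \<le> 1 / 40" "\<bar>t\<bar> \<le> 1 / 40" "\<bar>V\<bar> \<le> 1 / 40"
    and E: "\<bar>E\<bar> \<le> 1 / 4" "E = odd_self_energy K t V E"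
    and \<beta>: "\<beta> = t / (3 / 2 - V + K - E)"
  shows "E = - 4 * V - 4 * t * \<beta>" and "\<beta> * (3 / 2 - V + K - E) = t" and "\<bar>\<beta>\<bar> \<le> 1 / 40"
proof -
  show "E = - 4 * V - 4 * t * \<beta>"
    by (subst E(2)) (simp add: odd_self_energy_def \<beta> power2_eq_square)
  have d: "1 \<le> 3 / 2 - V + K - E"
    by (rule odd_denominator[OF bounds E(1)])
  then show "\<beta> * (3 / 2 - V + K - E) = t"
    by (simp add: \<beta>)
  have "\<bar>\<beta>\<bar> \<le> \<bar>t\<bar> / 1"
    unfolding \<beta> abs_divide using d by (intro divide_left_mono) auto
  then show "\<bar>\<beta>\<bar> \<le> 1 / 40"
    using bounds by simp
qed

text \<open>The perturbation is linear in the couplings, so three fixed matrix norms suffice. They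
  are never evaluated, which is why the later radius \<rho> is not a number; the added 1 secures
  \<open>C > 0\<close>.\<close>

lemma perturbation_bound:
  obtains C where "C > 0" "\<And>K t V v. norm (cip v ((H_pair K + H_hop t + H_nn V) *v v)) \<le>
    C * (\<bar>K\<bar> + \<bar>t\<bar> + \<bar>V\<bar>) * (norm v)\<^sup>2"
proof -
  define C where "C = norm (H_pair 1) + norm (H_hop 1) + norm (H_nn 1) + 1"
  have "norm (cip v ((H_pair K + H_hop t + H_nn V) *v v)) \<le> C * (\<bar>K\<bar> + \<bar>t\<bar> + \<bar>V\<bar>) * (norm v)\<^sup>2" for K t V v
  proof -
    have "norm (H_pair K + H_hop t + H_nn V) \<le> norm (H_pair K) + norm (H_hop t) + norm (H_nn V)"
      by (intro norm_triangle_le add_right_mono norm_triangle_ineq)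
    also have "\<dots> = \<bar>K\<bar> * norm (H_pair 1) + \<bar>t\<bar> * norm (H_hop 1) + \<bar>V\<bar> * norm (H_nn 1)"
      using H_scale(2)[of K 1] H_scale(3)[of t 1] H_scale(4)[of V 1] by simp
    also have "\<dots> \<le> \<bar>K\<bar> * C + \<bar>t\<bar> * C + \<bar>V\<bar> * C"
      by (intro add_mono mult_left_mono) (auto simp: C_def)
    finally have *: "norm (H_pair K + H_hop t + H_nn V) \<le> C * (\<bar>K\<bar> + \<bar>t\<bar> + \<bar>V\<bar>)"
      by (simp add: algebra_simps)
    have "norm (cip v ((H_pair K + H_hop t + H_nn V) *v v)) \<le> norm v * (norm (H_pair K + H_hop t + H_nn V) * norm v)"
      by (rule order_trans[OF norm_cip_le]) (intro mult_left_mono norm_mult_vec_le norm_ge_zero)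
    also have "\<dots> \<le> norm v * (C * (\<bar>K\<bar> + \<bar>t\<bar> + \<bar>V\<bar>) * norm v)"
      by (intro mult_left_mono mult_right_mono * norm_ge_zero)
    finally show ?thesis
      by (simp add: power2_eq_square mult_ac)
  qed
  moreover have "C > 0"
    by (simp add: C_def add_nonneg_pos)
  ultimately show ?thesis
    using that by blast
qed

lemma effective_couplings_exist:
  obtains \<rho> where "\<rho> > 0" "\<rho> \<le> 1 / 40"
    "\<And>K t V. \<lbrakk>\<bar>K\<bar> \<le> \<rho>; \<bar>t\<bar> \<le> \<rho>; \<bar>V\<bar> \<le> \<rho>\<rbrakk> \<Longrightarrow> \<exists>E\<^sub>e E\<^sub>o. \<bar>E\<^sub>e\<bar> \<le> 1 / 4 \<and> \<bar>E\<^sub>o\<bar> \<le> 1 / 4 \<and>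
      E\<^sub>e = even_self_energy K t V E\<^sub>e \<and> E\<^sub>o = odd_self_energy K t V E\<^sub>o \<and>
      t_b 1 K t V = complex_of_real ((E\<^sub>o - E\<^sub>e) / 2) \<and> V_b 1 K t V = complex_of_real (8 * V - E\<^sub>e - E\<^sub>o)"
proof -
  obtain C where C: "C > 0" "\<And>K t V v. norm (cip v ((H_pair K + H_hop t + H_nn V) *v v)) \<le>
      C * (\<bar>K\<bar> + \<bar>t\<bar> + \<bar>V\<bar>) * (norm v)\<^sup>2"
    using perturbation_bound by blast
  \<comment> \<open>The first bound makes the self-energies contractions; the second gives C times 3
    \<rho> at most 1/4, the size of perturbation that the gap tolerates.\<close>
  define \<rho> where "\<rho> = min (1 / 40) (1 / (12 * C))"
  have "\<exists>E\<^sub>e E\<^sub>o. \<bar>E\<^sub>e\<bar> \<le> 1 / 4 \<and> \<bar>E\<^sub>o\<bar> \<le> 1 / 4 \<and>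
      E\<^sub>e = even_self_energy K t V E\<^sub>e \<and> E\<^sub>o = odd_self_energy K t V E\<^sub>o \<and>
      t_b 1 K t V = complex_of_real ((E\<^sub>o - E\<^sub>e) / 2) \<and> V_b 1 K t V = complex_of_real (8 * V - E\<^sub>e - E\<^sub>o)"
    if KtV: "\<bar>K\<bar> \<le> \<rho>" "\<bar>t\<bar> \<le> \<rho>" "\<bar>V\<bar> \<le> \<rho>" for K t V
  proof -
    have small: "\<bar>K\<bar> \<le> 1 / 40" "\<bar>t\<bar> \<le> 1 / 40" "\<bar>V\<bar> \<le> 1 / 40"
      using KtV by (auto simp: \<rho>_def)
    have b: "\<bar>s * K\<bar> \<le> 1 / 40" "\<bar>s * t\<bar> \<le> 1 / 40" "\<bar>s * V\<bar> \<le> 1 / 40" if "s \<in> {0..1}" for s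
      using that small mult_mono[of s 1 "\<bar>K\<bar>" "1 / 40"] mult_mono[of s 1 "\<bar>t\<bar>" "1 / 40"]
        mult_mono[of s 1 "\<bar>V\<bar>" "1 / 40"] by (auto simp: abs_mult)
    have nz2: "2 - E \<noteq> 0" if "\<bar>E\<bar> \<le> 1 / 4" for E :: real
      using that by auto
    have nze: "3 / 2 - s * V - s * K - E - 12 * (s * t)\<^sup>2 / (2 - E) \<noteq> 0" if "s \<in> {0..1}" "\<bar>E\<bar> \<le> 1 / 4" for s E
      using even_denominator[OF b[OF that(1)] that(2)] by linarith
    have nzo: "3 / 2 - s * V + s * K - E \<noteq> 0" if "s \<in> {0..1}" "\<bar>E\<bar> \<le> 1 / 4" for s E
      using odd_denominator[OF b[OF that(1)] that(2)] by linarith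
    \<comment> \<open>The energy is needed as a continuous function of \<open>s\<close>, since the
      amplitudes built from it must trace a continuous path of projectors.\<close>
    obtain E\<^sub>e where E\<^sub>e: "continuous_on {0..1} E\<^sub>e" "\<And>s. s \<in> {0..1} \<Longrightarrow> \<bar>E\<^sub>e s\<bar> \<le> 1 / 4"
      "\<And>s. s \<in> {0..1} \<Longrightarrow> E\<^sub>e s = even_self_energy (s * K) (s * t) (s * V) (E\<^sub>e s)"
    proof (rule fixed_point_curve[of "1 / 4" "{0..1}" "\<lambda>s. even_self_energy (s * K) (s * t) (s * V)"])
      show "continuous_on {0..1} (\<lambda>s. even_self_energy (s * K) (s * t) (s * V) x)" if "\<bar>x\<bar> \<le> 1 / 4" for x
        unfolding even_self_energy_def even_response_def using that nz2 nze
        by (intro continuous_intros) auto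
    qed (use b self_energy_bounds even_self_energy_lipschitz in auto)
    obtain E\<^sub>o where E\<^sub>o: "continuous_on {0..1} E\<^sub>o" "\<And>s. s \<in> {0..1} \<Longrightarrow> \<bar>E\<^sub>o s\<bar> \<le> 1 / 4"
      "\<And>s. s \<in> {0..1} \<Longrightarrow> E\<^sub>o s = odd_self_energy (s * K) (s * t) (s * V) (E\<^sub>o s)"
    proof (rule fixed_point_curve[of "1 / 4" "{0..1}" "\<lambda>s. odd_self_energy (s * K) (s * t) (s * V)"])
      show "continuous_on {0..1} (\<lambda>s. odd_self_energy (s * K) (s * t) (s * V) x)" if "\<bar>x\<bar> \<le> 1 / 4" for x
        unfolding odd_self_energy_def using that nzo
        by (intro continuous_intros) auto
    qed (use b self_energy_bounds odd_self_energy_lipschitz in auto)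
    define \<beta> where "\<beta> s = s * t * (1 + 2 * (s * K) / (2 - E\<^sub>e s)) * even_response (s * K) (s * t) (s * V) (E\<^sub>e s)" for s
    define \<gamma> where "\<gamma> s = (2 * (s * K) + 4 * (s * t) * \<beta> s) / (2 - E\<^sub>e s)" for s
    define \<delta> where "\<delta> s = 4 * (s * t) * \<beta> s / (2 - E\<^sub>e s)" for s
    define \<epsilon> where "\<epsilon> s = s * t / (3 / 2 - s * V + s * K - E\<^sub>o s)" for s
    have nz: "2 - E\<^sub>e s \<noteq> 0" "3 / 2 - s * V - s * K - E\<^sub>e s - 12 * (s * t)\<^sup>2 / (2 - E\<^sub>e s) \<noteq> 0"
      "3 / 2 - s * V + s * K - E\<^sub>o s \<noteq> 0" if "s \<in> {0..1}" for s
      using that nz2 nze nzo E\<^sub>e(2) E\<^sub>o(2) by blast+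
    have cont: "continuous_on {0..1} \<beta>"
      unfolding \<beta>_def even_response_def using nz by (intro continuous_intros E\<^sub>e) blast+
    have even: "E\<^sub>e s = - 4 * (s * V) - 4 * (s * t) * \<beta> s - 2 * (s * K) * \<gamma> s"
      "\<beta> s * (3 / 2 - s * V - s * K - E\<^sub>e s) = s * t * (1 + \<gamma> s + 2 * \<delta> s)"
      "\<gamma> s * (2 - E\<^sub>e s) = 2 * (s * K) + 4 * (s * t) * \<beta> s" "\<delta> s * (2 - E\<^sub>e s) = 4 * (s * t) * \<beta> s"
      "\<bar>\<beta> s\<bar> \<le> 1 / 20" "\<bar>\<gamma> s\<bar> \<le> 1 / 10" "\<bar>\<delta> s\<bar> \<le> 1 / 40"
      if "s \<in> {0..1}" for s
      using even_solution[OF b[OF that] E\<^sub>e(2,3)[OF that] \<beta>_def \<gamma>_def \<delta>_def] by blast+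
    have odd: "E\<^sub>o s = - 4 * (s * V) - 4 * (s * t) * \<epsilon> s" "\<epsilon> s * (3 / 2 - s * V + s * K - E\<^sub>o s) = s * t"
      "\<bar>\<epsilon> s\<bar> \<le> 1 / 40" if "s \<in> {0..1}" for s
      using odd_solution[OF b[OF that] E\<^sub>o(2,3)[OF that] \<epsilon>_def] by blast+
    have "H_eff 1 K t V = (\<Sum>k\<in>UNIV. outer (complex_of_real (sector_energy V (E\<^sub>e 1) (E\<^sub>o 1) k) *s ground k) (ground k))"
    proof (rule H_eff_eq[where \<beta> = \<beta> and \<gamma> = \<gamma> and \<delta> = \<delta> and \<epsilon> = \<epsilon>])
      show "continuous_on {0..1} \<beta>"
        by (rule cont)
      show "continuous_on {0..1} \<gamma>" "continuous_on {0..1} \<delta>" "continuous_on {0..1} \<epsilon>"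
        unfolding \<gamma>_def \<delta>_def \<epsilon>_def using nz by (intro continuous_intros E\<^sub>e E\<^sub>o cont; blast)+
      show "\<beta> 0 = 0" "\<gamma> 0 = 0" "\<delta> 0 = 0" "\<epsilon> 0 = 0"
        by (simp_all add: \<beta>_def \<gamma>_def \<delta>_def \<epsilon>_def)
      show "4 * (\<beta> s)\<^sup>2 + (\<gamma> s)\<^sup>2 + 2 * (\<delta> s)\<^sup>2 + 4 * (\<epsilon> s)\<^sup>2 \<le> 1 / 4" if s: "s \<in> {0..1}" for s
        using square_le_of_abs_le[OF even(5)[OF s]] square_le_of_abs_le[OF even(6)[OF s]]
          square_le_of_abs_le[OF even(7)[OF s]] square_le_of_abs_le[OF odd(3)[OF s]]
        by (simp add: power_divide)
      show "E\<^sub>e s \<le> 1 / 4" "E\<^sub>o s \<le> 1 / 4" if "s \<in> {0..1}" for s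
        using E\<^sub>e(2)[OF that] E\<^sub>o(2)[OF that] by linarith+
      show "norm (cip v ((H_pair K + H_hop t + H_nn V) *v v)) \<le> 1 / 4 * (norm v)\<^sup>2" for v
      proof -
        have "\<bar>K\<bar> + \<bar>t\<bar> + \<bar>V\<bar> \<le> 3 * (1 / (12 * C))"
          using KtV by (simp add: \<rho>_def)
        then have "C * (\<bar>K\<bar> + \<bar>t\<bar> + \<bar>V\<bar>) \<le> C * (3 * (1 / (12 * C)))"
          using C(1) by (intro mult_left_mono) auto
        also have "\<dots> = 1 / 4"
          using C(1) by simp
        finally show ?thesis
          by (rule order_trans[OF C(2) mult_right_mono]) simp
      qed
    qed (use even odd small in auto)
    from effective_couplings[OF this] E\<^sub>e(2,3)[of 1] E\<^sub>o(2,3)[of 1] show ?thesis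
      by (intro exI[of _ "E\<^sub>e 1"] exI[of _ "E\<^sub>o 1"]) auto
  qed
  moreover have "\<rho> > 0" "\<rho> \<le> 1 / 40"
    using C by (auto simp: \<rho>_def)
  ultimately show ?thesis
    using that by blast
qed

section \<open>Expansion of the energies\<close>

lemma abs_mult_le:
  fixes x y a b :: real
  assumes "\<bar>x\<bar> \<le> a" "\<bar>y\<bar> \<le> b"
  shows "\<bar>x * y\<bar> \<le> a * b"
  unfolding abs_mult using assms by (intro mult_mono) auto

text \<open>An exact identity, used to gain one order at a time: a bound on the shift
  \<open>y\<close> becomes a bound on the error of replacing the denominator by its unperturbed
  value.\<close>

lemma resolvent_expansion:
  fixes c d y :: real
  assumes "c \<noteq> 0" "c - y \<noteq> 0"
  shows "1 / (c - y) - 1 / c = 1 / c * (1 / (c - y)) * y"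
  using assms by (simp add: field_simps)

text \<open>Bootstrapping: the crude shift bound gives |E| <= 5 m, hence \<open>w\<close> is 2/3 up
  to 5 m, and the prefactor t^2 turns this into third order. The constant 50 is shared with the even
  case.\<close>

lemma odd_energy_second_order:
  assumes m: "\<bar>K\<bar> \<le> m" "\<bar>t\<bar> \<le> m" "\<bar>V\<bar> \<le> m" "m \<le> 1 / 40"
    and E: "\<bar>E\<bar> \<le> 1 / 4" "E = odd_self_energy K t V E"
  shows "\<bar>E + 4 * V + 8 / 3 * t\<^sup>2\<bar> \<le> 50 * m ^ 3"
proof -
  have bounds: "\<bar>K\<bar> \<le> 1 / 40" "\<bar>t\<bar> \<le> 1 / 40" "\<bar>V\<bar> \<le> 1 / 40" and m0: "0 \<le> m"
    using m by linarith+
  have t2: "\<bar>t\<^sup>2\<bar> \<le> m\<^sup>2"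
    using square_le_of_abs_le[OF m(2)] by simp
  have m2: "m\<^sup>2 \<le> 1 / 40 * m"
    unfolding power2_eq_square using m(4) m0 by (rule mult_right_mono)
  have "\<bar>E + 4 * V\<bar> \<le> 4 * t\<^sup>2"
    using odd_self_energy_shift[OF bounds E(1)] E(2) by simp
  then have E5: "\<bar>E\<bar> \<le> 5 * m"
    using m t2 m2 by linarith
  define w where "w = 1 / (3 / 2 - (V - K + E))"
  have d: "1 \<le> 3 / 2 - (V - K + E)"
    using odd_denominator[OF bounds E(1)] by simp
  have w: "\<bar>w\<bar> \<le> 1"
    using d by (simp add: w_def)
  have "w - 2 / 3 = 2 / 3 * (w * (V - K + E))"
    unfolding w_def using resolvent_expansion[of "3 / 2" "V - K + E"] d by simp
  moreover have "\<bar>w * (V - K + E)\<bar> \<le> 1 * (7 * m)"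
    by (rule abs_mult_le[OF w]) (use m E5 in linarith)
  ultimately have "\<bar>w - 2 / 3\<bar> \<le> 5 * m"
    using m0 by linarith
  then have "\<bar>t\<^sup>2 * (w - 2 / 3)\<bar> \<le> m\<^sup>2 * (5 * m)"
    by (rule abs_mult_le[OF t2])
  moreover have "E = - 4 * V - 4 * t\<^sup>2 * w"
    by (subst E(2)) (simp add: odd_self_energy_def w_def algebra_simps)
  then have "E + 4 * V + 8 / 3 * t\<^sup>2 = - (4 * (t\<^sup>2 * (w - 2 / 3)))"
    by (simp add: algebra_simps)
  then have "\<bar>E + 4 * V + 8 / 3 * t\<^sup>2\<bar> = 4 * \<bar>t\<^sup>2 * (w - 2 / 3)\<bar>"
    by (simp add: abs_mult)
  moreover have "m\<^sup>2 * (5 * m) = 5 * m ^ 3" "0 \<le> m ^ 3"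
    using m0 by (simp_all add: power2_eq_square power3_eq_cube)
  ultimately show ?thesis
    by linarith
qed

text \<open>The same bootstrapping, with \<open>u\<close> near 1/2 producing 2 K^2. The factor (1 +
  2 K u)^2 differs from 1 by order m, so its cross terms in K and t are of third order. The constant
  is 50 = 4 * 5/2 + 4 * 10.\<close>

lemma even_energy_second_order:
  assumes m: "\<bar>K\<bar> \<le> m" "\<bar>t\<bar> \<le> m" "\<bar>V\<bar> \<le> m" "m \<le> 1 / 40"
    and E: "\<bar>E\<bar> \<le> 1 / 4" "E = even_self_energy K t V E"
  shows "\<bar>E + 4 * V + 2 * K\<^sup>2 + 8 / 3 * t\<^sup>2\<bar> \<le> 50 * m ^ 3"
proof -
  have bounds: "\<bar>K\<bar> \<le> 1 / 40" "\<bar>t\<bar> \<le> 1 / 40" "\<bar>V\<bar> \<le> 1 / 40" and m0: "0 \<le> m"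
    using m by linarith+
  have K2: "\<bar>K\<^sup>2\<bar> \<le> m\<^sup>2" and t2: "\<bar>t\<^sup>2\<bar> \<le> m\<^sup>2"
    using square_le_of_abs_le[OF m(1)] square_le_of_abs_le[OF m(2)] by simp_all
  have m2: "m\<^sup>2 \<le> 1 / 40 * m"
    unfolding power2_eq_square using m(4) m0 by (rule mult_right_mono)
  have "\<bar>E + 4 * V\<bar> \<le> 4 * K\<^sup>2 + 16 * t\<^sup>2"
    using even_self_energy_shift[OF bounds E(1)] E(2) by simp
  then have E5: "\<bar>E\<bar> \<le> 5 * m"
    using m K2 t2 m2 by linarith
  define u where "u = 1 / (2 - E)"
  define w where "w = even_response K t V E"
  define y where "y = V + K + E + 12 * (t\<^sup>2 * u)"
  have u: "\<bar>u\<bar> \<le> 1"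
    using inv_2[OF bounds E(1)] by (simp add: u_def)
  have w: "\<bar>w\<bar> \<le> 1"
    using even_response_bounds[OF bounds E(1)] by (simp add: w_def)
  have w_eq: "w = 1 / (3 / 2 - y)"
    by (simp add: w_def y_def u_def even_response_def algebra_simps)
  have d: "1 \<le> 3 / 2 - y"
    using even_denominator[OF bounds E(1)] by (simp add: y_def u_def algebra_simps)
  have "u - 1 / 2 = 1 / 2 * (u * E)"
    unfolding u_def using resolvent_expansion[of 2 E] E(1) by auto
  moreover have "\<bar>u * E\<bar> \<le> 1 * (5 * m)"
    by (rule abs_mult_le[OF u E5])
  ultimately have du: "\<bar>u - 1 / 2\<bar> \<le> 5 / 2 * m"
    by linarith
  have "\<bar>t\<^sup>2 * u\<bar> \<le> m\<^sup>2 * 1"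
    by (rule abs_mult_le[OF t2 u])
  then have y: "\<bar>y\<bar> \<le> 15 / 2 * m"
    unfolding y_def using m E5 m2 by linarith
  have "w - 2 / 3 = 2 / 3 * (w * y)"
    unfolding w_eq using resolvent_expansion[of "3 / 2" y] d by simp
  moreover have "\<bar>w * y\<bar> \<le> 1 * (15 / 2 * m)"
    by (rule abs_mult_le[OF w y])
  ultimately have dw: "\<bar>w - 2 / 3\<bar> \<le> 5 * m"
    by linarith
  have Ku: "\<bar>K * u\<bar> \<le> m * 1"
    by (rule abs_mult_le[OF m(1) u])
  have "\<bar>K * u * (1 + K * u)\<bar> \<le> m * 1 * (5 / 4)"
    by (rule abs_mult_le[OF Ku]) (use Ku m in linarith)
  moreover have "(1 + 2 * K * u)\<^sup>2 - 1 = 4 * (K * u * (1 + K * u))"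
    by (simp add: power2_eq_square algebra_simps)
  ultimately have "\<bar>(1 + 2 * K * u)\<^sup>2 - 1\<bar> \<le> 5 * m"
    by linarith
  then have "\<bar>((1 + 2 * K * u)\<^sup>2 - 1) * w\<bar> \<le> 5 * m * 1"
    by (rule abs_mult_le[OF _ w])
  moreover have "(1 + 2 * K * u)\<^sup>2 * w - 2 / 3 = ((1 + 2 * K * u)\<^sup>2 - 1) * w + (w - 2 / 3)"
    by (simp add: algebra_simps)
  ultimately have "\<bar>(1 + 2 * K * u)\<^sup>2 * w - 2 / 3\<bar> \<le> 10 * m"
    using dw by linarith
  then have T: "\<bar>t\<^sup>2 * ((1 + 2 * K * u)\<^sup>2 * w - 2 / 3)\<bar> \<le> m\<^sup>2 * (10 * m)"
    by (rule abs_mult_le[OF t2])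
  have Q: "\<bar>K\<^sup>2 * (u - 1 / 2)\<bar> \<le> m\<^sup>2 * (5 / 2 * m)"
    by (rule abs_mult_le[OF K2 du])
  have "E = - 4 * V - 4 * K\<^sup>2 * u - 4 * t\<^sup>2 * (1 + 2 * K * u)\<^sup>2 * w"
    by (subst E(2)) (simp add: even_self_energy_def w_def u_def)
  then have "E + 4 * V + 2 * K\<^sup>2 + 8 / 3 * t\<^sup>2 =
      - 4 * (K\<^sup>2 * (u - 1 / 2)) - 4 * (t\<^sup>2 * ((1 + 2 * K * u)\<^sup>2 * w - 2 / 3))"
    by (simp add: algebra_simps)
  moreover have "\<bar>- 4 * a - 4 * b\<bar> \<le> 50 * c" if "\<bar>a\<bar> \<le> 5 / 2 * c" "\<bar>b\<bar> \<le> 10 * c" for a b c :: real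
    using that by linarith
  moreover have "m\<^sup>2 * (5 / 2 * m) = 5 / 2 * m ^ 3" "m\<^sup>2 * (10 * m) = 10 * m ^ 3"
    by (simp_all add: power2_eq_square power3_eq_cube)
  ultimately show ?thesis
    using T Q by (simp only:)
qed

text \<open>Here \<open>\<tau> = t\<^sup>2\<close>, and \<open>\<alpha> \<tau>\<close> is the leading part of the shift of the singly-hopped level
  by its coupling to the doubly-hopped ones.\<close>

lemma hopping_energy_fourth_order:
  fixes E w \<eta> \<tau> \<alpha> :: real
  assumes \<tau>: "0 \<le> \<tau>" "\<tau> \<le> 1 / 1600" and E: "E = - 4 * (\<tau> * w)"
    and w: "\<bar>w\<bar> \<le> 1" "w - 2 / 3 = 2 / 3 * (w * (E + \<eta>))"
    and \<eta>: "\<bar>\<eta> - \<alpha> * \<tau>\<bar> \<le> 24 * \<tau>\<^sup>2" and \<alpha>: "0 \<le> \<alpha>" "\<alpha> \<le> 6"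
  shows "\<bar>E + 8 / 3 * \<tau>\<bar> \<le> 32 * \<tau>\<^sup>2"
    and "\<bar>E + 8 / 3 * \<tau> + 16 / 9 * (\<alpha> - 8 / 3) * \<tau>\<^sup>2\<bar> \<le> 340 * \<tau> ^ 3"
proof -
  have \<tau>': "\<bar>\<tau>\<bar> \<le> \<tau>"
    using \<tau> by simp
  have "\<bar>\<tau> * w\<bar> \<le> \<tau> * 1"
    by (rule abs_mult_le[OF \<tau>' w(1)])
  then have E4: "\<bar>E\<bar> \<le> 4 * \<tau>"
    using E by linarith
  have "\<tau>\<^sup>2 \<le> 1 / 1600 * \<tau>"
    unfolding power2_eq_square using \<tau> by (intro mult_right_mono) auto
  moreover have "0 \<le> \<alpha> * \<tau>" "\<alpha> * \<tau> \<le> 6 * \<tau>"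
    using \<tau> \<alpha> by (simp_all add: mult_right_mono)
  ultimately have y: "\<bar>E + \<eta>\<bar> \<le> 11 * \<tau>"
    using E4 \<eta> by linarith
  have "\<bar>w * (E + \<eta>)\<bar> \<le> 1 * (11 * \<tau>)"
    by (rule abs_mult_le[OF w(1) y])
  then have dw: "\<bar>w - 2 / 3\<bar> \<le> 8 * \<tau>"
    using w(2) \<tau>(1) by linarith
  have "\<bar>\<tau> * (w - 2 / 3)\<bar> \<le> \<tau> * (8 * \<tau>)"
    by (rule abs_mult_le[OF \<tau>' dw])
  moreover have "E + 8 / 3 * \<tau> = - 4 * (\<tau> * (w - 2 / 3))"
    by (simp add: E algebra_simps)
  moreover have "\<tau> * (8 * \<tau>) = 8 * \<tau>\<^sup>2"
    by (simp add: power2_eq_square)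
  ultimately show E8: "\<bar>E + 8 / 3 * \<tau>\<bar> \<le> 32 * \<tau>\<^sup>2"
    by linarith
  have "E + \<eta> - (\<alpha> - 8 / 3) * \<tau> = (E + 8 / 3 * \<tau>) + (\<eta> - \<alpha> * \<tau>)"
    by (simp add: algebra_simps)
  then have dy: "\<bar>E + \<eta> - (\<alpha> - 8 / 3) * \<tau>\<bar> \<le> 56 * \<tau>\<^sup>2"
    using abs_add_le[OF E8 \<eta>] by simp
  have "\<bar>(w - 2 / 3) * (E + \<eta>)\<bar> \<le> 8 * \<tau> * (11 * \<tau>)"
    by (rule abs_mult_le[OF dw y])
  moreover have "8 * \<tau> * (11 * \<tau>) = 88 * \<tau>\<^sup>2"
    by (simp add: power2_eq_square)
  \<comment> \<open>Using the identity for \<open>w\<close> a second time isolates a product of two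
    small factors; the rest is (2/3)^2 times the level shift, known to leading order.\<close>
  moreover have "w - 2 / 3 - 4 / 9 * (\<alpha> - 8 / 3) * \<tau> =
      2 / 3 * ((w - 2 / 3) * (E + \<eta>)) + 4 / 9 * (E + \<eta> - (\<alpha> - 8 / 3) * \<tau>)"
    by (subst w(2)) (simp add: algebra_simps)
  moreover have "\<bar>2 / 3 * a + 4 / 9 * b\<bar> \<le> 85 * c" if "\<bar>a\<bar> \<le> 88 * c" "\<bar>b\<bar> \<le> 56 * c" for a b c :: real
    using that by linarith
  ultimately have "\<bar>w - 2 / 3 - 4 / 9 * (\<alpha> - 8 / 3) * \<tau>\<bar> \<le> 85 * \<tau>\<^sup>2"
    using dy by (simp only:)
  then have "\<bar>\<tau> * (w - 2 / 3 - 4 / 9 * (\<alpha> - 8 / 3) * \<tau>)\<bar> \<le> \<tau> * (85 * \<tau>\<^sup>2)"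
    by (rule abs_mult_le[OF \<tau>'])
  moreover have "E + 8 / 3 * \<tau> + 16 / 9 * (\<alpha> - 8 / 3) * \<tau>\<^sup>2 =
      - 4 * (\<tau> * (w - 2 / 3 - 4 / 9 * (\<alpha> - 8 / 3) * \<tau>))"
    by (simp add: E field_simps power2_eq_square)
  moreover have "\<tau> * (85 * \<tau>\<^sup>2) = 85 * \<tau> ^ 3"
    by (simp add: power2_eq_square power3_eq_cube)
  ultimately show "\<bar>E + 8 / 3 * \<tau> + 16 / 9 * (\<alpha> - 8 / 3) * \<tau>\<^sup>2\<bar> \<le> 340 * \<tau> ^ 3"
    by linarith
qed

lemma odd_hopping_energy:
  assumes t: "\<bar>t\<bar> \<le> 1 / 40" and E: "\<bar>E\<bar> \<le> 1 / 4" "E = odd_self_energy 0 t 0 E"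
  shows "\<bar>E + 8 / 3 * t\<^sup>2\<bar> \<le> 32 * t ^ 4" "\<bar>E + 8 / 3 * t\<^sup>2 - 128 / 27 * t ^ 4\<bar> \<le> 340 * t ^ 6"
proof -
  define \<tau> w where "\<tau> = t\<^sup>2" and "w = 1 / (3 / 2 - E)"
  have d: "1 \<le> 3 / 2 - E"
    using E(1) by linarith
  have \<tau>: "0 \<le> \<tau>" "\<tau> \<le> 1 / 1600"
    using square_le_of_abs_le[OF t] by (simp_all add: power2_eq_square \<tau>_def)
  have Ew: "E = - 4 * (\<tau> * w)"
    using E(2) by (simp add: odd_self_energy_def \<tau>_def w_def)
  have w: "\<bar>w\<bar> \<le> 1" "w - 2 / 3 = 2 / 3 * (w * (E + 0))"
    using resolvent_expansion[of "3 / 2" E] d by (simp_all add: w_def)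
  have "\<bar>0 - 0 * \<tau>\<bar> \<le> 24 * \<tau>\<^sup>2"
    by simp
  from hopping_energy_fourth_order[OF \<tau> Ew w this]
  show "\<bar>E + 8 / 3 * t\<^sup>2\<bar> \<le> 32 * t ^ 4" "\<bar>E + 8 / 3 * t\<^sup>2 - 128 / 27 * t ^ 4\<bar> \<le> 340 * t ^ 6"
    by (simp_all add: \<tau>_def flip: power_mult)
qed

text \<open>Here the shift is \<eta> = 12 \<tau> u with \<open>u\<close> near 1/2, so \<alpha> = 6,
  whereas the odd case has \<alpha> = 0. This changes the fourth-order term from 128/27 to - 160/27,
  and half the difference is the 16/3 of quartet hopping.\<close>

lemma even_hopping_energy:
  assumes t: "\<bar>t\<bar> \<le> 1 / 40" and E: "\<bar>E\<bar> \<le> 1 / 4" "E = even_self_energy 0 t 0 E"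
  shows "\<bar>E + 8 / 3 * t\<^sup>2\<bar> \<le> 32 * t ^ 4" "\<bar>E + 8 / 3 * t\<^sup>2 + 160 / 27 * t ^ 4\<bar> \<le> 340 * t ^ 6"
proof -
  define \<tau> where "\<tau> = t\<^sup>2"
  define u where "u = 1 / (2 - E)"
  define w where "w = even_response 0 t 0 E"
  have bounds: "\<bar>0\<bar> \<le> (1 / 40 :: real)"
    by simp
  have u: "\<bar>u\<bar> \<le> 1"
    using inv_2[OF bounds t bounds E(1)] by (simp add: u_def)
  have w: "\<bar>w\<bar> \<le> 1"
    using even_response_bounds[OF bounds t bounds E(1)] by (simp add: w_def)
  have w_eq: "w = 1 / (3 / 2 - (E + 12 * \<tau> * u))"
    by (simp add: w_def u_def \<tau>_def even_response_def algebra_simps)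
  have d: "1 \<le> 3 / 2 - (E + 12 * \<tau> * u)"
    using even_denominator[OF bounds t bounds E(1)] by (simp add: u_def \<tau>_def algebra_simps)
  have Ew: "E = - 4 * (\<tau> * w)"
    using E(2) by (simp add: even_self_energy_def w_def \<tau>_def)
  have \<tau>: "0 \<le> \<tau>" "\<tau> \<le> 1 / 1600" "\<bar>\<tau>\<bar> \<le> \<tau>"
    using square_le_of_abs_le[OF t] by (simp_all add: power2_eq_square \<tau>_def)
  have "\<bar>\<tau> * w\<bar> \<le> \<tau> * 1"
    by (rule abs_mult_le[OF \<tau>(3) w])
  then have E4: "\<bar>E\<bar> \<le> 4 * \<tau>"
    using Ew by linarith
  have "\<bar>u * E\<bar> \<le> 1 * (4 * \<tau>)"
    by (rule abs_mult_le[OF u E4])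
  then have "\<bar>\<tau> * (u * E)\<bar> \<le> \<tau> * (1 * (4 * \<tau>))"
    by (rule abs_mult_le[OF \<tau>(3)])
  moreover have "u - 1 / 2 = 1 / 2 * (u * E)"
    unfolding u_def using resolvent_expansion[of 2 E] E(1) by auto
  then have "12 * (\<tau> * (u - 1 / 2)) = 6 * (\<tau> * (u * E))"
    by simp
  then have "12 * \<tau> * u - 6 * \<tau> = 6 * (\<tau> * (u * E))"
    by (simp add: algebra_simps)
  moreover have "\<tau> * (1 * (4 * \<tau>)) = 4 * \<tau>\<^sup>2"
    by (simp add: power2_eq_square)
  ultimately have \<eta>: "\<bar>12 * \<tau> * u - 6 * \<tau>\<bar> \<le> 24 * \<tau>\<^sup>2"
    by linarith
  have "w - 2 / 3 = 2 / 3 * (w * (E + 12 * \<tau> * u))"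
    unfolding w_eq using resolvent_expansion[of "3 / 2" "E + 12 * \<tau> * u"] d by simp
  from hopping_energy_fourth_order[OF \<tau>(1,2) Ew w this \<eta>]
  show "\<bar>E + 8 / 3 * t\<^sup>2\<bar> \<le> 32 * t ^ 4" "\<bar>E + 8 / 3 * t\<^sup>2 + 160 / 27 * t ^ 4\<bar> \<le> 340 * t ^ 6"
    by (simp_all add: \<tau>_def flip: power_mult)
qed

lemma abs_half_diff_le: "\<bar>(b - a) / 2\<bar> \<le> c" if "\<bar>a\<bar> \<le> c" "\<bar>b\<bar> \<le> c" for a b c :: real
proof -
  have "\<bar>b - a\<bar> \<le> 2 * c"
    using that by linarith
  then show ?thesis
    by simp
qed

lemma abs_neg_sum_le: "\<bar>- a - b\<bar> \<le> 2 * c" if "\<bar>a\<bar> \<le> c" "\<bar>b\<bar> \<le> c" for a b c :: real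
  using that by linarith

text \<open>In half the difference of the energies - 4 V and - 8/3 t^2 cancel; in the sum they
  double, so with the 8 V of the full and empty bonds the first-order term is 16 V. For electron
  hopping alone the cancellation leaves no second-order term in \<open>t_b\<close>, so the separate
  fourth-order estimate is needed.\<close>

lemma couplings_second_order:
  obtains \<rho> where "\<rho> > 0" "\<rho> \<le> 1 / 40"
    "\<And>K t V m. \<lbrakk>\<bar>K\<bar> \<le> m; \<bar>t\<bar> \<le> m; \<bar>V\<bar> \<le> m; m \<le> \<rho>\<rbrakk> \<Longrightarrow>
      norm (t_b 1 K t V - of_real (K\<^sup>2)) \<le> 50 * m ^ 3"
    "\<And>K t V m. \<lbrakk>\<bar>K\<bar> \<le> m; \<bar>t\<bar> \<le> m; \<bar>V\<bar> \<le> m; m \<le> \<rho>\<rbrakk> \<Longrightarrow>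
      norm (V_b 1 K t V - of_real (16 * V + 2 * K\<^sup>2 + 16 / 3 * t\<^sup>2)) \<le> 100 * m ^ 3"
    "\<And>t. \<bar>t\<bar> \<le> \<rho> \<Longrightarrow> norm (t_b 1 0 t 0 - of_real (16 / 3 * t ^ 4)) \<le> 340 * t ^ 6"
    "\<And>t. \<bar>t\<bar> \<le> \<rho> \<Longrightarrow> norm (V_b 1 0 t 0 - of_real (16 / 3 * t\<^sup>2)) \<le> 64 * t ^ 4"
proof -
  obtain \<rho> where \<rho>: "\<rho> > 0" "\<rho> \<le> 1 / 40"
    and ex: "\<And>K t V. \<lbrakk>\<bar>K\<bar> \<le> \<rho>; \<bar>t\<bar> \<le> \<rho>; \<bar>V\<bar> \<le> \<rho>\<rbrakk> \<Longrightarrow> \<exists>E\<^sub>e E\<^sub>o. \<bar>E\<^sub>e\<bar> \<le> 1 / 4 \<and> \<bar>E\<^sub>o\<bar> \<le> 1 / 4 \<and>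
      E\<^sub>e = even_self_energy K t V E\<^sub>e \<and> E\<^sub>o = odd_self_energy K t V E\<^sub>o \<and>
      t_b 1 K t V = complex_of_real ((E\<^sub>o - E\<^sub>e) / 2) \<and> V_b 1 K t V = complex_of_real (8 * V - E\<^sub>e - E\<^sub>o)"
    using effective_couplings_exist by blast
  have second: "norm (t_b 1 K t V - of_real (K\<^sup>2)) \<le> 50 * m ^ 3 \<and>
      norm (V_b 1 K t V - of_real (16 * V + 2 * K\<^sup>2 + 16 / 3 * t\<^sup>2)) \<le> 100 * m ^ 3"
    if m: "\<bar>K\<bar> \<le> m" "\<bar>t\<bar> \<le> m" "\<bar>V\<bar> \<le> m" "m \<le> \<rho>" for K t V m
  proof -
    have m40: "m \<le> 1 / 40"
      using m \<rho> by linarith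
    obtain E\<^sub>e E\<^sub>o where E: "\<bar>E\<^sub>e\<bar> \<le> 1 / 4" "\<bar>E\<^sub>o\<bar> \<le> 1 / 4" "E\<^sub>e = even_self_energy K t V E\<^sub>e"
      "E\<^sub>o = odd_self_energy K t V E\<^sub>o" and c: "t_b 1 K t V = complex_of_real ((E\<^sub>o - E\<^sub>e) / 2)"
      "V_b 1 K t V = complex_of_real (8 * V - E\<^sub>e - E\<^sub>o)"
      using ex[of K t V] m by force
    have "\<bar>(E\<^sub>o - E\<^sub>e) / 2 - K\<^sup>2\<bar> \<le> 50 * m ^ 3"
      "\<bar>(8 * V - E\<^sub>e - E\<^sub>o) - (16 * V + 2 * K\<^sup>2 + 16 / 3 * t\<^sup>2)\<bar> \<le> 100 * m ^ 3"
      using abs_half_diff_le[OF even_energy_second_order[OF m(1-3) m40 E(1,3)] odd_energy_second_order[OF m(1-3) m40 E(2,4)]]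
        abs_neg_sum_le[OF even_energy_second_order[OF m(1-3) m40 E(1,3)] odd_energy_second_order[OF m(1-3) m40 E(2,4)]]
      by (simp_all add: field_simps)
    then show ?thesis
      unfolding c of_real_diff[symmetric] norm_of_real by blast
  qed
  have fourth: "norm (t_b 1 0 t 0 - of_real (16 / 3 * t ^ 4)) \<le> 340 * t ^ 6 \<and>
      norm (V_b 1 0 t 0 - of_real (16 / 3 * t\<^sup>2)) \<le> 64 * t ^ 4" if t: "\<bar>t\<bar> \<le> \<rho>" for t
  proof -
    have t40: "\<bar>t\<bar> \<le> 1 / 40"
      using t \<rho> by linarith
    obtain E\<^sub>e E\<^sub>o where E: "\<bar>E\<^sub>e\<bar> \<le> 1 / 4" "\<bar>E\<^sub>o\<bar> \<le> 1 / 4" "E\<^sub>e = even_self_energy 0 t 0 E\<^sub>e"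
      "E\<^sub>o = odd_self_energy 0 t 0 E\<^sub>o" and c: "t_b 1 0 t 0 = complex_of_real ((E\<^sub>o - E\<^sub>e) / 2)"
      "V_b 1 0 t 0 = complex_of_real (8 * 0 - E\<^sub>e - E\<^sub>o)"
      using ex[of 0 t 0] t \<rho> by force
    have "\<bar>(E\<^sub>o - E\<^sub>e) / 2 - 16 / 3 * t ^ 4\<bar> \<le> 340 * t ^ 6"
      "\<bar>(8 * 0 - E\<^sub>e - E\<^sub>o) - 16 / 3 * t\<^sup>2\<bar> \<le> 64 * t ^ 4"
      using abs_half_diff_le[OF even_hopping_energy(2)[OF t40 E(1,3)] odd_hopping_energy(2)[OF t40 E(2,4)]]
        abs_neg_sum_le[OF even_hopping_energy(1)[OF t40 E(1,3)] odd_hopping_energy(1)[OF t40 E(2,4)]]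
      by (simp_all add: field_simps)
    then show ?thesis
      unfolding c of_real_diff[symmetric] norm_of_real by blast
  qed
  show ?thesis
    using that[OF \<rho>] second fourth by blast
qed

text \<open>The lower coefficients are only existentially quantified: 0 is chosen for order zero and
  \<open>a\<close> for order one.\<close>

lemma order_coeff_2I:
  assumes d: "d > 0"
    and est: "\<And>x. \<bar>x\<bar> < d \<Longrightarrow> norm (f x - of_real (a * x + b * x\<^sup>2)) \<le> C * \<bar>x\<bar> ^ 3"
  shows "order_coeff 2 f (of_real b)"
proof -
  define c where "c k = (if k = 1 then complex_of_real a else if k = 2 then of_real b else 0)" for k :: nat
  have sum: "(\<Sum>k\<le>2. c k * of_real x ^ k) = of_real (a * x + b * x\<^sup>2)" for x :: real
    by (simp add: c_def numeral_2_eq_2)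
  have "(\<lambda>x. f x - (\<Sum>k\<le>2. c k * of_real x ^ k)) \<in> O[at 0](\<lambda>x. of_real x ^ Suc 2)"
  proof (rule bigoI[of _ C])
    have "\<forall>\<^sub>F x in at 0. \<bar>x\<bar> < d"
      using d by (auto simp: eventually_at dist_real_def)
    then show "\<forall>\<^sub>F x in at 0. norm (f x - (\<Sum>k\<le>2. c k * of_real x ^ k)) \<le> C * norm (complex_of_real x ^ Suc 2)"
    proof eventually_elim
      case (elim x)
      have "norm (complex_of_real x ^ Suc 2) = \<bar>x\<bar> ^ 3"
        unfolding norm_power norm_of_real by simp
      then show ?case
        using est[OF elim] unfolding sum by simp
    qed
  qed
  moreover have "c 2 = of_real b"
    by (simp add: c_def)
  ultimately show ?thesis
    unfolding order_coeff_def by blast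
qed

lemma couplings_order_2:
  assumes U: "U > 0"
  shows "order_coeff 2 (\<lambda>x. t_b U (x * K) (x * t) (x * V)) (of_real (K\<^sup>2 / U))"
    and "order_coeff 2 (\<lambda>x. V_b U (x * K) (x * t) (x * V)) (of_real ((2 * K\<^sup>2 + 16 / 3 * t\<^sup>2) / U))"
proof -
  obtain \<rho> where \<rho>: "\<rho> > 0"
    and tb: "\<And>K t V m. \<lbrakk>\<bar>K\<bar> \<le> m; \<bar>t\<bar> \<le> m; \<bar>V\<bar> \<le> m; m \<le> \<rho>\<rbrakk> \<Longrightarrow>
      norm (t_b 1 K t V - of_real (K\<^sup>2)) \<le> 50 * m ^ 3"
    and Vb: "\<And>K t V m. \<lbrakk>\<bar>K\<bar> \<le> m; \<bar>t\<bar> \<le> m; \<bar>V\<bar> \<le> m; m \<le> \<rho>\<rbrakk> \<Longrightarrow>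
      norm (V_b 1 K t V - of_real (16 * V + 2 * K\<^sup>2 + 16 / 3 * t\<^sup>2)) \<le> 100 * m ^ 3"
    by (rule couplings_second_order, rule that; assumption)
  \<comment> \<open>A common bound for the couplings in units of U, so that |x| M can serve as the
    \<open>m\<close> of the estimates; the 1 keeps it positive when all couplings vanish.\<close>
  define M where "M = (\<bar>K\<bar> + \<bar>t\<bar> + \<bar>V\<bar> + 1) / U"
  have M: "M > 0"
    using U by (simp add: M_def add_nonneg_pos)
  have le: "\<bar>x * z / U\<bar> \<le> \<bar>x\<bar> * M" if "z \<in> {K, t, V}" for x z
  proof -
    have "\<bar>z\<bar> / U \<le> M"
      unfolding M_def using U that by (intro divide_right_mono) auto
    then have "\<bar>x\<bar> * (\<bar>z\<bar> / U) \<le> \<bar>x\<bar> * M"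
      by (intro mult_left_mono) auto
    then show ?thesis
      using U by (simp add: abs_mult)
  qed
  have small: "\<bar>x\<bar> * M \<le> \<rho>" if "\<bar>x\<bar> < \<rho> / M" for x
    using that M by (simp add: field_simps)
  show "order_coeff 2 (\<lambda>x. t_b U (x * K) (x * t) (x * V)) (of_real (K\<^sup>2 / U))"
  proof (rule order_coeff_2I[where d = "\<rho> / M" and a = 0 and C = "U * (50 * M ^ 3)"])
    fix x assume x: "\<bar>x\<bar> < \<rho> / M"
    have "t_b U (x * K) (x * t) (x * V) - of_real (0 * x + K\<^sup>2 / U * x\<^sup>2) =
        of_real U * (t_b 1 (x * K / U) (x * t / U) (x * V / U) - of_real ((x * K / U)\<^sup>2))"
      unfolding couplings_scale(1)[OF U, of "x * K"] using U
      by (simp add: field_simps power2_eq_square)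
    also have "norm \<dots> \<le> U * (50 * (\<bar>x\<bar> * M) ^ 3)"
      unfolding norm_mult using U tb[OF le le le small[OF x]] by (intro mult_mono) auto
    finally show "norm (t_b U (x * K) (x * t) (x * V) - of_real (0 * x + K\<^sup>2 / U * x\<^sup>2)) \<le> U * (50 * M ^ 3) * \<bar>x\<bar> ^ 3"
      by (simp add: power_mult_distrib mult_ac)
  qed (use \<rho> M in auto)
  show "order_coeff 2 (\<lambda>x. V_b U (x * K) (x * t) (x * V)) (of_real ((2 * K\<^sup>2 + 16 / 3 * t\<^sup>2) / U))"
  proof (rule order_coeff_2I[where d = "\<rho> / M" and a = "16 * V" and C = "U * (100 * M ^ 3)"])
    fix x assume x: "\<bar>x\<bar> < \<rho> / M"
    have "U * (16 * (x * V / U) + 2 * (x * K / U)\<^sup>2 + 16 / 3 * (x * t / U)\<^sup>2) =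
        16 * V * x + (2 * K\<^sup>2 + 16 / 3 * t\<^sup>2) / U * x\<^sup>2"
      using U by (simp add: field_simps power2_eq_square)
    then have "V_b U (x * K) (x * t) (x * V) - of_real (16 * V * x + (2 * K\<^sup>2 + 16 / 3 * t\<^sup>2) / U * x\<^sup>2) =
        of_real U * (V_b 1 (x * K / U) (x * t / U) (x * V / U) -
          of_real (16 * (x * V / U) + 2 * (x * K / U)\<^sup>2 + 16 / 3 * (x * t / U)\<^sup>2))"
      unfolding couplings_scale(2)[OF U, of "x * K"] right_diff_distrib of_real_mult[symmetric] by simp
    also have "norm \<dots> \<le> U * (100 * (\<bar>x\<bar> * M) ^ 3)"
      unfolding norm_mult using U Vb[OF le le le small[OF x]] by (intro mult_mono) auto
    finally show "norm (V_b U (x * K) (x * t) (x * V) - of_real (16 * V * x + (2 * K\<^sup>2 + 16 / 3 * t\<^sup>2) / U * x\<^sup>2))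
        \<le> U * (100 * M ^ 3) * \<bar>x\<bar> ^ 3"
      by (simp add: power_mult_distrib mult_ac)
  qed (use \<rho> M in auto)
qed

text \<open>The second-order coefficient is a sum of squares without a term in K t or K V, so
  subtracting its value at K = 0 leaves a quantity independent of t and V.\<close>

lemma pair_hopping_second_order:
  assumes "U > 0"
  shows "pair_hopping_contribution 2 (t_b U) K (of_real (K\<^sup>2 / U))"
    and "pair_hopping_contribution 2 (V_b U) K (of_real (2 * K\<^sup>2 / U))"
proof -
  show "pair_hopping_contribution 2 (t_b U) K (of_real (K\<^sup>2 / U))"
    unfolding pair_hopping_contribution_def
  proof (intro allI exI conjI)
    fix t V
    show "order_coeff 2 (\<lambda>x. t_b U (x * K) (x * t) (x * V)) (of_real (K\<^sup>2 / U))"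
      by (rule couplings_order_2[OF assms])
    show "order_coeff 2 (\<lambda>x. t_b U 0 (x * t) (x * V)) (of_real (0\<^sup>2 / U))"
      using couplings_order_2(1)[OF assms, of 0 t V] by simp
  qed simp
  show "pair_hopping_contribution 2 (V_b U) K (of_real (2 * K\<^sup>2 / U))"
    unfolding pair_hopping_contribution_def
  proof (intro allI exI conjI)
    fix t V
    show "order_coeff 2 (\<lambda>x. V_b U (x * K) (x * t) (x * V)) (of_real ((2 * K\<^sup>2 + 16 / 3 * t\<^sup>2) / U))"
      by (rule couplings_order_2[OF assms])
    show "order_coeff 2 (\<lambda>x. V_b U 0 (x * t) (x * V)) (of_real (16 / 3 * t\<^sup>2 / U))"
      using couplings_order_2(2)[OF assms, of 0 t V] by simp
  qed (simp add: add_divide_distrib)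
qed

section \<open>Asymptotics uniform in the on-site energy\<close>

lemma eventually_weak_couplingI:
  assumes "\<rho> > 0" "\<And>U g. U > 0 \<Longrightarrow> g \<noteq> 0 \<Longrightarrow> \<bar>g / U\<bar> \<le> \<rho> \<Longrightarrow> Q (U, g)"
  shows "eventually Q weak_coupling"
  unfolding eventually_weak_coupling
  using assms by (intro exI[of _ \<rho>]) (auto simp: field_simps)

theorem proposition4:
  shows
    "(\<forall>U\<^sub>0>0. \<forall>K.
        pair_hopping_contribution 2 (t_b U\<^sub>0) K (of_real (K\<^sup>2 / U\<^sub>0)) \<and>
        pair_hopping_contribution 2 (V_b U\<^sub>0) K (of_real (2 * K\<^sup>2 / U\<^sub>0))) \<and>
     (\<lambda>(U\<^sub>0, t). t_b U\<^sub>0 0 t 0 - of_real (16 / 3 * (t ^ 4 / U\<^sub>0 ^ 3)))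
       \<in> O[weak_coupling](\<lambda>(U\<^sub>0, t). of_real (t ^ 6 / U\<^sub>0 ^ 5)) \<and>
     (\<lambda>(U\<^sub>0, t). V_b U\<^sub>0 0 t 0 - of_real (16 / 3 * (t\<^sup>2 / U\<^sub>0)))
       \<in> O[weak_coupling](\<lambda>(U\<^sub>0, t). of_real (t ^ 4 / U\<^sub>0 ^ 3)) \<and>
     (\<exists>\<epsilon>. \<epsilon> \<in> O[weak_coupling](\<lambda>(U\<^sub>0, t). of_real (t\<^sup>2 / U\<^sub>0\<^sup>2)) \<and>
       (\<forall>\<^sub>F (U\<^sub>0, t) in weak_coupling.
          V_b U\<^sub>0 0 t 0 \<noteq> 0 \<and>
          t_b U\<^sub>0 0 t 0 / V_b U\<^sub>0 0 t 0 = of_real ((t / U\<^sub>0)\<^sup>2) * (1 + \<epsilon> (U\<^sub>0, t)))) \<and>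
     (\<lambda>(U\<^sub>0, K). t_b U\<^sub>0 K 0 0) \<in> \<Theta>[weak_coupling](\<lambda>(U\<^sub>0, K). of_real (K\<^sup>2 / U\<^sub>0)) \<and>
     (\<lambda>(U\<^sub>0, K). V_b U\<^sub>0 K 0 0) \<in> \<Theta>[weak_coupling](\<lambda>(U\<^sub>0, K). of_real (K\<^sup>2 / U\<^sub>0))"
proof -
  obtain \<rho> where \<rho>: "\<rho> > 0" "\<rho> \<le> 1 / 40"
    and second_t: "\<And>K t V m. \<lbrakk>\<bar>K\<bar> \<le> m; \<bar>t\<bar> \<le> m; \<bar>V\<bar> \<le> m; m \<le> \<rho>\<rbrakk> \<Longrightarrow>
      norm (t_b 1 K t V - of_real (K\<^sup>2)) \<le> 50 * m ^ 3"
    and second_V: "\<And>K t V m. \<lbrakk>\<bar>K\<bar> \<le> m; \<bar>t\<bar> \<le> m; \<bar>V\<bar> \<le> m; m \<le> \<rho>\<rbrakk> \<Longrightarrow>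
      norm (V_b 1 K t V - of_real (16 * V + 2 * K\<^sup>2 + 16 / 3 * t\<^sup>2)) \<le> 100 * m ^ 3"
    and fourth_t: "\<And>t. \<bar>t\<bar> \<le> \<rho> \<Longrightarrow> norm (t_b 1 0 t 0 - of_real (16 / 3 * t ^ 4)) \<le> 340 * t ^ 6"
    and fourth_V: "\<And>t. \<bar>t\<bar> \<le> \<rho> \<Longrightarrow> norm (V_b 1 0 t 0 - of_real (16 / 3 * t\<^sup>2)) \<le> 64 * t ^ 4"
    by (rule couplings_second_order, rule that; assumption)

  have scale0: "t_b U 0 t 0 = of_real U * t_b 1 0 (t / U) 0" "V_b U 0 t 0 = of_real U * V_b 1 0 (t / U) 0"
    "t_b U t 0 0 = of_real U * t_b 1 (t / U) 0 0" "V_b U t 0 0 = of_real U * V_b 1 (t / U) 0 0"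
    if "U > 0" for U t :: real
    using couplings_scale[OF that, of 0 t 0] couplings_scale[OF that, of t 0 0] by simp_all

  have hop_t: "(\<lambda>(U\<^sub>0, t). t_b U\<^sub>0 0 t 0 - of_real (16 / 3 * (t ^ 4 / U\<^sub>0 ^ 3)))
      \<in> O[weak_coupling](\<lambda>(U\<^sub>0, t). of_real (t ^ 6 / U\<^sub>0 ^ 5))"
  proof (rule bigoI[of _ 340], rule eventually_weak_couplingI[OF \<rho>(1)], unfold case_prod_conv)
    fix U t :: real assume U: "U > 0" and x: "\<bar>t / U\<bar> \<le> \<rho>"
    have "U * (16 / 3 * (t / U) ^ 4) = 16 / 3 * (t ^ 4 / U ^ 3)"
      using U by (simp add: field_simps power_numeral_reduce)
    then have "t_b U 0 t 0 - of_real (16 / 3 * (t ^ 4 / U ^ 3)) =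
        of_real U * (t_b 1 0 (t / U) 0 - of_real (16 / 3 * (t / U) ^ 4))"
      unfolding scale0[OF U] right_diff_distrib of_real_mult[symmetric] by simp
    also have "norm \<dots> \<le> U * (340 * (t / U) ^ 6)"
      unfolding norm_mult using U fourth_t[OF x] by (intro mult_mono) auto
    also have "\<dots> = 340 * norm (complex_of_real (t ^ 6 / U ^ 5))"
      using U by (simp add: norm_divide norm_power) (simp add: field_simps power_numeral_reduce)
    finally show "norm (t_b U 0 t 0 - of_real (16 / 3 * (t ^ 4 / U ^ 3))) \<le> 340 * norm (complex_of_real (t ^ 6 / U ^ 5))" .
  qed

  have hop_V: "(\<lambda>(U\<^sub>0, t). V_b U\<^sub>0 0 t 0 - of_real (16 / 3 * (t\<^sup>2 / U\<^sub>0)))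
      \<in> O[weak_coupling](\<lambda>(U\<^sub>0, t). of_real (t ^ 4 / U\<^sub>0 ^ 3))"
  proof (rule bigoI[of _ 64], rule eventually_weak_couplingI[OF \<rho>(1)], unfold case_prod_conv)
    fix U t :: real assume U: "U > 0" and x: "\<bar>t / U\<bar> \<le> \<rho>"
    have "U * (16 / 3 * (t / U)\<^sup>2) = 16 / 3 * (t\<^sup>2 / U)"
      using U by (simp add: field_simps power2_eq_square)
    then have "V_b U 0 t 0 - of_real (16 / 3 * (t\<^sup>2 / U)) =
        of_real U * (V_b 1 0 (t / U) 0 - of_real (16 / 3 * (t / U)\<^sup>2))"
      unfolding scale0[OF U] right_diff_distrib of_real_mult[symmetric] by simp
    also have "norm \<dots> \<le> U * (64 * (t / U) ^ 4)"
      unfolding norm_mult using U fourth_V[OF x] by (intro mult_mono) auto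
    also have "\<dots> = 64 * norm (complex_of_real (t ^ 4 / U ^ 3))"
      using U by (simp add: norm_divide norm_power) (simp add: field_simps power_numeral_reduce)
    finally show "norm (V_b U 0 t 0 - of_real (16 / 3 * (t\<^sup>2 / U))) \<le> 64 * norm (complex_of_real (t ^ 4 / U ^ 3))" .
  qed

  \<comment> \<open>The ratio identity solved for the correction, so the identity holds by
    construction once \<open>V_b\<close> is nonzero and only the size of the correction has to be
    estimated.\<close>
  define \<epsilon> where "\<epsilon> = (\<lambda>(U, t). t_b U 0 t 0 / V_b U 0 t 0 / of_real ((t / U)\<^sup>2) - 1)"
  have ratio: "V_b U 0 t 0 \<noteq> 0 \<and> t_b U 0 t 0 / V_b U 0 t 0 = of_real ((t / U)\<^sup>2) * (1 + \<epsilon> (U, t)) \<and>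
      norm (\<epsilon> (U, t)) \<le> 100 * norm (complex_of_real (t\<^sup>2 / U\<^sup>2))"
    if U: "U > 0" and t: "t \<noteq> 0" and x\<rho>: "\<bar>t / U\<bar> \<le> \<rho>" for U t :: real
  proof -
    define x A B where "x = t / U" and "A = t_b 1 0 x 0" and "B = V_b 1 0 x 0"
    have x0: "x \<noteq> 0" and x2: "0 < x\<^sup>2"
      using U t by (simp_all add: x_def)
    have x1600: "x\<^sup>2 \<le> 1 / 1600"
      using square_le_of_abs_le[OF order_trans[OF x\<rho> \<rho>(2)]] by (simp add: x_def power_divide)
    have A: "norm (A - of_real (16 / 3 * x ^ 4)) \<le> 340 * x ^ 6"
      and B: "norm (B - of_real (16 / 3 * x\<^sup>2)) \<le> 64 * x ^ 4"
      using fourth_t[OF x\<rho>] fourth_V[OF x\<rho>] by (simp_all add: A_def B_def x_def)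
    have x4: "x ^ 4 = x\<^sup>2 * x\<^sup>2" and x6: "x ^ 6 = x\<^sup>2 * x ^ 4"
      by (simp_all flip: power_add)
    \<comment> \<open>The error 64 x^4 is at most x^2 / 25, which leaves |B| >= (16/3 - 1/25) x^2 >
      5 x^2.\<close>
    have "x ^ 4 \<le> 1 / 1600 * x\<^sup>2"
      unfolding x4 using x1600 by (intro mult_right_mono) auto
    moreover have "norm (complex_of_real (16 / 3 * x\<^sup>2)) = 16 / 3 * x\<^sup>2"
      unfolding norm_of_real by simp
    moreover have "norm (complex_of_real (16 / 3 * x\<^sup>2)) \<le> norm B + norm (B - of_real (16 / 3 * x\<^sup>2))"
      by (metis norm_minus_commute norm_triangle_sub)
    ultimately have B5: "5 * x\<^sup>2 \<le> norm B"
      using B x2 by linarith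
    then have B0: "B \<noteq> 0"
      using x2 by auto
    have x4_complex: "complex_of_real (16 / 3 * x ^ 4) = of_real (x\<^sup>2) * of_real (16 / 3 * x\<^sup>2)"
      unfolding of_real_mult[symmetric] x4 by (subst mult.left_commute) (rule refl)
    \<comment> \<open>\<open>A\<close> and x^2 \<open>B\<close> have the same leading term, so only
      the errors remain, with constant 340 + 64 = 404; dividing by x^2 |B| >= 5 x^4 gives a
      correction of order x^2.\<close>
    have "A - of_real (x\<^sup>2) * B = (A - of_real (16 / 3 * x ^ 4)) - of_real (x\<^sup>2) * (B - of_real (16 / 3 * x\<^sup>2))"
      unfolding x4_complex by (simp only: right_diff_distrib) simp
    also have "norm \<dots> \<le> norm (A - of_real (16 / 3 * x ^ 4)) + norm (of_real (x\<^sup>2) * (B - of_real (16 / 3 * x\<^sup>2)))"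
      by (rule norm_triangle_ineq4)
    also have "\<dots> \<le> 340 * x ^ 6 + x\<^sup>2 * (64 * x ^ 4)"
      unfolding norm_mult norm_of_real using A B by (intro add_mono mult_mono) auto
    also have "x\<^sup>2 * (64 * x ^ 4) = 64 * x ^ 6"
      unfolding x6 by (rule mult.left_commute)
    finally have num: "norm (A - of_real (x\<^sup>2) * B) \<le> 404 * x ^ 6"
      by simp
    have ratio_x: "t_b U 0 t 0 / V_b U 0 t 0 = A / B"
      unfolding scale0[OF U] A_def B_def x_def using U by simp
    have "\<epsilon> (U, t) = (A - of_real (x\<^sup>2) * B) / (of_real (x\<^sup>2) * B)"
      unfolding \<epsilon>_def case_prod_conv ratio_x x_def[symmetric] using x0 B0 by (simp add: field_simps)
    then have "norm (\<epsilon> (U, t)) = norm (A - of_real (x\<^sup>2) * B) / (x\<^sup>2 * norm B)"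
      by (simp add: norm_divide norm_mult norm_power)
    also have "\<dots> \<le> 404 * x ^ 6 / (x\<^sup>2 * (5 * x\<^sup>2))"
      using num B5 x2 by (intro frac_le mult_left_mono) auto
    also have "\<dots> = 404 / 5 * x\<^sup>2"
      using x0 by (simp add: field_simps power_numeral_reduce)
    also have "\<dots> \<le> 100 * x\<^sup>2"
      using x2 by simp
    finally have "norm (\<epsilon> (U, t)) \<le> 100 * norm (complex_of_real (t\<^sup>2 / U\<^sup>2))"
      unfolding norm_of_real by (simp add: x_def power_divide)
    moreover have "V_b U 0 t 0 \<noteq> 0"
      unfolding scale0[OF U] using B0 U by (simp add: B_def x_def)
    moreover have "t_b U 0 t 0 / V_b U 0 t 0 = of_real ((t / U)\<^sup>2) * (1 + \<epsilon> (U, t))"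
      using U t by (simp add: \<epsilon>_def)
    ultimately show ?thesis
      by blast
  qed
  have hop_ratio: "\<exists>\<epsilon>. \<epsilon> \<in> O[weak_coupling](\<lambda>(U\<^sub>0, t). of_real (t\<^sup>2 / U\<^sub>0\<^sup>2)) \<and>
       (\<forall>\<^sub>F (U\<^sub>0, t) in weak_coupling.
          V_b U\<^sub>0 0 t 0 \<noteq> 0 \<and>
          t_b U\<^sub>0 0 t 0 / V_b U\<^sub>0 0 t 0 = of_real ((t / U\<^sub>0)\<^sup>2) * (1 + \<epsilon> (U\<^sub>0, t)))"
  proof (intro exI[of _ \<epsilon>] conjI)
    show "\<epsilon> \<in> O[weak_coupling](\<lambda>(U\<^sub>0, t). of_real (t\<^sup>2 / U\<^sub>0\<^sup>2))"
      by (rule bigoI[of _ 100], rule eventually_weak_couplingI[OF \<rho>(1)]) (use ratio in auto)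
    show "\<forall>\<^sub>F (U\<^sub>0, t) in weak_coupling. V_b U\<^sub>0 0 t 0 \<noteq> 0 \<and>
          t_b U\<^sub>0 0 t 0 / V_b U\<^sub>0 0 t 0 = of_real ((t / U\<^sub>0)\<^sup>2) * (1 + \<epsilon> (U\<^sub>0, t))"
      by (rule eventually_weak_couplingI[OF \<rho>(1)]) (use ratio in auto)
  qed

  \<comment> \<open>For |x| <= 1/100 the cubic errors 50 |x|^3 and 100 |x|^3 are at most half of the
    leading terms x^2 and 2 x^2, which gives the two-sided bounds.\<close>
  define r where "r = min \<rho> (1 / 100)"
  have r: "r > 0"
    using \<rho> by (simp add: r_def)
  have pair: "1 / 2 * (K\<^sup>2 / U) \<le> norm (t_b U K 0 0)" "norm (t_b U K 0 0) \<le> 2 * (K\<^sup>2 / U)"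
    "1 / 2 * (K\<^sup>2 / U) \<le> norm (V_b U K 0 0)" "norm (V_b U K 0 0) \<le> 3 * (K\<^sup>2 / U)"
    if U: "U > 0" and xr: "\<bar>K / U\<bar> \<le> r" for U K :: real
  proof -
    define x where "x = K / U"
    have x: "\<bar>x\<bar> \<le> \<rho>" "\<bar>x\<bar> \<le> 1 / 100"
      using xr by (simp_all add: x_def r_def)
    have "\<bar>x\<bar> ^ 3 = \<bar>x\<bar> * x\<^sup>2"
      by (simp add: power3_eq_cube power2_eq_square)
    also have "\<dots> \<le> 1 / 100 * x\<^sup>2"
      using x by (intro mult_right_mono) auto
    finally have x3: "\<bar>x\<bar> ^ 3 \<le> 1 / 100 * x\<^sup>2" .
    have "norm (t_b 1 x 0 0 - of_real (x\<^sup>2)) \<le> 1 / 2 * x\<^sup>2"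
      using second_t[of x "\<bar>x\<bar>" 0 0] x x3 by simp
    moreover have "norm (V_b 1 x 0 0 - of_real (2 * x\<^sup>2)) \<le> x\<^sup>2"
      using second_V[of x "\<bar>x\<bar>" 0 0] x x3 by simp
    moreover have "norm (complex_of_real (x\<^sup>2)) = x\<^sup>2" "norm (complex_of_real (2 * x\<^sup>2)) = 2 * x\<^sup>2"
      unfolding norm_of_real by simp_all
    ultimately have n: "1 / 2 * x\<^sup>2 \<le> norm (t_b 1 x 0 0)" "norm (t_b 1 x 0 0) \<le> 2 * x\<^sup>2"
      "1 / 2 * x\<^sup>2 \<le> norm (V_b 1 x 0 0)" "norm (V_b 1 x 0 0) \<le> 3 * x\<^sup>2"
      using norm_triangle_ineq2[of "t_b 1 x 0 0" "of_real (x\<^sup>2)"] norm_triangle_ineq3[of "t_b 1 x 0 0" "of_real (x\<^sup>2)"]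
        norm_triangle_ineq2[of "V_b 1 x 0 0" "of_real (2 * x\<^sup>2)"] norm_triangle_ineq3[of "V_b 1 x 0 0" "of_real (2 * x\<^sup>2)"]
        zero_le_power2[of x] by linarith+
    have Ux: "K\<^sup>2 / U = U * x\<^sup>2"
      using U by (simp add: x_def power2_eq_square)
    have norms: "norm (t_b U K 0 0) = U * norm (t_b 1 x 0 0)" "norm (V_b U K 0 0) = U * norm (V_b 1 x 0 0)"
      using U by (simp_all add: scale0(3,4)[OF U, of K] norm_mult x_def)
    show "1 / 2 * (K\<^sup>2 / U) \<le> norm (t_b U K 0 0)" "norm (t_b U K 0 0) \<le> 2 * (K\<^sup>2 / U)"
      "1 / 2 * (K\<^sup>2 / U) \<le> norm (V_b U K 0 0)" "norm (V_b U K 0 0) \<le> 3 * (K\<^sup>2 / U)"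
      unfolding norms Ux using n[THEN mult_left_mono, of U] U by (simp_all add: mult.left_commute)
  qed
  have norm_g: "norm (complex_of_real (K\<^sup>2 / U)) = K\<^sup>2 / U" if "U > 0" for K U :: real
    unfolding norm_of_real using that by simp
  have pair_t: "(\<lambda>(U\<^sub>0, K). t_b U\<^sub>0 K 0 0) \<in> \<Theta>[weak_coupling](\<lambda>(U\<^sub>0, K). of_real (K\<^sup>2 / U\<^sub>0))"
  proof (rule bigthetaI)
    show "(\<lambda>(U\<^sub>0, K). t_b U\<^sub>0 K 0 0) \<in> O[weak_coupling](\<lambda>(U\<^sub>0, K). of_real (K\<^sup>2 / U\<^sub>0))"
      by (rule bigoI[of _ 2], rule eventually_weak_couplingI[OF r])
        (unfold case_prod_conv, subst norm_g, assumption, rule pair, assumption+)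
    show "(\<lambda>(U\<^sub>0, K). t_b U\<^sub>0 K 0 0) \<in> \<Omega>[weak_coupling](\<lambda>(U\<^sub>0, K). of_real (K\<^sup>2 / U\<^sub>0))"
      by (rule landau_omega.bigI[of "1 / 2"], simp, rule eventually_weak_couplingI[OF r])
        (unfold case_prod_conv, subst norm_g, assumption, rule pair, assumption+)
  qed
  have pair_V: "(\<lambda>(U\<^sub>0, K). V_b U\<^sub>0 K 0 0) \<in> \<Theta>[weak_coupling](\<lambda>(U\<^sub>0, K). of_real (K\<^sup>2 / U\<^sub>0))"
  proof (rule bigthetaI)
    show "(\<lambda>(U\<^sub>0, K). V_b U\<^sub>0 K 0 0) \<in> O[weak_coupling](\<lambda>(U\<^sub>0, K). of_real (K\<^sup>2 / U\<^sub>0))"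
      by (rule bigoI[of _ 3], rule eventually_weak_couplingI[OF r])
        (unfold case_prod_conv, subst norm_g, assumption, rule pair, assumption+)
    show "(\<lambda>(U\<^sub>0, K). V_b U\<^sub>0 K 0 0) \<in> \<Omega>[weak_coupling](\<lambda>(U\<^sub>0, K). of_real (K\<^sup>2 / U\<^sub>0))"
      by (rule landau_omega.bigI[of "1 / 2"], simp, rule eventually_weak_couplingI[OF r])
        (unfold case_prod_conv, subst norm_g, assumption, rule pair, assumption+)
  qed
  show ?thesis
    using pair_hopping_second_order hop_t hop_V hop_ratio pair_t pair_V by blast
qed

end
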